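(* Let $\Omega\subset\mathbb{H}$ be a circular domain and let $f,g\in\mathcal{SEM}(\Omega)\setminus\mathcal{SEM}_{\mathbb{R}}(\Omega)$. Let $\mathcal{S}_{f,g}(\chi)=f*\chi+\chi*g$ be the associated Sylvester operator on $\mathcal{SEM}(\Omega)$. Then $\operatorname{rk}(\mathcal{S}_{f,g})$ is always strictly greater than $1$. Moreover: (a) $\operatorname{rk}(\mathcal{S}_{f,g})=4$ if and only if $(f_{0}+g_{0})^{2}[(f_{0}+g_{0})^{2}+2(f_{v}^{s}+g_{v}^{s})]+(f_{v}^{s}-g_{v}^{s})^{2}\not\equiv 0$. (b) The following are equivalent: (i) $\operatorname{rk}(\mathcal{S}_{f,g})=3$; (ii) $(f_{0}+g_{0})^{2}[(f_{0}+g_{0})^{2}+2(f_{v}^{s}+g_{v}^{s})]+(f_{v}^{s}-g_{v}^{s})^{2}\equiv 0$ and $f_{0}+g_{0}\not\equiv 0$; (iii) $\ker(\mathcal{S}_{f,g})\neq\{0\}$ and every nonzero element of $\ker(\mathcal{S}_{f,g})$ is a zero divisor. This case can occur only if $\Omega$ is a product domain. (c) The following are equivalent: (i) $\operatorname{rk}(\mathcal{S}_{f,g})=2$; (ii) $f\simeq -g$; (iii) $f_{0}+g_{0}\equiv 0$ and $f_{v}^{s}\equiv g_{v}^{s}$; (iv) $\ker(\mathcal{S}_{f,g})$ contains at least one invertible element of $\mathcal{SEM}(\Omega)$. (d) In case (c), $\ker(\mathcal{S}_{f,g})$ also contains zero divisors if and only if $\Omega$ is a product domain and one of the following holds: (1)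 $f_{v}=g_{v}$ and $f_{v}^{s}$ has a square root; (2) $f_{v}\neq g_{v}$ and $(f_{v}-g_{v})^{s}\equiv 0$; (3) $(f_{v}-g_{v})^{s}\not\equiv 0$ and $f_{v}^{s}$ has a square root.
   Context: $\mathbb{H}$ denotes the quaternions, $q^c$ the quaternionic conjugate, $\mathbb{S}=\{q\in\mathbb{H}: q^2=-1\}$, and $\mathbb{C}_I=\mathbb{R}+I\mathbb{R}$ for $I\in\mathbb{S}$. For $q=x+Iy$ put $\mathbb{S}_q=\{x+Jy: J\in\mathbb{S}\}$. A domain (connected open set) $\Omega\subset\mathbb{H}$ is circular if $\mathbb{S}_q\subset\Omega$ for all $q\in\Omega$; a circular domain is a slice domain if $\Omega\cap\mathbb{R}\neq\emptyset$ and a product domain otherwise. A function $f$ on a circular open set $\Omega$ is slice regular ($f\in\mathcal{SR}(\Omega)$) if $f(x+Iy)=F_1(x,y)+IF_2(x,y)$ for all $x+Iy\in\Omega$ ($x,y\in\mathbb{R}$, $I\in\mathbb{S}$), with $\mathbb{H}$-valued $F_1$ even in $y$ and $F_2$ odd in $y$, and each restriction $f|_{\Omega\cap\mathbb{C}_I}$ is real differentiable with $\frac12(\partial_x+I\partial_y)f|_{\Omega\cap\mathbb{C}_I}\equiv0$. The $*$-product is $(f*g)(q)=0$ if $f(q)=0$ and $(f*g)(q)=f(q)\,g(f(q)^{-1}qf(q))$ otherwise. $f$ is slice preserving if $f(\Omega\cap\mathbb{C}_I)\subset\mathbb{C}_I$ for every $I\in\mathbb{S}$. A function $f$ is slice semi-regular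 on $\Omega$ ($f\in\mathcal{SEM}(\Omega)$) if there is a circular open $\widetilde\Omega\subseteq\Omega$ with $f\in\mathcal{SR}(\widetilde\Omega)$ and each point of $\Omega\setminus\widetilde\Omega$ is a pole or a removable singularity; i.e. $\Omega\setminus\widetilde\Omega$ consists of isolated real points and isolated spheres $\mathbb{S}_p$, near each of which $\Delta_p^m f$ extends slice regularly for some integer $m\ge0$, where $\Delta_p(q)=q^2-2\mathrm{Re}(p)q+|p|^2$. Functions agreeing where both are defined are identified. $\mathcal{SEM}_{\mathbb{R}}(\Omega)$ is the subset of slice preserving elements; it is a field and the center of the algebra $(\mathcal{SEM}(\Omega),+,* )$, which is a 4-dimensional vector space over it: for an orthonormal basis $(1,I,J,K)$ of $\mathbb{H}$, each $f$ is uniquely $f_0+f_1I+f_2J+f_3K$ with $f_\ell\in\mathcal{SEM}_{\mathbb{R}}(\Omega)$. Set $f^c=f_0-(f_1I+f_2J+f_3K)$, $f^s=f*f^c=f_0^2+f_1^2+f_2^2+f_3^2$, $f_0=(f+f^c)/2$, $f_v=f-f_0$, so $f_v^s=(f_v)^s=f_1^2+f_2^2+f_3^2$. $f$ is $*$-invertible iff $f^s\not\equiv0$, with $f^{-*}=(f^s)^{-1}f^c$. A zero divisor is $f\not\equiv0$ with $f^s\equiv0$ (equivalently $f\not\equiv 0$ and $f*g\equiv0$ for some $g\not\equiv0$). $\mathcal{S}_{f,g}$ is $\mathcal{SEM}_{\mathbb{R}}(\Omega)$-linear and $\operatorname{rk}$ is its rank over $\mathcal{SEM}_{\mathbb{R}}(\Omega)$.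 We write $f\simeq g$ if there is a $*$-invertible $h\in\mathcal{SEM}(\Omega)$ with $f=h^{-*}*g*h$. "Has a square root" means being the square of an element of $\mathcal{SEM}_{\mathbb{R}}(\Omega)$. *)

theory Defs
  imports "HOL-Analysis.Analysis" "HOL-Algebra.Embedded_Algebras"
begin

section \<open>Quaternions\<close>

datatype quat = Quat (qre: real) (qi: real) (qj: real) (qk: real)

lemma quat_eq_iff:
  "p = q \<longleftrightarrow> qre p = qre q \<and> qi p = qi q \<and> qj p = qj q \<and> qk p = qk q"
  by (cases p; cases q) auto

instantiation quat :: real_vector
begin

definition "0 = Quat 0 0 0 0"
definition "p + q = Quat (qre p + qre q) (qi p + qi q) (qj p + qj q) (qk p + qk q)"
definition "- p = Quat (- qre p) (- qi p) (- qj p) (- qk p)"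
definition "p - q = Quat (qre p - qre q) (qi p - qi q) (qj p - qj q) (qk p - qk q)"
definition "scaleR r p = Quat (r * qre p) (r * qi p) (r * qj p) (r * qk p)"

instance
  by standard
    (simp_all add: zero_quat_def plus_quat_def uminus_quat_def minus_quat_def
      scaleR_quat_def quat_eq_iff algebra_simps)

end

instantiation quat :: real_inner
begin

definition "inner p q = qre p * qre q + qi p * qi q + qj p * qj q + qk p * qk q"
definition "norm (p :: quat) = sqrt (inner p p)"
definition "sgn (p :: quat) = p /\<^sub>R norm p"
definition "dist (p :: quat) q = norm (p - q)"
definition "(uniformity :: (quat \<times> quat) filter) = (INF e\<in>{0<..}. principal {(p, q). dist p q < e})"
definition "open (U :: quat set) \<longleftrightarrow> (\<forall>x\<in>U. eventually (\<lambda>(x', y). x' = x \<longrightarrow> y \<in> U) uniformity)"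

instance
proof
  fix p q r :: quat and a :: real
  show "inner p q = inner q p"
    by (simp add: inner_quat_def algebra_simps)
  show "inner (p + q) r = inner p r + inner q r"
    by (simp add: inner_quat_def plus_quat_def algebra_simps)
  show "inner (scaleR a p) q = a * inner p q"
    by (simp add: inner_quat_def scaleR_quat_def algebra_simps)
  show "0 \<le> inner p p"
    by (simp add: inner_quat_def)
  show "inner p p = 0 \<longleftrightarrow> p = 0"
    by (simp add: inner_quat_def zero_quat_def quat_eq_iff add_nonneg_eq_0_iff)
qed (simp_all only: norm_quat_def sgn_quat_def dist_quat_def uniformity_quat_def open_quat_def)

end

instantiation quat :: real_normed_div_algebra
begin

definition "1 = Quat 1 0 0 0"
definition "p * q = Quat
  (qre p * qre q - qi p * qi q - qj p * qj q - qk p * qk q)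
  (qre p * qi q + qi p * qre q + qj p * qk q - qk p * qj q)
  (qre p * qj q - qi p * qk q + qj p * qre q + qk p * qi q)
  (qre p * qk q + qi p * qj q - qj p * qi q + qk p * qre q)"
definition "inverse (p :: quat) = Quat (qre p) (- qi p) (- qj p) (- qk p) /\<^sub>R inner p p"
definition "p div (q :: quat) = p * inverse q"

instance
proof
  fix p q r :: quat and a :: real
  note quat_defs = zero_quat_def plus_quat_def scaleR_quat_def one_quat_def times_quat_def
  show "p * q * r = p * (q * r)" "(p + q) * r = p * r + q * r" "p * (q + r) = p * q + p * r"
    "scaleR a p * q = scaleR a (p * q)" "p * scaleR a q = scaleR a (p * q)"
    "1 * p = p" "p * 1 = p" "(0 :: quat) \<noteq> 1"
    by (simp_all add: quat_defs quat_eq_iff algebra_simps)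
  have c: "Quat (qre p) (- qi p) (- qj p) (- qk p) * p = inner p p *\<^sub>R 1"
    "p * Quat (qre p) (- qi p) (- qj p) (- qk p) = inner p p *\<^sub>R 1"
    by (simp_all add: quat_defs inner_quat_def quat_eq_iff algebra_simps)
  have s: "scaleR a p * q = scaleR a (p * q)" "p * scaleR a q = scaleR a (p * q)" for p q :: quat and a
    by (simp_all add: quat_defs quat_eq_iff algebra_simps)
  show "inverse p * p = 1" "p * inverse p = 1" if "p \<noteq> 0"
    using that by (simp_all add: inverse_quat_def s c)
  show "p div q = p * inverse q"
    by (simp add: divide_quat_def)
  show "inverse (0 :: quat) = 0"
    by (simp add: inverse_quat_def zero_quat_def scaleR_quat_def)
  have "inner (p * q) (p * q) = inner p p * inner q q"
    by (simp add: times_quat_def inner_quat_def algebra_simps)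
  then show "norm (p * q) = norm p * norm q"
    by (simp add: norm_quat_def real_sqrt_mult)
qed

end


section \<open>Circular domains\<close>

definition imag_units :: "quat set" where
  "imag_units = {q. q\<^sup>2 = - 1}"

definition slice_point :: "quat \<Rightarrow> real \<Rightarrow> real \<Rightarrow> quat" where
  "slice_point I x y = of_real x + I * of_real y"

definition complex_slice :: "quat \<Rightarrow> quat set" where
  "complex_slice I = {slice_point I x y | x y. True}"

definition sphere_of :: "quat \<Rightarrow> quat set" where
  "sphere_of q = {slice_point J x y | x y I J.
     I \<in> imag_units \<and> J \<in> imag_units \<and> q = slice_point I x y}"

definition circular :: "quat set \<Rightarrow> bool" where
  "circular \<Omega> \<longleftrightarrow> (\<forall>q\<in>\<Omega>. sphere_of q \<subseteq> \<Omega>)"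

definition circular_domain :: "quat set \<Rightarrow> bool" where
  "circular_domain \<Omega> \<longleftrightarrow> open \<Omega> \<and> connected \<Omega> \<and> circular \<Omega>"

definition slice_domain :: "quat set \<Rightarrow> bool" where
  "slice_domain \<Omega> \<longleftrightarrow> circular_domain \<Omega> \<and> \<Omega> \<inter> \<real> \<noteq> {}"

definition product_domain :: "quat set \<Rightarrow> bool" where
  "product_domain \<Omega> \<longleftrightarrow> circular_domain \<Omega> \<and> \<not> slice_domain \<Omega>"


section \<open>Slice regular and slice semi-regular functions\<close>

text \<open>Functions are total on the quaternions; only the values on the stated domain matter.\<close>

definition slice_regular :: "quat set \<Rightarrow> (quat \<Rightarrow> quat) \<Rightarrow> bool" where
  "slice_regular \<Omega> f \<longleftrightarrow>
     (\<exists>F1 F2 :: real \<Rightarrow> real \<Rightarrow> quat.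
        (\<forall>x y. F1 x (- y) = F1 x y \<and> F2 x (- y) = - F2 x y) \<and>
        (\<forall>I\<in>imag_units. \<forall>x y. slice_point I x y \<in> \<Omega> \<longrightarrow>
           f (slice_point I x y) = F1 x y + I * F2 x y)) \<and>
     (\<forall>I\<in>imag_units. \<forall>x y. slice_point I x y \<in> \<Omega> \<longrightarrow>
        (\<exists>L. ((\<lambda>(s, t). f (slice_point I s t)) has_derivative L) (at (x, y)) \<and>
             (L (1, 0) + I * L (0, 1)) /\<^sub>R 2 = 0))"

definition slice_preserving :: "quat set \<Rightarrow> (quat \<Rightarrow> quat) \<Rightarrow> bool" where
  "slice_preserving \<Omega> f \<longleftrightarrow>
     (\<forall>I\<in>imag_units. f ` (\<Omega> \<inter> complex_slice I) \<subseteq> complex_slice I)"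

definition star :: "(quat \<Rightarrow> quat) \<Rightarrow> (quat \<Rightarrow> quat) \<Rightarrow> quat \<Rightarrow> quat" where
  "star f g q = (if f q = 0 then 0 else f q * g (inverse (f q) * q * f q))"

definition Delta :: "quat \<Rightarrow> quat \<Rightarrow> quat" where
  "Delta p q = q\<^sup>2 - of_real (2 * qre p) * q + of_real ((norm p)\<^sup>2)"

text \<open>
  \<open>semiregular_on \<Omega> D f\<close>: \<open>f\<close> is regular on \<open>D\<close>, and each point \<open>p\<close> of \<open>\<Omega> - D\<close> lies on an
  isolated sphere (a single point when \<open>p\<close> is real) which is a pole or a removable singularity.
\<close>

definition semiregular_on :: "quat set \<Rightarrow> quat set \<Rightarrow> (quat \<Rightarrow> quat) \<Rightarrow> bool" where
  "semiregular_on \<Omega> D f \<longleftrightarrow>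
     D \<subseteq> \<Omega> \<and> open D \<and> circular D \<and> slice_regular D f \<and>
     (\<forall>p\<in>\<Omega> - D. \<exists>U m h. p \<in> U \<and> U \<subseteq> \<Omega> \<and> open U \<and> circular U \<and> U - sphere_of p \<subseteq> D \<and>
        slice_regular U h \<and> (\<forall>q\<in>U - sphere_of p. h q = Delta p q ^ m * f q))"


section \<open>The algebra of slice semi-regular functions\<close>

text \<open>
  The values of a representative at its singularities are arbitrary; representatives that agree
  wherever both are regular are identified.
\<close>

definition SEM_rel :: "quat set \<Rightarrow> ((quat \<Rightarrow> quat) \<times> (quat \<Rightarrow> quat)) set" where
  "SEM_rel \<Omega> = {(f, g). \<exists>D E. semiregular_on \<Omega> D f \<and> semiregular_on \<Omega> E g \<and>
     (\<forall>q\<in>D \<inter> E. f q = g q)}"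

definition SEM_class :: "quat set \<Rightarrow> (quat \<Rightarrow> quat) \<Rightarrow> (quat \<Rightarrow> quat) set" where
  "SEM_class \<Omega> f = SEM_rel \<Omega> `` {f}"

definition SEM :: "quat set \<Rightarrow> (quat \<Rightarrow> quat) set ring" where
  "SEM \<Omega> =
    \<lparr>carrier = {f. \<exists>D. semiregular_on \<Omega> D f} // SEM_rel \<Omega>,
     monoid.mult = (\<lambda>A B. \<Union>f\<in>A. \<Union>g\<in>B. SEM_class \<Omega> (star f g)),
     one = SEM_class \<Omega> (\<lambda>_. 1),
     zero = SEM_class \<Omega> (\<lambda>_. 0),
     add = (\<lambda>A B. \<Union>f\<in>A. \<Union>g\<in>B. SEM_class \<Omega> (\<lambda>q. f q + g q))\<rparr>"

definition SEM_R :: "quat set \<Rightarrow> (quat \<Rightarrow> quat) set set" where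
  "SEM_R \<Omega> = {SEM_class \<Omega> f | f D. semiregular_on \<Omega> D f \<and> slice_preserving D f}"

definition SEM_const :: "quat set \<Rightarrow> quat \<Rightarrow> (quat \<Rightarrow> quat) set" where
  "SEM_const \<Omega> c = SEM_class \<Omega> (\<lambda>_. c)"

text \<open>
  The component \<open>f\<^sub>0\<close> in the decomposition over the standard basis; it does not depend on the
  choice of the orthonormal basis \<open>(1, I, J, K)\<close>.
\<close>

definition SEM_re :: "quat set \<Rightarrow> (quat \<Rightarrow> quat) set \<Rightarrow> (quat \<Rightarrow> quat) set" where
  "SEM_re \<Omega> f = (THE f0. f0 \<in> SEM_R \<Omega> \<and>
     (\<exists>f1\<in>SEM_R \<Omega>. \<exists>f2\<in>SEM_R \<Omega>. \<exists>f3\<in>SEM_R \<Omega>.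
        f = f0 \<oplus>\<^bsub>SEM \<Omega>\<^esub> f1 \<otimes>\<^bsub>SEM \<Omega>\<^esub> SEM_const \<Omega> (Quat 0 1 0 0)
               \<oplus>\<^bsub>SEM \<Omega>\<^esub> f2 \<otimes>\<^bsub>SEM \<Omega>\<^esub> SEM_const \<Omega> (Quat 0 0 1 0)
               \<oplus>\<^bsub>SEM \<Omega>\<^esub> f3 \<otimes>\<^bsub>SEM \<Omega>\<^esub> SEM_const \<Omega> (Quat 0 0 0 1)))"

definition SEM_vec :: "quat set \<Rightarrow> (quat \<Rightarrow> quat) set \<Rightarrow> (quat \<Rightarrow> quat) set" where
  "SEM_vec \<Omega> f = f \<ominus>\<^bsub>SEM \<Omega>\<^esub> SEM_re \<Omega> f"

definition SEM_conj :: "quat set \<Rightarrow> (quat \<Rightarrow> quat) set \<Rightarrow> (quat \<Rightarrow> quat) set" where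
  "SEM_conj \<Omega> f = SEM_re \<Omega> f \<ominus>\<^bsub>SEM \<Omega>\<^esub> SEM_vec \<Omega> f"

definition SEM_symm :: "quat set \<Rightarrow> (quat \<Rightarrow> quat) set \<Rightarrow> (quat \<Rightarrow> quat) set" where
  "SEM_symm \<Omega> f = f \<otimes>\<^bsub>SEM \<Omega>\<^esub> SEM_conj \<Omega> f"

definition SEM_zero_divisor :: "quat set \<Rightarrow> (quat \<Rightarrow> quat) set \<Rightarrow> bool" where
  "SEM_zero_divisor \<Omega> f \<longleftrightarrow> f \<in> carrier (SEM \<Omega>) \<and>
     f \<noteq> \<zero>\<^bsub>SEM \<Omega>\<^esub> \<and> SEM_symm \<Omega> f = \<zero>\<^bsub>SEM \<Omega>\<^esub>"

definition SEM_equiv :: "quat set \<Rightarrow> (quat \<Rightarrow> quat) set \<Rightarrow> (quat \<Rightarrow> quat) set \<Rightarrow> bool" where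
  "SEM_equiv \<Omega> f g \<longleftrightarrow>
     (\<exists>h\<in>Units (SEM \<Omega>). f = m_inv (SEM \<Omega>) h \<otimes>\<^bsub>SEM \<Omega>\<^esub> g \<otimes>\<^bsub>SEM \<Omega>\<^esub> h)"

definition SEM_has_sqrt :: "quat set \<Rightarrow> (quat \<Rightarrow> quat) set \<Rightarrow> bool" where
  "SEM_has_sqrt \<Omega> f \<longleftrightarrow> (\<exists>h\<in>SEM_R \<Omega>. f = h [^]\<^bsub>SEM \<Omega>\<^esub> (2::nat))"


section \<open>The Sylvester operator\<close>

definition Sylvester ::
    "quat set \<Rightarrow> (quat \<Rightarrow> quat) set \<Rightarrow> (quat \<Rightarrow> quat) set \<Rightarrow> (quat \<Rightarrow> quat) set \<Rightarrow> (quat \<Rightarrow> quat) set"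
  where "Sylvester \<Omega> f g X = f \<otimes>\<^bsub>SEM \<Omega>\<^esub> X \<oplus>\<^bsub>SEM \<Omega>\<^esub> X \<otimes>\<^bsub>SEM \<Omega>\<^esub> g"

definition SEM_ker ::
    "quat set \<Rightarrow> ((quat \<Rightarrow> quat) set \<Rightarrow> (quat \<Rightarrow> quat) set) \<Rightarrow> (quat \<Rightarrow> quat) set set"
  where "SEM_ker \<Omega> T = a_kernel (SEM \<Omega>) (SEM \<Omega>) T"

definition SEM_rk :: "quat set \<Rightarrow> ((quat \<Rightarrow> quat) set \<Rightarrow> (quat \<Rightarrow> quat) set) \<Rightarrow> nat"
  where "SEM_rk \<Omega> T = ring.dim (SEM \<Omega>) (SEM_R \<Omega>) (T ` carrier (SEM \<Omega>))"

end

theory Submission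
  imports Defs "HOL-Complex_Analysis.Complex_Analysis"
begin

text \<open>
  A slice regular function \<open>F\<^sub>1 + I F\<^sub>2\<close> is the same as its stem \<open>F\<^sub>1 + \<i> F\<^sub>2\<close>, a function of one complex variable with values in
  the complexified quaternions that commutes with conjugation. Regularity means that the four complex coordinates of the
  stem are holomorphic, the \<open>*\<close>-product is the pointwise product of stems, and semi-regular functions correspond to
  meromorphic stems (\<open>semiregular_unstem\<close>, \<open>semiregular_stem\<close>, \<open>unstem_star\<close>). Hence the algebra of semi-regular functions is
  the quaternion algebra over the field \<open>F\<close> of conjugation-symmetric meromorphic functions on the planar section of the
  domain. Expanding at a base point at which the identity theorem holds (\<open>base_point_exists\<close>) turns classes of functions
  into quaternions over the complex Laurent series, and \<open>F\<close> into a subfield of that series field (\<open>SEM_rel_iff\<close>).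
  Slice preserving functions become the scalars from \<open>F\<close> (\<open>SEM_R_eq\<close>).

  What remains is linear algebra in a quaternion algebra over \<open>F\<close>. Let \<open>a\<close> be the sum of the real parts of \<open>f\<close> and \<open>g\<close>, let
  \<open>v\<close>, \<open>w\<close> be their vector parts, which are nonzero by assumption, and \<open>m\<close>, \<open>n\<close> the norms of these. The Sylvester operator is
  \<open>x \<mapsto> a x + v x + x w\<close>. The multiplications by \<open>v\<close> and \<open>w\<close> commute and have the squares \<open>- m\<close> and \<open>- n\<close>, so over an
  algebraic closure the eigenvalues are \<open>a \<plusminus> \<lambda> \<plusminus> \<mu>\<close> with \<open>\<lambda>\<^sup>2 = - m\<close>, \<open>\<mu>\<^sup>2 = - n\<close>, and the product of the four is the
  discriminant in the theorem. The kernel, and by \<open>linear_map_rank_nullity\<close> the rank, is as follows.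

  \<^item> If the discriminant is nonzero, the kernel is zero (\<open>ker_trivial\<close>).

  \<^item> If it vanishes and \<open>a \<noteq> 0\<close>, then \<open>\<lambda>\<close> and \<open>\<mu>\<close> are rational expressions in \<open>a\<close>, \<open>m\<close>, \<open>n\<close>, and the kernel is the
    line \<open>(v + \<lambda>) _ (w + \<mu>)\<close>, which consists of elements of norm zero (\<open>ker_line\<close>, \<open>ker_isotropic\<close>).

  \<^item> If it vanishes and \<open>a = 0\<close>, then \<open>m = n\<close>, there is an invertible \<open>h = v y - y w\<close> in the kernel, and the kernel is the
    plane \<open>h (F + F w)\<close> (\<open>ker_invertible\<close>, \<open>ker_plane_iff\<close>). Its zero divisors correspond to the solutions of
    \<open>\<alpha>\<^sup>2 + \<beta>\<^sup>2 n = 0\<close> (\<open>ker_zero_divisor_iff\<close>).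

  The rank is never smaller, as \<open>v\<close> and \<open>w\<close> are nonzero. The kind of the domain enters through the arithmetic of \<open>F\<close>: on a
  slice domain, symmetric functions are real on the real axis, a sum of four squares vanishes only trivially, and there
  are no zero divisors (\<open>anisotropic_real_base\<close>); on a product domain \<open>- 1\<close> is a square in \<open>F\<close>, namely that of the function
  equal to \<open>\<i>\<close> on the upper half plane and to \<open>- \<i>\<close> on the lower one (\<open>imaginary_unit_off_axis\<close>).
\<close>

section \<open>Quaternions over a commutative ring\<close>

text \<open>
  Two coefficient rings are used: complex numbers, for the values of stems, and Laurent series, for the algebra of
  semi-regular functions. Both algebras have zero divisors.
\<close>

datatype 'a qalg = QA (co0: 'a) (co1: 'a) (co2: 'a) (co3: 'a)

lemma qalg_eq_iff:
  "p = q \<longleftrightarrow> co0 p = co0 q \<and> co1 p = co1 q \<and> co2 p = co2 q \<and> co3 p = co3 q"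
  by (cases p; cases q) auto

instantiation qalg :: (comm_ring_1) ring_1
begin

definition "0 = QA 0 0 0 0"
definition "1 = QA 1 0 0 0"
definition "p + q = QA (co0 p + co0 q) (co1 p + co1 q) (co2 p + co2 q) (co3 p + co3 q)"
definition "- p = QA (- co0 p) (- co1 p) (- co2 p) (- co3 p)"
definition "p - q = QA (co0 p - co0 q) (co1 p - co1 q) (co2 p - co2 q) (co3 p - co3 q)"
definition "p * q = QA
  (co0 p * co0 q - co1 p * co1 q - co2 p * co2 q - co3 p * co3 q)
  (co0 p * co1 q + co1 p * co0 q + co2 p * co3 q - co3 p * co2 q)
  (co0 p * co2 q - co1 p * co3 q + co2 p * co0 q + co3 p * co1 q)
  (co0 p * co3 q + co1 p * co2 q - co2 p * co1 q + co3 p * co0 q)"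

instance
  by standard
    (simp_all add: zero_qalg_def one_qalg_def plus_qalg_def uminus_qalg_def minus_qalg_def
      times_qalg_def qalg_eq_iff algebra_simps)

end

lemma co_simps [simp]:
  "co0 0 = 0" "co1 0 = 0" "co2 0 = 0" "co3 0 = 0"
  "co0 1 = 1" "co1 1 = 0" "co2 1 = 0" "co3 1 = 0"
  "co0 (p + q) = co0 p + co0 q" "co1 (p + q) = co1 p + co1 q"
  "co2 (p + q) = co2 p + co2 q" "co3 (p + q) = co3 p + co3 q"
  "co0 (p - q) = co0 p - co0 q" "co1 (p - q) = co1 p - co1 q"
  "co2 (p - q) = co2 p - co2 q" "co3 (p - q) = co3 p - co3 q"
  "co0 (- p) = - co0 p" "co1 (- p) = - co1 p" "co2 (- p) = - co2 p" "co3 (- p) = - co3 p"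
  for p q :: "'a :: comm_ring_1 qalg"
  by (simp_all add: zero_qalg_def one_qalg_def plus_qalg_def uminus_qalg_def minus_qalg_def)

lemma co_mult:
  "co0 (p * q) = co0 p * co0 q - co1 p * co1 q - co2 p * co2 q - co3 p * co3 q"
  "co1 (p * q) = co0 p * co1 q + co1 p * co0 q + co2 p * co3 q - co3 p * co2 q"
  "co2 (p * q) = co0 p * co2 q - co1 p * co3 q + co2 p * co0 q + co3 p * co1 q"
  "co3 (p * q) = co0 p * co3 q + co1 p * co2 q - co2 p * co1 q + co3 p * co0 q"
  for p q :: "'a :: comm_ring_1 qalg"
  by (simp_all add: times_qalg_def)

definition qscal :: "'a :: comm_ring_1 \<Rightarrow> 'a qalg" where
  "qscal c = QA c 0 0 0"

definition qconj :: "'a :: comm_ring_1 qalg \<Rightarrow> 'a qalg" where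
  "qconj p = QA (co0 p) (- co1 p) (- co2 p) (- co3 p)"

definition qnrm :: "'a :: comm_ring_1 qalg \<Rightarrow> 'a" where
  "qnrm p = co0 p * co0 p + co1 p * co1 p + co2 p * co2 p + co3 p * co3 p"

definition qvec :: "'a :: comm_ring_1 qalg \<Rightarrow> 'a qalg" where
  "qvec p = QA 0 (co1 p) (co2 p) (co3 p)"

lemma co_qscal [simp]: "co0 (qscal c) = c" "co1 (qscal c) = 0" "co2 (qscal c) = 0" "co3 (qscal c) = 0"
  by (simp_all add: qscal_def)

lemma co_qconj [simp]:
  "co0 (qconj p) = co0 p" "co1 (qconj p) = - co1 p" "co2 (qconj p) = - co2 p" "co3 (qconj p) = - co3 p"
  by (simp_all add: qconj_def)

lemma co_qvec [simp]:
  "co0 (qvec p) = 0" "co1 (qvec p) = co1 p" "co2 (qvec p) = co2 p" "co3 (qvec p) = co3 p"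
  by (simp_all add: qvec_def)

lemma qscal_mult [simp]: "qscal a * qscal b = qscal (a * b)"
  and qscal_add [simp]: "qscal a + qscal b = qscal (a + b)"
  and qscal_diff [simp]: "qscal a - qscal b = qscal (a - b)"
  and qscal_minus [simp]: "- qscal a = qscal (- a)"
  and qscal_0 [simp]: "qscal 0 = 0"
  and qscal_1 [simp]: "qscal 1 = 1"
  and qscal_eq_iff [simp]: "qscal a = qscal b \<longleftrightarrow> a = b"
  and qscal_eq_0 [simp]: "qscal a = 0 \<longleftrightarrow> a = 0"
  and qscal_commute: "p * qscal a = qscal a * p"
  by (auto simp: qalg_eq_iff co_mult)

lemma qscal_qscal [simp]: "qscal a * (qscal b * x) = qscal (a * b) * x"
  by (simp only: mult.assoc[symmetric] qscal_mult)

lemma qscal_plus_qvec: "qscal (co0 p) + qvec p = p"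
  by (simp add: qalg_eq_iff)

lemma qconj_mult: "qconj (p * q) = qconj q * qconj p"
  by (simp add: qalg_eq_iff co_mult algebra_simps)

lemma mult_qconj: "p * qconj p = qscal (qnrm p)" "qconj p * p = qscal (qnrm p)"
  by (simp_all add: qalg_eq_iff co_mult qnrm_def algebra_simps)

lemma qconj_qconj [simp]: "qconj (qconj p) = p"
  by (simp add: qalg_eq_iff)

lemma plus_qconj: "p + qconj p = qscal (2 * co0 p)"
  by (simp add: qalg_eq_iff)

lemma qnrm_mult: "qnrm (p * q) = qnrm p * qnrm q"
  by (simp add: qnrm_def co_mult algebra_simps)

lemma qvec_square: "qvec p * qvec p = - qscal (qnrm (qvec p))"
  by (simp add: qalg_eq_iff co_mult qnrm_def algebra_simps)

lemma co0_mult_commute: "co0 (p * q) = co0 (q * p)"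
  by (simp add: co_mult algebra_simps)

lemma qscal_left_commute: "p * (qscal c * q) = qscal c * (p * q)"
proof -
  have "p * (qscal c * q) = (p * qscal c) * q" by (simp only: mult.assoc)
  also have "\<dots> = (qscal c * p) * q" unfolding qscal_commute[of p] ..
  finally show ?thesis by (simp only: mult.assoc)
qed

lemma qnrm_0 [simp]: "qnrm 0 = 0" by (simp add: qnrm_def)

lemma qscal_cancel:
  fixes p :: "'a :: field qalg"
  assumes "qscal c * p = 0" "c \<noteq> 0"
  shows "p = 0"
  using assms by (auto simp: qalg_eq_iff co_mult)

definition qunits :: "'a :: comm_ring_1 qalg set" where
  "qunits = {1, QA 0 1 0 0, QA 0 0 1 0, QA 0 0 0 1}"

text \<open>
  The sandwich average \<open>\<Sum> e Z e\<^sup>c\<close> over the basis is four times the real part of \<open>Z\<close>. It turns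
  products \<open>p e q\<close> into multiples of \<open>p\<close>, which is why the algebra is prime although it may have
  zero divisors.
\<close>

lemma sandwich_sum:
  fixes z :: "'a :: comm_ring_1 qalg"
  shows "(\<Sum>e\<in>qunits. e * z * qconj e) = qscal (4 * co0 z)"
proof -
  have "(1::'a qalg) \<noteq> QA 0 1 0 0" "(1::'a qalg) \<noteq> QA 0 0 1 0" "(1::'a qalg) \<noteq> QA 0 0 0 1"
    by (auto simp: qalg_eq_iff)
  then show ?thesis
    unfolding qunits_def
    by (simp add: qalg_eq_iff co_mult algebra_simps)
qed

lemma nonzero_trace_witness:
  fixes q :: "'a :: comm_ring_1 qalg"
  assumes "q \<noteq> 0"
  shows "\<exists>e\<in>qunits. co0 (e * q) \<noteq> 0"
proof -
  have u: "1 \<in> (qunits :: 'a qalg set)" "QA 0 1 0 0 \<in> (qunits :: 'a qalg set)"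
    "QA 0 0 1 0 \<in> (qunits :: 'a qalg set)" "QA 0 0 0 1 \<in> (qunits :: 'a qalg set)"
    by (auto simp: qunits_def)
  from assms consider "co0 q \<noteq> 0" | "co1 q \<noteq> 0" | "co2 q \<noteq> 0" | "co3 q \<noteq> 0"
    by (auto simp: qalg_eq_iff)
  then show ?thesis
    by cases (use u in \<open>force simp: co_mult\<close>)+
qed

lemma qalg_prime:
  fixes p q :: "'a :: field_char_0 qalg"
  assumes "p \<noteq> 0" "q \<noteq> 0"
  shows "\<exists>e\<in>qunits. p * e * q \<noteq> 0"
proof (rule ccontr)
  assume "\<not> ?thesis"
  then have 0: "p * e * q = 0" if "e \<in> qunits" for e using that by blast
  obtain w where w: "w \<in> qunits" "co0 (w * q) \<noteq> 0"
    using nonzero_trace_witness[OF assms(2)] by blast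
  have w': "co0 (q * w) \<noteq> 0" using w(2) unfolding co0_mult_commute[of q w] .
  have "p * qscal (4 * co0 (q * w)) = (\<Sum>e\<in>qunits. p * e * q * (w * qconj e))"
    unfolding sandwich_sum[symmetric] sum_distrib_left by (simp add: mult.assoc)
  also have "\<dots> = 0" by (simp add: 0)
  finally have "qscal (4 * co0 (q * w)) * p = 0" unfolding qscal_commute[of p] .
  with w' have "p = 0" by (intro qscal_cancel[of "4 * co0 (q * w)" p]) auto
  with assms show False by simp
qed

text \<open>
  Some \<open>w p\<close> has nonzero trace \<open>t = w p + (w p)\<^sup>c\<close>. If \<open>p x = 0\<close>, then \<open>t x = p\<^sup>c w\<^sup>c x\<close>, and \<open>t\<close> is a scalar.
\<close>

lemma left_annihilator_factor:
  fixes p x :: "'a :: field_char_0 qalg"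
  assumes "p \<noteq> 0" "p * x = 0"
  shows "\<exists>u. x = qconj p * u"
proof -
  obtain w where w: "co0 (w * p) \<noteq> 0" using nonzero_trace_witness[OF assms(1)] by blast
  define t where "t = 2 * co0 (w * p)"
  have "qscal t * x = (w * p + qconj (w * p)) * x"
    by (simp add: plus_qconj t_def)
  also have "\<dots> = qconj p * (qconj w * x)"
    by (simp add: distrib_right mult.assoc assms(2) qconj_mult)
  finally have "qscal (1 / t) * (qscal t * x) = qscal (1 / t) * (qconj p * (qconj w * x))" by simp
  moreover have "t \<noteq> 0" using w by (simp add: t_def)
  ultimately have "x = qconj p * (qscal (1 / t) * (qconj w * x))"
    by (simp add: qscal_left_commute[of "qconj p"])
  then show ?thesis by blast
qed

lemma right_annihilator_factor:
  fixes p x :: "'a :: field_char_0 qalg"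
  assumes "p \<noteq> 0" "x * p = 0"
  shows "\<exists>u. x = u * qconj p"
proof -
  have "qconj p * qconj x = 0" using assms(2) by (simp add: qconj_mult[symmetric] qalg_eq_iff)
  moreover have "qconj p \<noteq> 0" using assms(1) by (auto simp: qalg_eq_iff)
  ultimately obtain u where "qconj x = qconj (qconj p) * u"
    using left_annihilator_factor by blast
  then have "qconj (qconj x) = qconj (p * u)" by simp
  then have "x = qconj u * qconj p" by (simp add: qconj_mult)
  then show ?thesis by blast
qed

text \<open>
  Replace \<open>x p\<close> by its trace minus its conjugate: the second part is killed by \<open>p (x p)\<^sup>c = p p\<^sup>c x\<^sup>c = 0\<close>. So an
  isotropic \<open>p\<close> spans a line \<open>p _ p\<close>.
\<close>

lemma isotropic_sandwich:
  assumes "qnrm p = 0"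
  shows "p * x * p = qscal (2 * co0 (x * p)) * p"
proof -
  have "p * x * p + p * qconj (x * p) = p * qscal (2 * co0 (x * p))"
    unfolding plus_qconj[symmetric] by (simp add: distrib_left mult.assoc)
  moreover have "p * qconj (x * p) = 0"
    by (simp add: qconj_mult mult_qconj assms flip: mult.assoc)
  ultimately show ?thesis by (simp only: qscal_commute) simp
qed

section \<open>The Sylvester equation over a quaternion algebra\<close>

text \<open>
  If \<open>\<lambda>\<^sup>2 = - m\<close> and \<open>\<mu>\<^sup>2 = - n\<close>, this is the product of \<open>a \<plusminus> \<lambda> \<plusminus> \<mu>\<close> over the four choices of signs, hence the
  determinant of \<open>x \<mapsto> a x + v x + x w\<close> for vectors \<open>v\<close>, \<open>w\<close> of norms \<open>m\<close>, \<open>n\<close>.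
\<close>

definition sylv_disc :: "'a :: comm_ring_1 \<Rightarrow> 'a \<Rightarrow> 'a \<Rightarrow> 'a" where
  "sylv_disc a m n = a * a * (a * a + 2 * (m + n)) + (m - n) * (m - n)"

lemma sylv_disc_eq: "sylv_disc a m n = (a * a + m + n) * (a * a + m + n) - 4 * m * n"
  unfolding sylv_disc_def by (simp add: algebra_simps)

text \<open>
  The equation \<open>f x + x g = 0\<close> depends on the real parts only through their sum \<open>a\<close>. The vector parts satisfy
  \<open>v\<^sup>2 = - m\<close> and \<open>w\<^sup>2 = - n\<close>, and left multiplication by \<open>v\<close> commutes with right multiplication by \<open>w\<close>.
\<close>

locale sylvester_pair =
  fixes f g :: "'a :: field_char_0 qalg" and a m n :: 'a and v w :: "'a qalg"
  defines "a \<equiv> co0 f + co0 g" and "v \<equiv> qvec f" and "w \<equiv> qvec g"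
    and "m \<equiv> qnrm v" and "n \<equiv> qnrm w"
  assumes v_nz: "v \<noteq> 0" and w_nz: "w \<noteq> 0"
begin

lemma co0_vw [simp]: "co0 v = 0" "co0 w = 0" by (simp_all add: v_def w_def)

lemma v_sq: "v * v = - qscal m" and w_sq: "w * w = - qscal n"
  by (simp_all add: v_def w_def m_def n_def qvec_square)

lemma vv: "v * (v * x) = - (qscal m * x)"
  by (simp add: mult.assoc[symmetric] v_sq del: qscal_minus)

lemma ww: "x * w * w = - (qscal n * x)"
proof -
  have "x * w * w = - (x * qscal n)" by (simp add: mult.assoc w_sq del: qscal_minus)
  then show ?thesis by (simp only: qscal_commute)
qed

lemma op_eq: "f * x + x * g = qscal a * x + v * x + x * w"
proof -
  have "f = qscal (co0 f) + v" "g = qscal (co0 g) + w"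
    by (simp_all add: qscal_plus_qvec v_def w_def)
  then have "f * x + x * g = (qscal (co0 f) + v) * x + x * (qscal (co0 g) + w)" by simp
  also have "\<dots> = qscal (co0 f) * x + v * x + (qscal (co0 g) * x + x * w)"
    unfolding distrib_left distrib_right qscal_commute ..
  also have "\<dots> = qscal a * x + v * x + x * w"
    unfolding a_def qscal_add[symmetric] distrib_right by (simp add: add_ac)
  finally show ?thesis .
qed

lemma ker_iff: "f * x + x * g = 0 \<longleftrightarrow> v * x + x * w = qscal (- a) * x"
  unfolding op_eq by (simp add: eq_neg_iff_add_eq_0 add_ac flip: qscal_minus)

text \<open>
  Squaring \<open>v x + x w = - a x\<close>, in the sense of applying the operator on the left twice, gives
  \<open>- (m + n) x + 2 v x w = a\<^sup>2 x\<close>.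
\<close>

lemma ker_vxw:
  assumes "f * x + x * g = 0"
  shows "qscal 2 * (v * x * w) = qscal (a * a + m + n) * x"
proof -
  note k = assms[unfolded ker_iff]
  have 1: "v * (v * x + x * w) = - (qscal m * x) + v * x * w"
    by (simp add: distrib_left vv mult.assoc)
  have 2: "(v * x + x * w) * w = v * x * w - qscal n * x"
    by (simp add: distrib_right ww)
  have 3: "v * (qscal (- a) * x) = qscal (- a) * (v * x)"
    by (rule qscal_left_commute)
  have "v * (v * x + x * w) + (v * x + x * w) * w = qscal (- a) * (v * x) + qscal (- a) * x * w"
    unfolding k 3 ..
  also have "\<dots> = qscal (- a) * (v * x + x * w)"
    by (simp only: distrib_left mult.assoc)
  also have "\<dots> = qscal (a * a) * x" unfolding k by (simp add: mult.assoc[symmetric])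
  finally have 4: "- (qscal m * x) + v * x * w + (v * x * w - qscal n * x) = qscal (a * a) * x"
    unfolding 1 2 .
  have group: "y + y = r + p + q" if "- p + y + (y - q) = r" for p q r y :: "'a qalg"
    using that by (auto simp: algebra_simps)
  have two: "qscal 2 * y = y + y" for y :: "'a qalg"
    by (simp add: qalg_eq_iff co_mult)
  show ?thesis unfolding two group[OF 4] qscal_add[symmetric] distrib_right ..
qed

text \<open>
  On the kernel, \<open>2 v x w = s x\<close> with \<open>s = a\<^sup>2 + m + n\<close>; applying \<open>v _ w\<close> once more multiplies the left
  side by \<open>m n\<close>, so \<open>s\<^sup>2 - 4 m n\<close> kills the kernel.
\<close>

lemma ker_trivial:
  assumes "f * x + x * g = 0" "sylv_disc a m n \<noteq> 0"
  shows "x = 0"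
proof -
  let ?s = "a * a + m + n" and ?y = "v * x * w"
  note k = ker_vxw[OF assms(1)]
  have "v * ?y * w = v * (v * (x * w * w))" by (simp only: mult.assoc)
  also have "\<dots> = qscal m * (qscal n * x)" by (simp only: vv ww minus_minus mult_minus_right)
  finally have "qscal 4 * (v * ?y * w) = qscal 4 * (qscal m * (qscal n * x))" by (rule arg_cong)
  then have 1: "qscal 4 * (v * ?y * w) = qscal (4 * m * n) * x"
    by (simp only: mult.assoc[symmetric] qscal_mult)
  have "qscal 4 * (v * ?y * w) = qscal 2 * (v * (qscal 2 * ?y) * w)"
    by (simp add: qscal_left_commute[of v] mult.assoc)
  also have "\<dots> = qscal 2 * (v * (qscal ?s * x) * w)" unfolding k ..
  also have "\<dots> = qscal ?s * (qscal 2 * ?y)"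
    by (simp only: qscal_left_commute[of v] mult.assoc qscal_qscal mult.commute[of 2])
  also have "\<dots> = qscal (?s * ?s) * x" unfolding k qscal_qscal ..
  finally have "qscal (sylv_disc a m n) * x = 0"
    unfolding 1 sylv_disc_eq qscal_diff[symmetric] left_diff_distrib by simp
  with assms(2) show ?thesis by (rule qscal_cancel[rotated])
qed

text \<open>
  The real part of \<open>(f x + x g) x\<^sup>c\<close> is \<open>a\<close> times the norm of \<open>x\<close>.
\<close>

lemma ker_isotropic:
  assumes "f * x + x * g = 0" "a \<noteq> 0"
  shows "qnrm x = 0"
proof -
  have "co0 ((f * x + x * g) * qconj x) = a * qnrm x"
    by (simp add: co_mult qnrm_def a_def algebra_simps)
  with assms show ?thesis by simp
qed

text \<open>
  The only candidates for eigenvalues \<open>v x = \<lambda> x\<close>, \<open>x w = \<mu> x\<close> on the kernel: there \<open>\<lambda> + \<mu> = - a\<close> and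
  \<open>2 \<lambda> \<mu> = a\<^sup>2 + m + n\<close>, so \<open>a \<lambda> = - \<lambda>\<^sup>2 - \<lambda> \<mu> = m - (a\<^sup>2 + m + n) / 2\<close>, and likewise for \<open>\<mu>\<close>.
\<close>

definition "lam = (m - (a * a + m + n) / 2) / a"
definition "mu = (n - (a * a + m + n) / 2) / a"

lemma lam_plus_mu: "a \<noteq> 0 \<Longrightarrow> lam + mu = - a"
  by (simp add: lam_def mu_def field_simps)

lemma lam_square:
  assumes "sylv_disc a m n = 0" "a \<noteq> 0"
  shows "lam * lam = - m" "mu * mu = - n"
proof -
  have *: "(x / a) * (x / a) = - y" if "x * x + a * a * y = 0" for x y
    using that assms(2) by (simp add: field_simps eq_neg_iff_add_eq_0)
  show "lam * lam = - m" unfolding lam_def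
    by (rule *) (use assms(1) in \<open>simp add: sylv_disc_eq field_simps\<close>)
  show "mu * mu = - n" unfolding mu_def
    by (rule *) (use assms(1) in \<open>simp add: sylv_disc_eq field_simps\<close>)
qed

text \<open>
  Multiplication by \<open>v + \<lambda>\<close> maps into the eigenspace of \<open>\<lambda>\<close>, because \<open>(v - \<lambda>) (v + \<lambda>) = v\<^sup>2 - \<lambda>\<^sup>2 = 0\<close>. This
  remains true for \<open>\<lambda> = 0\<close>, when \<open>v\<close> is nilpotent and cannot be diagonalized.
\<close>

definition "vl = v + qscal lam"
definition "wm = w + qscal mu"

lemma co_vl_wm:
  "co0 vl = lam" "co1 vl = co1 v" "co2 vl = co2 v" "co3 vl = co3 v"
  "co0 wm = mu" "co1 wm = co1 w" "co2 wm = co2 w" "co3 wm = co3 w"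
  by (simp_all add: vl_def wm_def)

lemma plus_qscal_nz:
  fixes u :: "'a qalg"
  assumes "u \<noteq> 0" "co0 u = 0"
  shows "u + qscal c \<noteq> 0"
proof
  assume "u + qscal c = 0"
  then have "co1 (u + qscal c) = 0" "co2 (u + qscal c) = 0" "co3 (u + qscal c) = 0" by simp_all
  with assms show False by (simp add: qalg_eq_iff)
qed

lemma vl_nz: "vl \<noteq> 0" and wm_nz: "wm \<noteq> 0"
  unfolding vl_def wm_def using plus_qscal_nz v_nz w_nz co0_vw by blast+

text \<open>
  Multiplying \<open>v x + x w = - a x\<close> by \<open>v\<close> from the left and inserting \<open>2 v x w = s x\<close> with \<open>s = a\<^sup>2 + m + n\<close> gives
  \<open>a v x = (m - s / 2) x\<close>, which is \<open>a \<lambda> x\<close>; multiplying by \<open>w\<close> from the right gives the other equation.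
\<close>

lemma ker_eigen_iff:
  assumes "sylv_disc a m n = 0" "a \<noteq> 0"
  shows "f * x + x * g = 0 \<longleftrightarrow> v * x = qscal lam * x \<and> x * w = qscal mu * x"
proof
  assume x: "f * x + x * g = 0"
  have 1: "v * (v * x + x * w) = - (qscal m * x) + v * x * w"
    by (simp add: distrib_left vv mult.assoc)
  have 2: "v * (qscal (- a) * x) = qscal (- a) * (v * x)"
    by (rule qscal_left_commute)
  have "qscal (- a) * (v * x) = - (qscal m * x) + v * x * w"
    using 1 unfolding x[unfolded ker_iff] 2 .
  then have "qscal 2 * (qscal (- a) * (v * x)) = qscal 2 * - (qscal m * x) + qscal 2 * (v * x * w)"
    by (simp only: distrib_left)
  also have "\<dots> = qscal (- 2 * m) * x + qscal (a * a + m + n) * x"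
    unfolding ker_vxw[OF x] mult_minus_right qscal_qscal
    by (simp only: mult_minus_left flip: qscal_minus)
  finally have "qscal (-2 * a) * (v * x) = qscal (-2 * m + (a * a + m + n)) * x"
    unfolding qscal_qscal distrib_right[symmetric] qscal_add by simp
  then have "qscal (1 / (-2 * a)) * (qscal (-2 * a) * (v * x))
      = qscal (1 / (-2 * a)) * (qscal (-2 * m + (a * a + m + n)) * x)" by simp
  moreover have "1 / (-2 * a) * (-2 * m + (a * a + m + n)) = lam"
    unfolding lam_def using assms(2) by (simp add: field_simps)
  ultimately have vx: "v * x = qscal lam * x"
    unfolding qscal_qscal using assms(2) by simp
  have "v * x + x * w = qscal (lam + mu) * x"
    using x unfolding ker_iff lam_plus_mu[OF assms(2)] .
  then have "x * w = qscal mu * x"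
    unfolding vx qscal_add[symmetric] distrib_right by (rule add_left_imp_eq)
  with vx show "v * x = qscal lam * x \<and> x * w = qscal mu * x" by blast
next
  assume "v * x = qscal lam * x \<and> x * w = qscal mu * x"
  then have "v * x + x * w = qscal (lam + mu) * x"
    unfolding qscal_add[symmetric] distrib_right by simp
  then show "f * x + x * g = 0"
    unfolding ker_iff lam_plus_mu[OF assms(2)] .
qed

text \<open>
  Every product \<open>vl * e * wm\<close> lies in the common eigenspace, and primeness of the algebra provides one that is nonzero.
\<close>

lemma ker_witness:
  assumes "sylv_disc a m n = 0" "a \<noteq> 0"
  shows "\<exists>e\<in>qunits. vl * e * wm \<noteq> 0 \<and> f * (vl * e * wm) + (vl * e * wm) * g = 0"
proof -
  obtain e where e: "e \<in> qunits" "vl * e * wm \<noteq> 0"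
    using qalg_prime[OF vl_nz wm_nz] by blast
  have "v * vl = qscal lam * vl"
    unfolding vl_def distrib_left v_sq qscal_mult lam_square[OF assms]
    by (simp add: qscal_commute[of v])
  moreover have "wm * w = qscal mu * wm"
    unfolding wm_def distrib_left distrib_right w_sq qscal_mult lam_square[OF assms] by simp
  ultimately have "v * (vl * e * wm) = qscal lam * (vl * e * wm)"
      "(vl * e * wm) * w = qscal mu * (vl * e * wm)"
    by (simp only: mult.assoc[symmetric], simp only: mult.assoc qscal_left_commute)
  with e show ?thesis unfolding ker_eigen_iff[OF assms] by blast
qed

text \<open>
  An element of the kernel is annihilated by \<open>v - \<lambda>\<close> from the left and by \<open>w - \<mu>\<close> from the right, so it is of
  the form \<open>vl * u1\<close> and also of the form \<open>u2 * wm\<close>; the two factorizations are merged by inserting \<open>vl * t\<close>.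
\<close>

lemma ker_factor:
  assumes "sylv_disc a m n = 0" "a \<noteq> 0" "f * x + x * g = 0"
  shows "\<exists>u. x = vl * u * wm"
proof -
  note e = assms(3)[unfolded ker_eigen_iff[OF assms(1,2)]]
  have c: "qconj (v - qscal lam) = - vl" "qconj (w - qscal mu) = - wm"
    by (simp_all add: qalg_eq_iff co_vl_wm)
  have nz: "v - qscal lam \<noteq> 0" "w - qscal mu \<noteq> 0"
    unfolding diff_conv_add_uminus qscal_minus by (intro plus_qscal_nz v_nz w_nz co0_vw)+
  have "(v - qscal lam) * x = 0" using e by (simp add: left_diff_distrib)
  then obtain u1 where u1: "x = - vl * u1"
    using left_annihilator_factor[OF nz(1)] c by metis
  have "x * (w - qscal mu) = 0" using e by (simp add: right_diff_distrib qscal_commute[of x])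
  then obtain u2 where u2: "x = u2 * - wm"
    using right_annihilator_factor[OF nz(2)] c by metis
  obtain t where t: "co0 (t * vl) \<noteq> 0"
    using nonzero_trace_witness[OF vl_nz] by blast
  have iso: "qnrm vl = 0"
    using lam_square[OF assms(1,2)] by (simp add: co_vl_wm qnrm_def m_def)
  define c where "c = 2 * co0 (t * vl)"
  \<comment> \<open>Left multiplication by \<open>vl * t\<close> is the scalar \<open>c\<close> on the right ideal \<open>vl * _\<close>, which contains \<open>x\<close>.\<close>
  have "vl * t * vl = qscal c * vl"
    unfolding c_def by (rule isotropic_sandwich[OF iso])
  then have "vl * t * (vl * u1) = qscal c * (vl * u1)"
    by (simp add: mult.assoc[symmetric])
  then have "vl * t * x = qscal c * x" unfolding u1 by simp
  then have "qscal (1 / c) * (qscal c * x) = qscal (1 / c) * (vl * t * x)" by simp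
  moreover have "c \<noteq> 0" using t by (simp add: c_def)
  ultimately have "x = qscal (1 / c) * (vl * t * x)"
    by simp
  also have "\<dots> = vl * (qscal (1 / c) * t * u2 * -1) * wm"
    by (subst u2) (simp add: mult.assoc qscal_left_commute[of vl])
  finally show ?thesis by blast
qed

text \<open>Both generators are isotropic, so \<open>vl * _ * wm\<close> is the intersection of a minimal right ideal with
  a minimal left ideal: a line.\<close>

lemma ker_line:
  assumes "sylv_disc a m n = 0" "a \<noteq> 0"
    and "f * x + x * g = 0" "f * y + y * g = 0" "x \<noteq> 0"
  shows "\<exists>c. y = qscal c * x"
proof -
  obtain u where u: "x = vl * u * wm" using ker_factor[OF assms(1-3)] by blast
  obtain u' where u': "y = vl * u' * wm" using ker_factor[OF assms(1,2,4)] by blast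
  have iso: "qnrm vl = 0" "qnrm wm = 0"
    using lam_square[OF assms(1,2)] by (simp_all add: co_vl_wm qnrm_def m_def n_def)
  obtain t where t: "co0 (t * x) \<noteq> 0"
    using nonzero_trace_witness[OF assms(5)] by blast
  have "x * t * y = (vl * (u * wm * t) * vl) * u' * wm"
    unfolding u u' by (simp add: mult.assoc)
  also have "\<dots> = qscal (2 * co0 (u * wm * t * vl)) * y"
    unfolding isotropic_sandwich[OF iso(1)] u' by (simp add: mult.assoc)
  also have "co0 (u * wm * t * vl) = co0 (t * x)"
    unfolding u using co0_mult_commute[of "u * wm * t" vl] co0_mult_commute[of "vl * u * wm" t]
    by (simp add: mult.assoc)
  finally have 1: "x * t * y = qscal (2 * co0 (t * x)) * y" .
  have "x * t * y = vl * u * (wm * (t * vl * u') * wm)"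
    unfolding u u' by (simp add: mult.assoc)
  also have "\<dots> = vl * u * (qscal (2 * co0 (t * vl * u' * wm)) * wm)"
    unfolding isotropic_sandwich[OF iso(2)] ..
  also have "\<dots> = qscal (2 * co0 (t * vl * u' * wm)) * x"
    unfolding u by (simp only: mult.assoc qscal_left_commute)
  finally have "qscal (2 * co0 (t * x)) * y = qscal (2 * co0 (t * vl * u' * wm)) * x"
    using 1 by simp
  then have "qscal (1 / (2 * co0 (t * x))) * (qscal (2 * co0 (t * x)) * y)
     = qscal (1 / (2 * co0 (t * x))) * (qscal (2 * co0 (t * vl * u' * wm)) * x)" by simp
  with t have "y = qscal (1 / (2 * co0 (t * x)) * (2 * co0 (t * vl * u' * wm))) * x"
    by simp
  then show ?thesis by blast
qed

end


context sylvester_pair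
begin

text \<open>
  When \<open>a = 0\<close> and \<open>m = n\<close>, every \<open>v y - y w\<close> solves the equation. If all of these with coordinates of \<open>y\<close> in \<open>{0, 1}\<close>
  were isotropic, then \<open>y = 1, i, j, k\<close> would give \<open>m = 0\<close> and \<open>v\<^sub>r w\<^sub>r = 0\<close>, the sums of two units would give
  \<open>v\<^sub>r w\<^sub>s = 0\<close> for \<open>r \<noteq> s\<close>, and \<open>v\<close> or \<open>w\<close> would vanish. Coordinates in \<open>{0, 1}\<close> belong to every subfield, so the
  solution is rational over any field of definition of \<open>f\<close> and \<open>g\<close>.
\<close>

lemma ker_invertible:
  assumes "a = 0" "m = n"
  shows "\<exists>y. {co0 y, co1 y, co2 y, co3 y} \<subseteq> {0, 1} \<and> qnrm (v * y - y * w) \<noteq> 0 \<and>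
    f * (v * y - y * w) + (v * y - y * w) * g = 0"
proof -
  have "v * (v * y - y * w) + (v * y - y * w) * w = 0" for y
  proof -
    have "v * (v * y - y * w) + (v * y - y * w) * w = v * (v * y) - y * w * w"
      by (simp add: left_diff_distrib right_diff_distrib mult.assoc)
    then show ?thesis using assms by (simp only: vv ww) simp
  qed
  then have ker: "f * (v * y - y * w) + (v * y - y * w) * g = 0" for y
    unfolding ker_iff assms(1) by simp
  have "\<exists>y. {co0 y, co1 y, co2 y, co3 y} \<subseteq> {0, 1} \<and> qnrm (v * y - y * w) \<noteq> 0"
  proof (rule ccontr)
    assume neg: "\<not> ?thesis"
    obtain x1 x2 x3 where v: "v = QA 0 x1 x2 x3" by (metis co0_vw(1) qalg.collapse)
    obtain y1 y2 y3 where w: "w = QA 0 y1 y2 y3" by (metis co0_vw(2) qalg.collapse)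
    have z: "qnrm (v * QA s0 s1 s2 s3 - QA s0 s1 s2 s3 * w) = 0"
      if "{s0, s1, s2, s3} \<subseteq> {0, 1}" for s0 s1 s2 s3
      using neg that by (metis qalg.sel)
    have mn: "x1 * x1 + x2 * x2 + x3 * x3 = y1 * y1 + y2 * y2 + y3 * y3"
      using assms(2) by (simp add: m_def n_def v w qnrm_def)
    let ?X = "x1*x1 + x2*x2 + x3*x3" and ?Y = "y1*y1 + y2*y2 + y3*y3"
    let ?q = "\<lambda>s0 s1 s2 s3. qnrm (QA 0 x1 x2 x3 * QA s0 s1 s2 s3 - QA s0 s1 s2 s3 * QA 0 y1 y2 y3)"
    have z': "{s0, s1, s2, s3} \<subseteq> {0, 1} \<Longrightarrow> ?q s0 s1 s2 s3 = 0"
      for s0 s1 s2 s3 using z[of s0 s1 s2 s3] unfolding v w .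
    have mn': "?X - ?Y = 0" using mn by simp
    have four: "t = 0" if "4 * t = 0" for t :: 'a using that by simp
    have two: "t = 0" if "2 * t = 0 + 0 - 2 * 0" for t :: 'a using that by simp
    have dbl: "t = 0" if "0 + N * 0 = 2 * t" for t N :: 'a using that by simp
    \<comment> \<open>Adding a multiple of \<open>m - n = 0\<close> to each norm removes the squares of the coordinates of \<open>w\<close>.
      The units give \<open>m = \<plusminus> x1 y1 \<plusminus> x2 y2 \<plusminus> x3 y3\<close> with the sum of the four right sides zero.\<close>
    have z_e0: "?q 1 0 0 0 = 0" by (rule z') simp
    have "?q 1 0 0 0 + 1 * (?X - ?Y)
        = 2 * (1 * ?X - (x1*y1 + x2*y2 + x3*y3))"
      by (simp add: qnrm_def co_mult algebra_simps)
    then have e0: "1 * ?X - (x1*y1 + x2*y2 + x3*y3) = 0"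
      unfolding mn' z_e0 by (rule dbl)
    have z_e1: "?q 0 1 0 0 = 0" by (rule z') simp
    have "?q 0 1 0 0 + 1 * (?X - ?Y)
        = 2 * (1 * ?X - (x1*y1 - x2*y2 - x3*y3))"
      by (simp add: qnrm_def co_mult algebra_simps)
    then have e1: "1 * ?X - (x1*y1 - x2*y2 - x3*y3) = 0"
      unfolding mn' z_e1 by (rule dbl)
    have z_e2: "?q 0 0 1 0 = 0" by (rule z') simp
    have "?q 0 0 1 0 + 1 * (?X - ?Y)
        = 2 * (1 * ?X - (x2*y2 - x1*y1 - x3*y3))"
      by (simp add: qnrm_def co_mult algebra_simps)
    then have e2: "1 * ?X - (x2*y2 - x1*y1 - x3*y3) = 0"
      unfolding mn' z_e2 by (rule dbl)
    have z_e3: "?q 0 0 0 1 = 0" by (rule z') simp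
    have "?q 0 0 0 1 + 1 * (?X - ?Y)
        = 2 * (1 * ?X - (x3*y3 - x1*y1 - x2*y2))"
      by (simp add: qnrm_def co_mult algebra_simps)
    then have e3: "1 * ?X - (x3*y3 - x1*y1 - x2*y2) = 0"
      unfolding mn' z_e3 by (rule dbl)
    have "4 * ?X = (1 * ?X - (x1*y1 + x2*y2 + x3*y3)) + (1 * ?X - (x1*y1 - x2*y2 - x3*y3))
        + (1 * ?X - (x2*y2 - x1*y1 - x3*y3)) + (1 * ?X - (x3*y3 - x1*y1 - x2*y2))"
      by (simp add: algebra_simps)
    then have "4 * ?X = 0" unfolding e0 e1 e2 e3 by simp
    then have M: "?X = 0" by (rule four)
    have "2 * (x1*y1) = (1 * ?X - (x2*y2 - x1*y1 - x3*y3)) + (1 * ?X - (x3*y3 - x1*y1 - x2*y2)) - 2 * ?X"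
      by (simp add: algebra_simps)
    then have d1: "x1*y1 = 0" unfolding e2 e3 unfolding M by (rule two)
    have "2 * (x2*y2) = (1 * ?X - (x1*y1 - x2*y2 - x3*y3)) + (1 * ?X - (x3*y3 - x1*y1 - x2*y2)) - 2 * ?X"
      by (simp add: algebra_simps)
    then have d2: "x2*y2 = 0" unfolding e1 e3 unfolding M by (rule two)
    have "2 * (x3*y3) = (1 * ?X - (x1*y1 - x2*y2 - x3*y3)) + (1 * ?X - (x2*y2 - x1*y1 - x3*y3)) - 2 * ?X"
      by (simp add: algebra_simps)
    then have d3: "x3*y3 = 0" unfolding e1 e2 unfolding M by (rule two)
    \<comment> \<open>The sums \<open>1 + i\<close> and \<open>j + k\<close> determine \<open>x3 y2 - x2 y3\<close> and \<open>x3 y2 + x2 y3\<close>, and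
      cyclically for the other two pairs.\<close>
    have z_f1: "?q 1 1 0 0 = 0" by (rule z') simp
    have "?q 1 1 0 0 + 2 * (?X - ?Y)
        = 2 * (2 * ?X - (2*(x1*y1) + 2*(x3*y2 - x2*y3)))"
      by (simp add: qnrm_def co_mult algebra_simps)
    then have f1: "2 * ?X - (2*(x1*y1) + 2*(x3*y2 - x2*y3)) = 0"
      unfolding mn' z_f1 by (rule dbl)
    have z_f2: "?q 1 0 1 0 = 0" by (rule z') simp
    have "?q 1 0 1 0 + 2 * (?X - ?Y)
        = 2 * (2 * ?X - (2*(x2*y2) + 2*(x1*y3 - x3*y1)))"
      by (simp add: qnrm_def co_mult algebra_simps)
    then have f2: "2 * ?X - (2*(x2*y2) + 2*(x1*y3 - x3*y1)) = 0"
      unfolding mn' z_f2 by (rule dbl)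
    have z_f3: "?q 1 0 0 1 = 0" by (rule z') simp
    have "?q 1 0 0 1 + 2 * (?X - ?Y)
        = 2 * (2 * ?X - (2*(x3*y3) + 2*(x2*y1 - x1*y2)))"
      by (simp add: qnrm_def co_mult algebra_simps)
    then have f3: "2 * ?X - (2*(x3*y3) + 2*(x2*y1 - x1*y2)) = 0"
      unfolding mn' z_f3 by (rule dbl)
    have z_g1: "?q 0 0 1 1 = 0" by (rule z') simp
    have "?q 0 0 1 1 + 2 * (?X - ?Y)
        = 2 * (2 * ?X - (2*(x2*y3 + x3*y2) - 2*(x1*y1)))"
      by (simp add: qnrm_def co_mult algebra_simps)
    then have g1: "2 * ?X - (2*(x2*y3 + x3*y2) - 2*(x1*y1)) = 0"
      unfolding mn' z_g1 by (rule dbl)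
    have z_g2: "?q 0 1 0 1 = 0" by (rule z') simp
    have "?q 0 1 0 1 + 2 * (?X - ?Y)
        = 2 * (2 * ?X - (2*(x1*y3 + x3*y1) - 2*(x2*y2)))"
      by (simp add: qnrm_def co_mult algebra_simps)
    then have g2: "2 * ?X - (2*(x1*y3 + x3*y1) - 2*(x2*y2)) = 0"
      unfolding mn' z_g2 by (rule dbl)
    have z_g3: "?q 0 1 1 0 = 0" by (rule z') simp
    have "?q 0 1 1 0 + 2 * (?X - ?Y)
        = 2 * (2 * ?X - (2*(x1*y2 + x2*y1) - 2*(x3*y3)))"
      by (simp add: qnrm_def co_mult algebra_simps)
    then have g3: "2 * ?X - (2*(x1*y2 + x2*y1) - 2*(x3*y3)) = 0"
      unfolding mn' z_g3 by (rule dbl)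
    have sd: "p = 0 \<and> q = 0" if "2 * 0 - (2 * 0 + 2 * (p - q)) = 0" "2 * 0 - (2 * (q + p) - 2 * 0) = 0" for p q :: 'a
    proof -
      have "p - q = 0" "q + p = 0" using that by simp_all
      then have "2 * p = 0" by (simp add: algebra_simps)
      then show ?thesis using \<open>q + p = 0\<close> by simp
    qed
    have "x3*y2 = 0 \<and> x2*y3 = 0"
      using f1 g1 unfolding M d1 d2 d3 by (rule sd)
    moreover have "x1*y3 = 0 \<and> x3*y1 = 0"
      using f2 g2 unfolding M d1 d2 d3 by (intro sd) (simp_all add: add.commute)
    moreover have "x2*y1 = 0 \<and> x1*y2 = 0"
      using f3 g3 unfolding M d1 d2 d3 by (intro sd) (simp_all add: add.commute)
    ultimately have d: "x1*y1 = 0 \<and> x2*y2 = 0 \<and> x3*y3 = 0 \<and> x3*y2 = 0 \<and> x2*y3 = 0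
      \<and> x1*y3 = 0 \<and> x3*y1 = 0 \<and> x2*y1 = 0 \<and> x1*y2 = 0" using d1 d2 d3 by simp
    with d have "v = 0 \<or> w = 0" unfolding v w by (auto simp: zero_qalg_def)
    with v_nz w_nz show False by blast
  qed
  with ker show ?thesis by blast
qed

text \<open>
  If \<open>v h = - h w\<close> and \<open>v x = - x w\<close> with \<open>h\<close> invertible, then \<open>h\<^sup>-\<^sup>1 x\<close> commutes with \<open>w\<close>; the conjugate \<open>h\<^sup>c\<close> is
  \<open>h\<^sup>-\<^sup>1\<close> up to a scalar. Hence \<open>x\<close> is determined by an element of the centralizer of \<open>w\<close>, which is a plane.
\<close>

lemma ker_quotient_commutes:
  assumes "a = 0" "f * h + h * g = 0" "f * x + x * g = 0" "qnrm h \<noteq> 0"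
  shows "(qconj h * x) * w = w * (qconj h * x)"
proof -
  have h: "v * h = - (h * w)" and x: "v * x = - (x * w)"
    using assms(2,3) unfolding ker_iff assms(1) by (simp_all add: eq_neg_iff_add_eq_0)
  have v: "qconj v = - v" and w: "qconj w = - w" by (simp_all add: qalg_eq_iff)
  have "qconj (v * h) = qconj (- (h * w))" by (simp only: h)
  moreover have "qconj (- (h * w)) = w * qconj h"
  proof -
    have "qconj (- (h * w)) = - qconj (h * w)" by (simp add: qalg_eq_iff)
    then show ?thesis by (simp add: qconj_mult w)
  qed
  ultimately have "qconj h * v = - (w * qconj h)"
    by (simp add: qconj_mult v) (metis minus_minus)
  then have "qconj h * (v * x) = - (w * qconj h * x)"
    by (simp add: mult.assoc[symmetric])
  then show ?thesis unfolding x by (simp add: mult.assoc)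
qed

end

text \<open>
  Commuting with \<open>w\<close> means that the cross product of the vector parts vanishes, so they are proportional. The factor
  is a quotient of coordinates, hence in any subfield that contains them.
\<close>

lemma commutes_with_vector:
  fixes z w :: "'a :: field_char_0 qalg"
  assumes "z * w = w * z" "w \<noteq> 0" "co0 w = 0"
  shows "\<exists>i\<in>{co1, co2, co3}. i w \<noteq> 0 \<and> z = qscal (co0 z) + qscal (i z / i w) * w"
proof -
  have c: "co1 (z * w) = co1 (w * z)" "co2 (z * w) = co2 (w * z)" "co3 (z * w) = co3 (w * z)"
    by (simp_all only: assms(1))
  have dbl: "p = q" if "r + p - q = r' + q - p" "r = r'" for p q r r' :: 'a
  proof -
    have "2 * p = 2 * q" using that by (simp add: algebra_simps)
    then show ?thesis by simp
  qed
  have e: "co2 z * co3 w = co3 z * co2 w" "co3 z * co1 w = co1 z * co3 w" "co1 z * co2 w = co2 z * co1 w"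
    using c unfolding co_mult assms(3)
    by (auto intro!: dbl[of "co0 z * co1 w"] dbl[of "co0 z * co2 w"] dbl[of "co0 z * co3 w"] simp: algebra_simps)
  from assms(2,3) consider "co1 w \<noteq> 0" | "co2 w \<noteq> 0" | "co3 w \<noteq> 0"
    by (auto simp: qalg_eq_iff)
  then show ?thesis
  proof cases
    case 1
    then have "z = qscal (co0 z) + qscal (co1 z / co1 w) * w"
      using e assms(3) by (simp add: qalg_eq_iff co_mult field_simps)
    with 1 show ?thesis by blast
  next
    case 2
    then have "z = qscal (co0 z) + qscal (co2 z / co2 w) * w"
      using e assms(3) by (simp add: qalg_eq_iff co_mult field_simps)
    with 2 show ?thesis by blast
  next
    case 3
    then have "z = qscal (co0 z) + qscal (co3 z / co3 w) * w"
      using e assms(3) by (simp add: qalg_eq_iff co_mult field_simps)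
    with 3 show ?thesis by blast
  qed
qed

locale subfield_set =
  fixes F :: "'k :: field_char_0 set"
  assumes F_0: "0 \<in> F" and F_1: "1 \<in> F"
    and F_add: "x \<in> F \<Longrightarrow> y \<in> F \<Longrightarrow> x + y \<in> F"
    and F_minus: "x \<in> F \<Longrightarrow> - x \<in> F"
    and F_mult: "x \<in> F \<Longrightarrow> y \<in> F \<Longrightarrow> x * y \<in> F"
    and F_inverse: "x \<in> F \<Longrightarrow> inverse x \<in> F"
begin

lemma F_diff: "x \<in> F \<Longrightarrow> y \<in> F \<Longrightarrow> x - y \<in> F"
  using F_add[of x "- y"] F_minus by simp

lemma F_divide: "x \<in> F \<Longrightarrow> y \<in> F \<Longrightarrow> x / y \<in> F"
  using F_mult F_inverse by (simp add: divide_inverse)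

lemma F_numeral: "numeral n \<in> F"
proof -
  have "of_nat n \<in> F" for n by (induction n) (auto intro: F_0 F_1 F_add)
  then show ?thesis by (metis of_nat_numeral)
qed

lemmas F_intros = F_0 F_1 F_add F_minus F_mult F_inverse F_diff F_divide F_numeral

definition QF :: "'k qalg set" where
  "QF = {p. co0 p \<in> F \<and> co1 p \<in> F \<and> co2 p \<in> F \<and> co3 p \<in> F}"

lemma QF_D: "p \<in> QF \<Longrightarrow> co0 p \<in> F" "p \<in> QF \<Longrightarrow> co1 p \<in> F" "p \<in> QF \<Longrightarrow> co2 p \<in> F" "p \<in> QF \<Longrightarrow> co3 p \<in> F"
  by (simp_all add: QF_def)

lemma QF_intros:
  "0 \<in> QF" "1 \<in> QF"
  "p \<in> QF \<Longrightarrow> q \<in> QF \<Longrightarrow> p + q \<in> QF" "p \<in> QF \<Longrightarrow> q \<in> QF \<Longrightarrow> p - q \<in> QF"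
  "p \<in> QF \<Longrightarrow> - p \<in> QF" "p \<in> QF \<Longrightarrow> q \<in> QF \<Longrightarrow> p * q \<in> QF"
  "p \<in> QF \<Longrightarrow> qconj p \<in> QF" "p \<in> QF \<Longrightarrow> qvec p \<in> QF" "c \<in> F \<Longrightarrow> qscal c \<in> QF"
  by (auto simp: QF_def co_mult intro!: F_intros)

lemma qnrm_F: "p \<in> QF \<Longrightarrow> qnrm p \<in> F"
  by (auto simp: QF_def qnrm_def intro!: F_intros)

lemma qunits_QF: "qunits \<subseteq> QF"
  by (auto simp: qunits_def QF_def F_intros)

end

text \<open>
  When the coordinates of \<open>f\<close> and \<open>g\<close> lie in a subfield \<open>F\<close>, so do \<open>\<lambda>\<close>, \<open>\<mu>\<close> and the solutions constructed above:
  each of them is a rational expression in those coordinates.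
\<close>

locale rational_sylvester_pair = sylvester_pair f g a m n v w + subfield_set F
  for f g :: "'k :: field_char_0 qalg" and a m n :: 'k and v w :: "'k qalg" and F :: "'k set" +
  assumes f_QF: "f \<in> QF" and g_QF: "g \<in> QF"
begin

lemma vw_QF: "v \<in> QF" "w \<in> QF"
  using f_QF g_QF by (simp_all add: v_def w_def QF_intros)

lemma amn_F: "a \<in> F" "m \<in> F" "n \<in> F"
  using f_QF g_QF vw_QF by (simp_all add: a_def m_def n_def qnrm_F F_intros QF_D)

lemma rational_ker_witness:
  assumes "sylv_disc a m n = 0" "a \<noteq> 0"
  shows "\<exists>x\<in>QF. x \<noteq> 0 \<and> f * x + x * g = 0"
proof -
  have "vl \<in> QF" "wm \<in> QF"
    unfolding vl_def wm_def lam_def mu_def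
    by (intro QF_intros vw_QF F_intros amn_F)+
  then have "vl * e * wm \<in> QF" if "e \<in> qunits" for e
    using that qunits_QF by (auto intro!: QF_intros)
  then show ?thesis using ker_witness[OF assms] by blast
qed

lemma rational_ker_invertible:
  assumes "a = 0" "m = n"
  shows "\<exists>h\<in>QF. qnrm h \<noteq> 0 \<and> f * h + h * g = 0"
proof -
  obtain y where y: "{co0 y, co1 y, co2 y, co3 y} \<subseteq> {0, 1}" "qnrm (v * y - y * w) \<noteq> 0"
    "f * (v * y - y * w) + (v * y - y * w) * g = 0"
    using ker_invertible[OF assms] by blast
  have "z \<in> F" if "z \<in> {0, 1}" for z using that F_0 F_1 by blast
  with y(1) have "y \<in> QF" unfolding QF_def by simp
  then have "v * y - y * w \<in> QF" by (intro QF_intros vw_QF)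
  with y show ?thesis by blast
qed

lemma ker_line_coeff:
  assumes "x \<in> QF" "y \<in> QF" "y = qscal c * x" "x \<noteq> 0"
  shows "c \<in> F"
proof -
  from assms(4) obtain i where i: "i \<in> {co0, co1, co2, co3}" "i x \<noteq> 0"
    by (auto simp: qalg_eq_iff)
  then have "i y = c * i x" unfolding assms(3) by (auto simp: co_mult)
  with i have "c = i y / i x" by simp
  moreover have "i y \<in> F" "i x \<in> F" using i assms(1,2) by (auto simp: QF_def)
  ultimately show ?thesis by (simp add: F_divide)
qed

lemma ker_plane_iff:
  assumes "a = 0" "h \<in> QF" "f * h + h * g = 0" "qnrm h \<noteq> 0" "x \<in> QF"
  shows "f * x + x * g = 0 \<longleftrightarrow> (\<exists>\<alpha>\<in>F. \<exists>\<beta>\<in>F. x = qscal \<alpha> * h + qscal \<beta> * (h * w))"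
proof
  assume x: "f * x + x * g = 0"
  let ?z = "qconj h * x" and ?N = "qnrm h"
  obtain i where i: "i \<in> {co1, co2, co3}" "i w \<noteq> 0" "?z = qscal (co0 ?z) + qscal (i ?z / i w) * w"
    using commutes_with_vector[OF ker_quotient_commutes[OF assms(1,3) x assms(4)] w_nz] by auto
  have z: "?z \<in> QF" using assms by (intro QF_intros)
  then have iF: "i ?z \<in> F" "i w \<in> F" "co0 ?z \<in> F" "?N \<in> F"
    using i vw_QF assms(2) by (auto simp: QF_def qnrm_F)
  have "qscal ?N * x = h * ?z" by (simp add: mult.assoc[symmetric] mult_qconj)
  also have "\<dots> = h * (qscal (co0 ?z) + qscal (i ?z / i w) * w)" using i(3) by (rule arg_cong)
  also have "\<dots> = qscal (co0 ?z) * h + qscal (i ?z / i w) * (h * w)"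
    unfolding distrib_left qscal_left_commute[of h] qscal_commute[of h] ..
  finally have "qscal (1 / ?N) * (qscal ?N * x) =
      qscal (1 / ?N) * (qscal (co0 ?z) * h + qscal (i ?z / i w) * (h * w))" by (rule arg_cong)
  then have "x = qscal (1 / ?N * co0 ?z) * h + qscal (1 / ?N * (i ?z / i w)) * (h * w)"
    unfolding distrib_left qscal_qscal using assms(4) by simp
  moreover have "1 / ?N * co0 ?z \<in> F" "1 / ?N * (i ?z / i w) \<in> F"
    by (intro F_intros iF)+
  ultimately show "\<exists>\<alpha>\<in>F. \<exists>\<beta>\<in>F. x = qscal \<alpha> * h + qscal \<beta> * (h * w)" by blast
next
  assume "\<exists>\<alpha>\<in>F. \<exists>\<beta>\<in>F. x = qscal \<alpha> * h + qscal \<beta> * (h * w)"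
  then obtain \<alpha> \<beta> where x: "x = qscal \<alpha> * h + qscal \<beta> * (h * w)" by blast
  have h: "v * h = - (h * w)"
    using assms(3) unfolding ker_iff assms(1) by (simp add: eq_neg_iff_add_eq_0)
  have "v * x = qscal \<alpha> * (v * h) + qscal \<beta> * (v * h * w)"
    unfolding x distrib_left qscal_left_commute[of v] by (simp only: mult.assoc)
  also have "\<dots> = - (x * w)"
    unfolding h x by (simp add: distrib_right mult.assoc)
  finally show "f * x + x * g = 0"
    unfolding ker_iff assms(1) by simp
qed

text \<open>
  For an invertible \<open>h\<close> in the kernel, the norm of \<open>h (\<alpha> + \<beta> w)\<close> is that of \<open>h\<close> times \<open>\<alpha>\<^sup>2 + \<beta>\<^sup>2 n\<close>. A zero divisor
  therefore exhibits \<open>- n\<close> as a square, which is the same as \<open>n\<close> being one once \<open>- 1\<close> is a square.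
\<close>

lemma ker_zero_divisor_iff:
  assumes "a = 0" "m = n" "\<iota> \<in> F" "\<iota> * \<iota> = - 1"
  shows "(\<exists>x\<in>QF. x \<noteq> 0 \<and> qnrm x = 0 \<and> f * x + x * g = 0) \<longleftrightarrow> (\<exists>r\<in>F. m = r * r)"
proof -
  obtain h where h: "h \<in> QF" "qnrm h \<noteq> 0" "f * h + h * g = 0"
    using rational_ker_invertible[OF assms(1,2)] by blast
  have nrm: "qnrm (qscal \<alpha> * h + qscal \<beta> * (h * w)) = qnrm h * (\<alpha> * \<alpha> + \<beta> * \<beta> * n)" for \<alpha> \<beta>
  proof -
    have "qscal \<alpha> * h + qscal \<beta> * (h * w) = h * (qscal \<alpha> + qscal \<beta> * w)"
      unfolding distrib_left qscal_left_commute[of h] qscal_commute[of h] ..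
    moreover have "qnrm (qscal \<alpha> + qscal \<beta> * w) = \<alpha> * \<alpha> + \<beta> * \<beta> * n"
      by (simp add: qnrm_def co_mult n_def algebra_simps)
    ultimately show ?thesis by (simp add: qnrm_mult)
  qed
  show ?thesis
  proof
    assume "\<exists>x\<in>QF. x \<noteq> 0 \<and> qnrm x = 0 \<and> f * x + x * g = 0"
    then obtain x where x: "x \<in> QF" "x \<noteq> 0" "qnrm x = 0" "f * x + x * g = 0" by blast
    obtain \<alpha> \<beta> where ab: "\<alpha> \<in> F" "\<beta> \<in> F" "x = qscal \<alpha> * h + qscal \<beta> * (h * w)"
      using x ker_plane_iff[OF assms(1) h(1,3,2) x(1)] by blast
    have 0: "\<alpha> * \<alpha> + \<beta> * \<beta> * n = 0" using x(3) h(2) unfolding ab(3) nrm by simp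
    have "\<beta> \<noteq> 0" using 0 x(2) ab(3) by auto
    have "n = - (\<alpha> * \<alpha>) / (\<beta> * \<beta>)" using 0 \<open>\<beta> \<noteq> 0\<close> by (simp add: field_simps eq_neg_iff_add_eq_0)
    also have "\<dots> = (\<iota> * \<iota>) * (\<alpha> * \<alpha>) / (\<beta> * \<beta>)" using assms(4) by simp
    also have "\<dots> = (\<iota> * \<alpha> / \<beta>) * (\<iota> * \<alpha> / \<beta>)" by (simp add: field_simps)
    finally show "\<exists>r\<in>F. m = r * r"
      using assms(2,3) ab by (intro bexI[of _ "\<iota> * \<alpha> / \<beta>"]) (simp_all add: F_intros)
  next
    assume "\<exists>r\<in>F. m = r * r"
    then obtain r where r: "r \<in> F" "m = r * r" by blast
    let ?x = "qscal (\<iota> * r) * h + qscal 1 * (h * w)"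
    have xe: "?x = h * (w + qscal (\<iota> * r))"
      unfolding distrib_left qscal_commute[of h] by simp
    have xQF: "?x \<in> QF" using h assms(3) r by (intro QF_intros F_intros vw_QF)
    have "f * ?x + ?x * g = 0"
      using ker_plane_iff[OF assms(1) h(1,3,2) xQF] assms(3) r(1) F_intros by blast
    moreover have "?x \<noteq> 0"
    proof
      assume "?x = 0"
      then have "qconj h * (h * (w + qscal (\<iota> * r))) = 0" using xe by simp
      then have "qscal (qnrm h) * (w + qscal (\<iota> * r)) = 0" by (simp add: mult.assoc[symmetric] mult_qconj)
      then have "w + qscal (\<iota> * r) = 0" using h(2) by (rule qscal_cancel)
      with plus_qscal_nz[OF w_nz] show False by simp
    qed
    moreover have "qnrm ?x = 0"
    proof -
      have "(\<iota> * r) * (\<iota> * r) + 1 * 1 * n = (\<iota> * \<iota> + 1) * (r * r)"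
        using assms(2) r(2) by (simp add: algebra_simps)
      then show ?thesis unfolding nrm using assms(4) by simp
    qed
    ultimately show "\<exists>x\<in>QF. x \<noteq> 0 \<and> qnrm x = 0 \<and> f * x + x * g = 0" using xQF by blast
  qed
qed

end


section \<open>Rank and nullity of linear endomorphisms\<close>

text \<open>
  Induction along \<open>E = K v + E'\<close>: either \<open>T v = T e\<close> for some \<open>e\<close> in \<open>E'\<close>, and then \<open>v - e\<close> enlarges the kernel, or \<open>T v\<close>
  enlarges the image.
\<close>

lemma (in ring) linear_map_rank_nullity:
  assumes K: "subfield K R"
    and T: "\<And>x. x \<in> carrier R \<Longrightarrow> T x \<in> carrier R"
    and lin: "\<And>k x y. k \<in> K \<Longrightarrow> x \<in> carrier R \<Longrightarrow> y \<in> carrier R \<Longrightarrow> T (k \<otimes> x \<oplus> y) = k \<otimes> T x \<oplus> T y"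
    and E: "dimension n K E"
  shows "\<exists>r s. dimension r K {x \<in> E. T x = \<zero>} \<and> dimension s K (T ` E) \<and> r + s = n"
  using E
proof (induction n arbitrary: E)
  have K0: "\<zero> \<in> K" and K1: "\<one> \<in> K" and Kc: "K \<subseteq> carrier R"
    using subringE[OF subfieldE(1)[OF K]] by auto
  have T0: "T \<zero> = \<zero>"
  proof -
    have "T (\<zero> \<otimes> \<zero> \<oplus> \<zero>) = \<zero> \<otimes> T \<zero> \<oplus> T \<zero>" by (rule lin) (use K0 in auto)
    moreover have "\<one> \<otimes> \<zero> \<oplus> \<zero> = \<zero>" by simp
    moreover have "T (\<one> \<otimes> \<zero> \<oplus> \<zero>) = \<one> \<otimes> T \<zero> \<oplus> T \<zero>" by (rule lin) (use K1 in auto)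
    ultimately have "T \<zero> = T \<zero> \<oplus> T \<zero>" using T[of \<zero>] by simp
    then show ?thesis unfolding add.r_cancel_one'[OF T[OF zero_closed] T[OF zero_closed]] .
  qed
  {
    case 0
    then have "E = {\<zero>}" by (rule dimension_zero[OF K])
    then have "{x \<in> E. T x = \<zero>} = {\<zero>}" "T ` E = {\<zero>}" using T0 by auto
    then show ?case using zero_dim[of K] by auto
  next
    case (Suc n)
    from dimension_backwards[OF K Suc.prems]
    obtain v E' where v: "v \<in> carrier R" "v \<notin> E'" "dimension n K E'" "E = line_extension K v E'"
      by metis
    note sp = space_subgroup_props[OF K v(3)]
    obtain r s where rs: "dimension r K {x \<in> E'. T x = \<zero>}" "dimension s K (T ` E')" "r + s = n"
      using Suc.IH[OF v(3)] by blast
    note si = space_subgroup_props[OF K rs(2)]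
    have Em: "x \<in> E \<longleftrightarrow> (\<exists>k\<in>K. \<exists>y\<in>E'. x = k \<otimes> v \<oplus> y)" for x
      unfolding v(4) line_extension_mem_iff ..
    have Tm: "T (k \<otimes> v \<oplus> y) = k \<otimes> T v \<oplus> T y" if "k \<in> K" "y \<in> E'" for k y
      using lin that v(1) sp(1) by blast
    show ?case
    proof (cases "T v \<in> T ` E'")
      case True
      then obtain e where e: "e \<in> E'" "T v = T e" by blast
      have ec: "e \<in> carrier R" using e sp(1) by blast
      define u where "u = v \<ominus> e"
      have uc: "u \<in> carrier R" using v(1) ec by (simp add: u_def)
      have veq: "v = u \<oplus> e" unfolding u_def using v(1) ec by algebra
      have Tu: "T u = \<zero>"
      proof -
        have "T (\<one> \<otimes> u \<oplus> e) = \<one> \<otimes> T u \<oplus> T e" using lin K1 uc ec by blast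
        then have "T v = T u \<oplus> T e" using uc ec veq T by simp
        then show ?thesis unfolding e(2) add.r_cancel_one'[OF T[OF ec] T[OF uc]] .
      qed
      have "u \<notin> {x \<in> E'. T x = \<zero>}"
        using sp(3) e(1) v(2) veq by blast
      then have "dimension (Suc r) K (line_extension K u {x \<in> E'. T x = \<zero>})"
        using Suc_dim[OF uc _ rs(1)] by blast
      moreover have "line_extension K u {x \<in> E'. T x = \<zero>} = {x \<in> E. T x = \<zero>}"
      proof (intro Set.set_eqI iffI)
        fix x assume "x \<in> line_extension K u {x \<in> E'. T x = \<zero>}"
        then obtain k y where x: "k \<in> K" "y \<in> E'" "T y = \<zero>" "x = k \<otimes> u \<oplus> y"
          unfolding line_extension_mem_iff by blast
        have kc: "k \<in> carrier R" and yc: "y \<in> carrier R" using x Kc sp(1) by auto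
        have "x = k \<otimes> v \<oplus> (\<ominus> (k \<otimes> e) \<oplus> y)"
          unfolding x(4) veq using uc ec kc yc by algebra
        moreover have "\<ominus> (k \<otimes> e) \<oplus> y \<in> E'" using sp(3,4,5) x e by blast
        ultimately have "x \<in> E" unfolding Em using x(1) by blast
        moreover have "T x = \<zero>" using lin[OF x(1) uc yc] x(3,4) Tu kc by simp
        ultimately show "x \<in> {x \<in> E. T x = \<zero>}" by blast
      next
        fix x assume "x \<in> {x \<in> E. T x = \<zero>}"
        then obtain k y where x: "k \<in> K" "y \<in> E'" "x = k \<otimes> v \<oplus> y" "T x = \<zero>"
          using Em by blast
        have kc: "k \<in> carrier R" and yc: "y \<in> carrier R" using x Kc sp(1) by auto
        have "x = k \<otimes> u \<oplus> (k \<otimes> e \<oplus> y)" unfolding x(3) veq using uc ec kc yc by algebra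
        moreover have "T (k \<otimes> e \<oplus> y) = \<zero>" using lin[OF x(1) ec yc] Tm[OF x(1,2)] x(3,4) e(2) by simp
        moreover have "k \<otimes> e \<oplus> y \<in> E'" using sp(3,5) x e by blast
        ultimately show "x \<in> line_extension K u {x \<in> E'. T x = \<zero>}"
          unfolding line_extension_mem_iff using x(1) by blast
      qed
      moreover have "T ` E = T ` E'"
      proof (intro Set.set_eqI iffI)
        fix z assume "z \<in> T ` E"
        then obtain x0 where x0: "x0 \<in> E" "z = T x0" by blast
        obtain k y where x: "k \<in> K" "y \<in> E'" "x0 = k \<otimes> v \<oplus> y"
          using x0(1) unfolding Em by blast
        have yc: "y \<in> carrier R" using x(2) sp(1) by blast
        have "z = T (k \<otimes> e \<oplus> y)"
          unfolding x0(2) x(3) Tm[OF x(1,2)] e(2) lin[OF x(1) ec yc] ..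
        moreover have "k \<otimes> e \<oplus> y \<in> E'" using sp(3)[OF sp(5)[OF x(1) e(1)] x(2)] .
        ultimately show "z \<in> T ` E'" by blast
      next
        fix z assume "z \<in> T ` E'"
        then obtain y where y: "y \<in> E'" "z = T y" by blast
        have "y = \<zero> \<otimes> v \<oplus> y" using v(1) y(1) sp(1) by (simp add: subsetD)
        then have "y \<in> E" unfolding Em using y(1) K0 by blast
        then show "z \<in> T ` E" using y(2) by blast
      qed
      ultimately show ?thesis using rs by (metis add_Suc)
    next
      case False
      have "dimension (Suc s) K (line_extension K (T v) (T ` E'))"
        using Suc_dim[OF T[OF v(1)] False rs(2)] .
      moreover have "line_extension K (T v) (T ` E') = T ` E"
      proof (intro Set.set_eqI iffI)
        fix z assume "z \<in> line_extension K (T v) (T ` E')"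
        then obtain k y where "k \<in> K" "y \<in> E'" "z = k \<otimes> T v \<oplus> T y"
          unfolding line_extension_mem_iff by blast
        then have "z = T (k \<otimes> v \<oplus> y)" "k \<otimes> v \<oplus> y \<in> E" using Tm Em by auto
        then show "z \<in> T ` E" by blast
      next
        fix z assume "z \<in> T ` E"
        then obtain x0 where x0: "x0 \<in> E" "z = T x0" by blast
        obtain k y where ky: "k \<in> K" "y \<in> E'" "x0 = k \<otimes> v \<oplus> y"
          using x0(1) unfolding Em by blast
        have "z = k \<otimes> T v \<oplus> T y" unfolding x0(2) ky(3) by (rule Tm[OF ky(1,2)])
        then show "z \<in> line_extension K (T v) (T ` E')"
          unfolding line_extension_mem_iff using ky(1,2) by blast
      qed
      moreover have "{x \<in> E. T x = \<zero>} = {x \<in> E'. T x = \<zero>}"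
      proof (intro Set.set_eqI iffI)
        fix x assume "x \<in> {x \<in> E. T x = \<zero>}"
        then obtain k y where x: "k \<in> K" "y \<in> E'" "x = k \<otimes> v \<oplus> y" "T x = \<zero>"
          using Em by blast
        have kc: "k \<in> carrier R" and yc: "y \<in> carrier R" using x Kc sp(1) by auto
        have "k \<otimes> T v \<oplus> T y = \<zero>" using Tm x by simp
        then have "k \<otimes> T v = \<ominus> T y"
          using minus_equality[symmetric] T v(1) yc kc by blast
        then have "k \<otimes> T v \<in> T ` E'" using si(4) x(2) by simp
        then have "k = \<zero>" using si(6)[of k "T v"] x(1) False T[OF v(1)] by blast
        then have "x = y" using x(3) v(1) yc by simp
        then show "x \<in> {x \<in> E'. T x = \<zero>}" using x by blast
      next
        fix y assume y: "y \<in> {x \<in> E'. T x = \<zero>}"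
        have "y = \<zero> \<otimes> v \<oplus> y" using v(1) y sp(1) by (simp add: subsetD)
        then have "y \<in> E" unfolding Em using y K0 by blast
        then show "y \<in> {x \<in> E. T x = \<zero>}" using y by blast
      qed
      ultimately show ?thesis using rs by (metis add_Suc_right)
    qed
  }
qed

section \<open>Rings that are quaternion algebras over a subfield\<close>

text \<open>
  The ring axioms of \<open>R\<close> are a consequence: they are pulled back along \<open>\<Psi>\<close>. The subfield \<open>K\<close> of \<open>R\<close> below is the inverse
  image of the scalars, so \<open>R\<close> has dimension four over it.
\<close>

locale quat_model = subfield_set F for F :: "'k :: field_char_0 set" +
  fixes R (structure) and \<Psi> :: "'r \<Rightarrow> 'k qalg"
  assumes bij: "bij_betw \<Psi> (carrier R) QF"
    and add_cl: "x \<in> carrier R \<Longrightarrow> y \<in> carrier R \<Longrightarrow> x \<oplus> y \<in> carrier R"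
    and mult_cl: "x \<in> carrier R \<Longrightarrow> y \<in> carrier R \<Longrightarrow> x \<otimes> y \<in> carrier R"
    and zero_cl: "\<zero> \<in> carrier R" and one_cl: "\<one> \<in> carrier R"
    and Psi_add: "x \<in> carrier R \<Longrightarrow> y \<in> carrier R \<Longrightarrow> \<Psi> (x \<oplus> y) = \<Psi> x + \<Psi> y"
    and Psi_mult: "x \<in> carrier R \<Longrightarrow> y \<in> carrier R \<Longrightarrow> \<Psi> (x \<otimes> y) = \<Psi> x * \<Psi> y"
    and Psi_zero: "\<Psi> \<zero> = 0" and Psi_one: "\<Psi> \<one> = 1"
begin

lemma Psi_eq_iff: "x \<in> carrier R \<Longrightarrow> y \<in> carrier R \<Longrightarrow> x = y \<longleftrightarrow> \<Psi> x = \<Psi> y"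
  using bij by (auto simp: bij_betw_def inj_on_def)

lemma Psi_QF: "x \<in> carrier R \<Longrightarrow> \<Psi> x \<in> QF"
  using bij by (auto simp: bij_betw_def)

lemma Psi_surj: "q \<in> QF \<Longrightarrow> \<exists>x\<in>carrier R. \<Psi> x = q"
  using bij unfolding bij_betw_def by (metis imageE)

lemma ring_R: "ring R"
proof (rule ringI)
  show "abelian_group R"
  proof (rule abelian_groupI)
    fix x assume x: "x \<in> carrier R"
    obtain y where "y \<in> carrier R" "\<Psi> y = - \<Psi> x" using Psi_surj QF_intros(5)[OF Psi_QF[OF x]] by blast
    then show "\<exists>y\<in>carrier R. y \<oplus> x = \<zero>"
      using x by (intro bexI[of _ y]) (simp_all add: Psi_eq_iff add_cl zero_cl Psi_add Psi_zero)
  qed (simp_all add: Psi_eq_iff add_cl zero_cl Psi_add Psi_zero add_ac)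
  show "monoid R"
    by (rule monoidI) (simp_all add: Psi_eq_iff mult_cl one_cl Psi_mult Psi_one mult.assoc)
qed (simp_all add: Psi_eq_iff add_cl mult_cl Psi_add Psi_mult distrib_left distrib_right)

sublocale ring R by (rule ring_R)

lemma Psi_minus: "x \<in> carrier R \<Longrightarrow> \<Psi> (\<ominus> x) = - \<Psi> x"
  using Psi_add[of "\<ominus> x" x] by (simp add: l_neg Psi_zero eq_neg_iff_add_eq_0)

lemma Psi_diff: "x \<in> carrier R \<Longrightarrow> y \<in> carrier R \<Longrightarrow> \<Psi> (x \<ominus> y) = \<Psi> x - \<Psi> y"
  by (simp add: a_minus_def Psi_add Psi_minus)

lemma Psi_square: "x \<in> carrier R \<Longrightarrow> \<Psi> (x [^] (2::nat)) = \<Psi> x * \<Psi> x"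
  by (simp add: numeral_2_eq_2 Psi_mult Psi_one one_cl mult_cl)

lemmas Psi_simps = Psi_add Psi_mult Psi_zero Psi_one Psi_minus Psi_diff Psi_square

definition K :: "'r set" where "K = {x \<in> carrier R. qvec (\<Psi> x) = 0}"

lemma K_iff: "x \<in> K \<longleftrightarrow> x \<in> carrier R \<and> \<Psi> x = qscal (co0 (\<Psi> x))"
  by (auto simp: K_def qalg_eq_iff)

lemma K_D: "x \<in> K \<Longrightarrow> x \<in> carrier R" "x \<in> K \<Longrightarrow> \<Psi> x = qscal (co0 (\<Psi> x))" "x \<in> K \<Longrightarrow> co0 (\<Psi> x) \<in> F"
  using Psi_QF[of x] by (auto simp: K_iff QF_D)

lemma K_I: "x \<in> carrier R \<Longrightarrow> \<Psi> x = qscal c \<Longrightarrow> x \<in> K"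
  by (auto simp: K_iff)

lemma K_surj:
  assumes "c \<in> F"
  shows "\<exists>k\<in>K. \<Psi> k = qscal c"
proof -
  obtain k where "k \<in> carrier R" "\<Psi> k = qscal c"
    using Psi_surj[OF QF_intros(9)[OF assms]] by blast
  then show ?thesis using K_I by blast
qed

text \<open>
  The inverse of \<open>x\<close> is its conjugate divided by the norm, which is an element of \<open>F\<close>.
\<close>

lemma Units_iff: "x \<in> Units R \<longleftrightarrow> x \<in> carrier R \<and> qnrm (\<Psi> x) \<noteq> 0"
proof
  assume x: "x \<in> Units R"
  then have c: "x \<in> carrier R" "inv x \<in> carrier R" by (rule Units_closed, rule Units_inv_closed)
  have "qnrm (\<Psi> x) * qnrm (\<Psi> (inv x)) = qnrm (\<Psi> (x \<otimes> inv x))"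
    unfolding Psi_mult[OF c] qnrm_mult ..
  also have "\<dots> = 1" unfolding Units_r_inv[OF x] Psi_one by (simp add: qnrm_def)
  finally show "x \<in> carrier R \<and> qnrm (\<Psi> x) \<noteq> 0" using c by auto
next
  assume x: "x \<in> carrier R \<and> qnrm (\<Psi> x) \<noteq> 0"
  let ?q = "qscal (1 / qnrm (\<Psi> x)) * qconj (\<Psi> x)"
  have "?q \<in> QF" using x by (intro QF_intros F_intros qnrm_F Psi_QF) auto
  then obtain y where y: "y \<in> carrier R" "\<Psi> y = ?q" using Psi_surj by blast
  have "?q * \<Psi> x = 1" "\<Psi> x * ?q = 1"
    using x by (simp_all add: qscal_left_commute[of "\<Psi> x"] mult_qconj mult.assoc)
  then have "y \<otimes> x = \<one>" "x \<otimes> y = \<one>"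
    using x y by (simp_all add: Psi_eq_iff Psi_simps)
  then show "x \<in> Units R" using x y by (auto simp: Units_def)
qed

lemma subfield_K: "subfield K R"
proof (rule subfieldI)
  have c: "a \<otimes> b = b \<otimes> a" if ab: "a \<in> K" "b \<in> K" for a b
  proof -
    obtain \<alpha> where "\<Psi> a = qscal \<alpha>" using K_D(2)[OF ab(1)] by blast
    then have "\<Psi> (a \<otimes> b) = \<Psi> (b \<otimes> a)"
      using that by (simp add: Psi_mult K_D(1) qscal_commute[of "\<Psi> b"])
    then show ?thesis using ab by (simp add: Psi_eq_iff K_D(1))
  qed
  show "subcring K R"
  proof (rule subcringI)
    show "subring K R"
    proof (rule subringI)
      show "a \<otimes> b \<in> K" if "a \<in> K" "b \<in> K" for a b
        using that by (auto simp: K_def Psi_mult qalg_eq_iff co_mult)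
    qed (auto simp: K_def Psi_simps qalg_eq_iff)
  qed (rule c)
  show "Units (R\<lparr>carrier := K\<rparr>) = K - {\<zero>}"
  proof (intro Set.set_eqI iffI)
    fix x assume "x \<in> Units (R\<lparr>carrier := K\<rparr>)"
    then obtain y where "x \<in> K" "y \<in> K" "y \<otimes> x = \<one>" by (auto simp: Units_def)
    then show "x \<in> K - {\<zero>}"
      using Psi_eq_iff[of \<zero> \<one>] by (auto simp: K_D(1) Psi_simps)
  next
    fix x assume x: "x \<in> K - {\<zero>}"
    obtain \<alpha> where \<alpha>: "\<Psi> x = qscal \<alpha>" "\<alpha> \<in> F" using K_D[of x] x by blast
    have nz: "\<alpha> \<noteq> 0" using x \<alpha> Psi_eq_iff[of x \<zero>] K_D(1)[of x] by (auto simp: Psi_zero)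
    obtain y where y: "y \<in> K" "\<Psi> y = qscal (1 / \<alpha>)"
      using K_surj[OF F_divide[OF F_1 \<alpha>(2)]] by blast
    have "\<Psi> (y \<otimes> x) = \<Psi> \<one>"
      using x y nz \<alpha> by (simp add: Psi_mult Psi_one K_D(1))
    then have "y \<otimes> x = \<one>" using x y K_D(1) by (simp add: Psi_eq_iff)
    then show "x \<in> Units (R\<lparr>carrier := K\<rparr>)" using x y c[of x y] by (auto simp: Units_def intro!: bexI[of _ y])
  qed
qed

lemma line_extension_iff:
  assumes "v \<in> carrier R" "E \<subseteq> carrier R"
  shows "x \<in> line_extension K v E \<longleftrightarrow>
    x \<in> carrier R \<and> (\<exists>c\<in>F. \<exists>y\<in>E. \<Psi> x = qscal c * \<Psi> v + \<Psi> y)"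
proof
  assume "x \<in> line_extension K v E"
  then obtain k y where k: "k \<in> K" "y \<in> E" "x = k \<otimes> v \<oplus> y"
    unfolding line_extension_mem_iff by blast
  then have "\<Psi> x = \<Psi> k * \<Psi> v + \<Psi> y" "x \<in> carrier R"
    using assms K_D(1)[of k] by (auto simp: Psi_simps subsetD)
  then show "x \<in> carrier R \<and> (\<exists>c\<in>F. \<exists>y\<in>E. \<Psi> x = qscal c * \<Psi> v + \<Psi> y)"
    using k K_D(2,3)[OF k(1)] by metis
next
  assume "x \<in> carrier R \<and> (\<exists>c\<in>F. \<exists>y\<in>E. \<Psi> x = qscal c * \<Psi> v + \<Psi> y)"
  then obtain c y where c: "x \<in> carrier R" "c \<in> F" "y \<in> E" "\<Psi> x = qscal c * \<Psi> v + \<Psi> y" by blast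
  obtain k where k: "k \<in> K" "\<Psi> k = qscal c" using K_surj c(2) by blast
  then have "x = k \<otimes> v \<oplus> y" using c assms by (auto simp: Psi_eq_iff Psi_simps K_D(1) subsetD)
  then show "x \<in> line_extension K v E" unfolding line_extension_mem_iff using k c by blast
qed

lemma dimension_carrier: "dimension 4 K (carrier R)"
proof -
  define W :: "nat \<Rightarrow> 'k qalg set" where "W n = {q. (n < 4 \<longrightarrow> co0 q = 0) \<and> (n < 3 \<longrightarrow> co1 q = 0) \<and>
    (n < 2 \<longrightarrow> co2 q = 0) \<and> (n < 1 \<longrightarrow> co3 q = 0)}" for n
  define V where "V n = {x \<in> carrier R. \<Psi> x \<in> W n}" for n
  have "V 0 = {\<zero>}"
    unfolding V_def W_def by (auto simp: Psi_eq_iff Psi_zero qalg_eq_iff)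
  then have d0: "dimension 0 K (V 0)" by simp
  have step: "dimension (Suc n) K (V (Suc n))"
    if dn: "dimension n K (V n)" and e: "e \<in> QF" and ico: "i \<in> {co0, co1, co2, co3}"
      and i: "\<And>q. q \<in> W n \<Longrightarrow> i q = 0" "i e = 1"
      and W: "\<And>q. q \<in> W (Suc n) \<longleftrightarrow> q - qscal (i q) * e \<in> W n"
    for n e and i :: "'k qalg \<Rightarrow> 'k"
  proof -
    obtain v where v: "v \<in> carrier R" "\<Psi> v = e" using Psi_surj[OF e] by blast
    have "v \<notin> V n" using i v by (force simp: V_def)
    then have "dimension (Suc n) K (line_extension K v (V n))" using Suc_dim v(1) dn by blast
    moreover have "line_extension K v (V n) = V (Suc n)"
    proof (intro Set.set_eqI)
      fix x
      have "V n \<subseteq> carrier R" by (auto simp: V_def)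
      then have "x \<in> line_extension K v (V n) \<longleftrightarrow>
          x \<in> carrier R \<and> (\<exists>c\<in>F. \<exists>y\<in>V n. \<Psi> x = qscal c * e + \<Psi> y)"
        using line_extension_iff[OF v(1)] v(2) by simp
      also have "\<dots> \<longleftrightarrow> x \<in> carrier R \<and> (\<exists>y\<in>V n. \<Psi> x = qscal (i (\<Psi> x)) * e + \<Psi> y)"
      proof -
        have "c = i (\<Psi> x)" if c: "\<Psi> x = qscal c * e + \<Psi> y" "y \<in> V n" for c y
        proof -
          have "i (\<Psi> y) = 0" using c i by (simp add: V_def)
          then show ?thesis unfolding c(1) using ico i(2) by (auto simp: co_mult)
        qed
        moreover have "i (\<Psi> x) \<in> F" if "x \<in> carrier R"
          using Psi_QF[OF that] ico by (auto simp: QF_def)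
        ultimately show ?thesis by blast
      qed
      also have "\<dots> \<longleftrightarrow> x \<in> V (Suc n)"
      proof -
        have "(\<exists>y\<in>V n. p = q + \<Psi> y) \<longleftrightarrow> p - q \<in> W n" if "p - q \<in> QF" for p q
        proof
          assume "p - q \<in> W n"
          moreover obtain y where "y \<in> carrier R" "\<Psi> y = p - q" using Psi_surj[OF \<open>p - q \<in> QF\<close>] by blast
          ultimately show "\<exists>y\<in>V n. p = q + \<Psi> y" by (intro bexI[of _ y]) (simp_all add: V_def)
        qed (auto simp: V_def)
        moreover have "\<Psi> x - qscal (i (\<Psi> x)) * e \<in> QF" if "x \<in> carrier R"
          using Psi_QF[OF that] ico e by (intro QF_intros) (auto simp: QF_def)
        ultimately show ?thesis unfolding V_def[of "Suc n"] W by blast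
      qed
      finally show "x \<in> line_extension K v (V n) \<longleftrightarrow> x \<in> V (Suc n)" .
    qed
    ultimately show ?thesis by simp
  qed
  have u: "1 \<in> QF" "QA 0 1 0 0 \<in> QF" "QA 0 0 1 0 \<in> QF" "QA 0 0 0 1 \<in> QF"
    using qunits_QF by (auto simp: qunits_def)
  have d1: "dimension (Suc 0) K (V (Suc 0))"
    by (rule step[OF d0 u(4), of co3])
      (auto simp: W_def co_mult)
  have d2: "dimension (Suc (Suc 0)) K (V (Suc (Suc 0)))"
    by (rule step[OF d1 u(3), of co2])
      (auto simp: W_def co_mult)
  have d3: "dimension (Suc (Suc (Suc 0))) K (V (Suc (Suc (Suc 0))))"
    by (rule step[OF d2 u(2), of co1])
      (auto simp: W_def co_mult)
  have d4: "dimension (Suc (Suc (Suc (Suc 0)))) K (V (Suc (Suc (Suc (Suc 0)))))"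
    by (rule step[OF d3 u(1), of co0])
      (auto simp: W_def co_mult)
  have "V 4 = carrier R" by (auto simp: V_def W_def)
  with d4 show ?thesis by (simp add: numeral_eq_Suc)
qed

definition sylvester :: "'r \<Rightarrow> 'r \<Rightarrow> 'r \<Rightarrow> 'r" where
  "sylvester f g x = f \<otimes> x \<oplus> x \<otimes> g"

lemma Psi_sylvester:
  "f \<in> carrier R \<Longrightarrow> g \<in> carrier R \<Longrightarrow> x \<in> carrier R \<Longrightarrow> \<Psi> (sylvester f g x) = \<Psi> f * \<Psi> x + \<Psi> x * \<Psi> g"
  by (simp add: sylvester_def Psi_simps)

lemma rank_from_nullity:
  assumes "f \<in> carrier R" "g \<in> carrier R"
    and "dimension r K {x \<in> carrier R. \<Psi> f * \<Psi> x + \<Psi> x * \<Psi> g = 0}"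
  shows "dim K (sylvester f g ` carrier R) = 4 - r"
proof -
  have cl: "sylvester f g x \<in> carrier R" if "x \<in> carrier R" for x
    using assms that by (simp add: sylvester_def)
  have lin: "sylvester f g (k \<otimes> x \<oplus> y) = k \<otimes> sylvester f g x \<oplus> sylvester f g y"
    if k: "k \<in> K" and x: "x \<in> carrier R" and y: "y \<in> carrier R" for k x y
  proof -
    obtain c where c: "\<Psi> k = qscal c" using K_D(2)[OF k] by blast
    have "\<Psi> (sylvester f g (k \<otimes> x \<oplus> y))
        = \<Psi> f * (qscal c * \<Psi> x + \<Psi> y) + (qscal c * \<Psi> x + \<Psi> y) * \<Psi> g"
      using x y K_D(1)[OF k] assms(1,2) by (simp add: Psi_sylvester Psi_add Psi_mult c)
    also have "\<dots> = qscal c * (\<Psi> f * \<Psi> x + \<Psi> x * \<Psi> g) + (\<Psi> f * \<Psi> y + \<Psi> y * \<Psi> g)"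
      by (simp only: distrib_left distrib_right qscal_left_commute[of "\<Psi> f"] mult.assoc add_ac)
    also have "\<dots> = \<Psi> (k \<otimes> sylvester f g x \<oplus> sylvester f g y)"
      using x y K_D(1)[OF k] assms(1,2) cl by (simp add: Psi_sylvester Psi_add Psi_mult c)
    finally show ?thesis
      using x y K_D(1)[OF k] cl by (simp add: Psi_eq_iff)
  qed
  have "\<exists>r s. dimension r K {x \<in> carrier R. sylvester f g x = \<zero>} \<and>
      dimension s K (sylvester f g ` carrier R) \<and> r + s = 4"
    by (rule linear_map_rank_nullity[of K "sylvester f g" 4 "carrier R"])
      (fact subfield_K cl lin dimension_carrier)+
  then obtain r' s where rs: "dimension r' K {x \<in> carrier R. sylvester f g x = \<zero>}"
      "dimension s K (sylvester f g ` carrier R)" "r' + s = 4"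
    by (elim exE conjE)
  have "sylvester f g x = \<zero> \<longleftrightarrow> \<Psi> f * \<Psi> x + \<Psi> x * \<Psi> g = 0" if x: "x \<in> carrier R" for x
    unfolding Psi_eq_iff[OF cl[OF x] zero_closed] Psi_sylvester[OF assms(1,2) x] Psi_zero ..
  then have "{x \<in> carrier R. sylvester f g x = \<zero>} = {x \<in> carrier R. \<Psi> f * \<Psi> x + \<Psi> x * \<Psi> g = 0}"
    by blast
  then have "r' = r" using dimension_is_inj[OF subfield_K rs(1)] assms(3) by simp
  then show ?thesis using dimI[OF subfield_K rs(2)] rs(3) by (simp add: over_def)
qed

lemma dimension_line:
  assumes "x \<in> carrier R" "\<Psi> x \<noteq> 0"
  shows "dimension 1 K {y \<in> carrier R. \<exists>c\<in>F. \<Psi> y = qscal c * \<Psi> x}"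
proof -
  have "dimension (Suc 0) K (line_extension K x {\<zero>})"
    using assms by (intro Suc_dim) (auto simp: Psi_zero)
  moreover have "line_extension K x {\<zero>} = {y \<in> carrier R. \<exists>c\<in>F. \<Psi> y = qscal c * \<Psi> x}"
    using assms by (auto simp: line_extension_iff Psi_zero)
  ultimately show ?thesis by simp
qed

lemma dimension_plane:
  assumes "x \<in> carrier R" "y \<in> carrier R" "\<Psi> x \<noteq> 0" "\<And>c. \<Psi> y \<noteq> qscal c * \<Psi> x"
  shows "dimension 2 K {z \<in> carrier R. \<exists>\<alpha>\<in>F. \<exists>\<beta>\<in>F. \<Psi> z = qscal \<alpha> * \<Psi> x + qscal \<beta> * \<Psi> y}"
proof -
  let ?L = "{y \<in> carrier R. \<exists>c\<in>F. \<Psi> y = qscal c * \<Psi> x}"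
  have "dimension (Suc 1) K (line_extension K y ?L)"
    using assms by (intro Suc_dim dimension_line) auto
  moreover have "line_extension K y ?L =
      {z \<in> carrier R. \<exists>\<alpha>\<in>F. \<exists>\<beta>\<in>F. \<Psi> z = qscal \<alpha> * \<Psi> x + qscal \<beta> * \<Psi> y}" (is "_ = ?P")
  proof (intro Set.set_eqI iffI)
    fix z assume "z \<in> line_extension K y ?L"
    then obtain c y' where "z \<in> carrier R" "c \<in> F" "y' \<in> ?L" "\<Psi> z = qscal c * \<Psi> y + \<Psi> y'"
      using line_extension_iff[OF assms(2), of ?L z] by blast
    moreover from this obtain c' where "c' \<in> F" "\<Psi> y' = qscal c' * \<Psi> x" by blast
    ultimately have "z \<in> carrier R \<and> \<Psi> z = qscal c' * \<Psi> x + qscal c * \<Psi> y" "c \<in> F" "c' \<in> F"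
      by (simp_all add: add.commute)
    then show "z \<in> ?P" by blast
  next
    fix z assume "z \<in> ?P"
    then obtain \<alpha> \<beta> where z: "z \<in> carrier R" "\<alpha> \<in> F" "\<beta> \<in> F" "\<Psi> z = qscal \<alpha> * \<Psi> x + qscal \<beta> * \<Psi> y" by blast
    obtain y' where "y' \<in> carrier R" "\<Psi> y' = qscal \<alpha> * \<Psi> x"
      using Psi_surj[OF QF_intros(6)[OF QF_intros(9)[OF z(2)] Psi_QF[OF assms(1)]]] by blast
    then have "y' \<in> ?L" "\<Psi> z = qscal \<beta> * \<Psi> y + \<Psi> y'" using z by (auto simp: add.commute)
    then show "z \<in> line_extension K y ?L"
      using line_extension_iff[OF assms(2), of ?L z] z by blast
  qed
  ultimately show ?thesis by (simp add: numeral_2_eq_2)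
qed

end

text \<open>The ranks are read off the kernels: zero, a line, or the plane \<open>h (F + F w)\<close>.\<close>

locale sylvester_model = quat_model F R \<Psi>
  for F :: "'k :: field_char_0 set" and R (structure) and \<Psi> :: "'r \<Rightarrow> 'k qalg" +
  fixes f g :: 'r
  assumes f_cl: "f \<in> carrier R" and g_cl: "g \<in> carrier R"
    and f_nK: "f \<notin> K" and g_nK: "g \<notin> K"
begin

definition "tr = co0 (\<Psi> f) + co0 (\<Psi> g)"
definition "vf = qvec (\<Psi> f)"
definition "vg = qvec (\<Psi> g)"
definition "ker = {x \<in> carrier R. \<Psi> f * \<Psi> x + \<Psi> x * \<Psi> g = 0}"

sublocale S: rational_sylvester_pair "\<Psi> f" "\<Psi> g" tr "qnrm vf" "qnrm vg" vf vg F
proof unfold_locales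
  show "qvec (\<Psi> f) \<noteq> 0" "qvec (\<Psi> g) \<noteq> 0"
    using f_nK g_nK f_cl g_cl by (auto simp: K_def)
  show "\<Psi> f \<in> QF" "\<Psi> g \<in> QF" using f_cl g_cl Psi_QF by auto
qed (simp_all add: tr_def vf_def vg_def)

abbreviation "disc \<equiv> sylv_disc tr (qnrm vf) (qnrm vg)"
abbreviation "rk \<equiv> dim K (sylvester f g ` carrier R)"

lemma zero_in_ker: "\<zero> \<in> ker"
  by (simp add: ker_def Psi_zero)

lemma ker_nonzero: "x \<in> ker \<Longrightarrow> x \<noteq> \<zero> \<Longrightarrow> \<Psi> x \<noteq> 0"
  using Psi_eq_iff[of x \<zero>] by (simp add: ker_def Psi_zero)

lemma ker_D: "x \<in> ker \<Longrightarrow> x \<in> carrier R" "x \<in> ker \<Longrightarrow> \<Psi> f * \<Psi> x + \<Psi> x * \<Psi> g = 0"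
  by (simp_all add: ker_def)

lemma ker_eq_zero:
  assumes "disc \<noteq> 0"
  shows "ker = {\<zero>}"
  using S.ker_trivial[OF ker_D(2) assms] ker_nonzero zero_in_ker by blast

lemma rank_4: "disc \<noteq> 0 \<Longrightarrow> rk = 4"
proof -
  assume "disc \<noteq> 0"
  then have "ker = {\<zero>}" by (rule ker_eq_zero)
  then have "dimension 0 K ker" by simp
  from rank_from_nullity[OF f_cl g_cl this[unfolded ker_def]] show "rk = 4" by simp
qed

lemma rank_3:
  assumes "disc = 0" "tr \<noteq> 0"
  shows "rk = 3" "ker \<noteq> {\<zero>}"
proof -
  obtain q where q: "q \<in> QF" "q \<noteq> 0" "\<Psi> f * q + q * \<Psi> g = 0"
    using S.rational_ker_witness[OF assms] by blast
  obtain x where x: "x \<in> carrier R" "\<Psi> x = q" using Psi_surj q(1) by blast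
  have "\<Psi> x \<noteq> 0" using q x by simp
  have "ker = {y \<in> carrier R. \<exists>c\<in>F. \<Psi> y = qscal c * \<Psi> x}" (is "_ = ?L")
  proof (intro Set.set_eqI iffI)
    fix y assume y: "y \<in> ker"
    then obtain c where c: "\<Psi> y = qscal c * q"
      using S.ker_line[OF assms q(3) ker_D(2)[OF y] q(2)] by blast
    moreover have "c \<in> F"
      using S.ker_line_coeff[OF q(1) Psi_QF[OF ker_D(1)[OF y]] c q(2)] .
    ultimately show "y \<in> ?L" using ker_D(1)[OF y] x(2) by blast
  next
    fix y assume "y \<in> ?L"
    then obtain c where c: "y \<in> carrier R" "\<Psi> y = qscal c * q" using x by auto
    have "\<Psi> f * \<Psi> y + \<Psi> y * \<Psi> g = qscal c * (\<Psi> f * q + q * \<Psi> g)"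
      unfolding c(2) by (simp add: qscal_left_commute[of "\<Psi> f"] distrib_left mult.assoc)
    then show "y \<in> ker" using c(1) q(3) by (simp add: ker_def)
  qed
  then have "dimension 1 K ker" using dimension_line[OF x(1) \<open>\<Psi> x \<noteq> 0\<close>] by simp
  from rank_from_nullity[OF f_cl g_cl this[unfolded ker_def]] show "rk = 3" by simp
  have "x \<in> ker" using x q by (simp add: ker_def)
  then show "ker \<noteq> {\<zero>}" using \<open>\<Psi> x \<noteq> 0\<close> Psi_zero by auto
qed

lemma rank_2:
  assumes "tr = 0" "qnrm vf = qnrm vg"
  shows "rk = 2" "\<exists>x\<in>ker. qnrm (\<Psi> x) \<noteq> 0"
proof -
  obtain q where q: "q \<in> QF" "qnrm q \<noteq> 0" "\<Psi> f * q + q * \<Psi> g = 0"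
    using S.rational_ker_invertible[OF assms] by blast
  obtain x where x: "x \<in> carrier R" "\<Psi> x = q" using Psi_surj q(1) by blast
  then show "\<exists>x\<in>ker. qnrm (\<Psi> x) \<noteq> 0" using q by (auto simp: ker_def)
  obtain y where y: "y \<in> carrier R" "\<Psi> y = q * vg"
    using Psi_surj[OF QF_intros(6)[OF q(1) S.vw_QF(2)]] by blast
  have nz: "\<Psi> x \<noteq> 0" using q x by auto
  have ind: "\<Psi> y \<noteq> qscal c * \<Psi> x" for c
  proof
    assume "\<Psi> y = qscal c * \<Psi> x"
    then have "q * vg = qscal c * q" using x y by simp
    then have "q * (vg + qscal (- c)) = 0"
      unfolding distrib_left qscal_commute[of q] by (simp add: distrib_right[symmetric])
    then have "qconj q * (q * (vg + qscal (- c))) = 0" by simp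
    then have "qscal (qnrm q) * (vg + qscal (- c)) = 0"
      by (simp only: mult.assoc[symmetric] mult_qconj)
    then have "vg + qscal (- c) = 0" using q(2) by (rule qscal_cancel)
    with S.plus_qscal_nz[OF S.w_nz S.co0_vw(2)] show False by blast
  qed
  have "ker = {z \<in> carrier R. \<exists>\<alpha>\<in>F. \<exists>\<beta>\<in>F. \<Psi> z = qscal \<alpha> * \<Psi> x + qscal \<beta> * \<Psi> y}"
    unfolding ker_def x(2) y(2)
    by (intro Collect_cong conj_cong refl S.ker_plane_iff[OF assms(1) q(1,3,2) Psi_QF])
  then have "dimension 2 K ker" using dimension_plane[OF x(1) y(1) nz ind] by simp
  from rank_from_nullity[OF f_cl g_cl this[unfolded ker_def]] show "rk = 2" by simp
qed

lemma disc_trace_zero: "tr = 0 \<Longrightarrow> disc = 0 \<longleftrightarrow> qnrm vf = qnrm vg"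
  by (simp add: sylv_disc_def)

lemma rank_cases:
  "disc \<noteq> 0 \<and> rk = 4 \<or> disc = 0 \<and> tr \<noteq> 0 \<and> rk = 3 \<or> disc = 0 \<and> tr = 0 \<and> qnrm vf = qnrm vg \<and> rk = 2"
  using rank_4 rank_3(1) rank_2(1) disc_trace_zero by blast

lemma rank_3_iff_ker:
  "rk = 3 \<longleftrightarrow> ker \<noteq> {\<zero>} \<and> (\<forall>x\<in>ker - {\<zero>}. qnrm (\<Psi> x) = 0)"
proof
  assume "rk = 3"
  then have d: "disc = 0" "tr \<noteq> 0" using rank_cases by auto
  then show "ker \<noteq> {\<zero>} \<and> (\<forall>x\<in>ker - {\<zero>}. qnrm (\<Psi> x) = 0)"
    using rank_3(2) S.ker_isotropic[OF ker_D(2)] by blast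
next
  assume k: "ker \<noteq> {\<zero>} \<and> (\<forall>x\<in>ker - {\<zero>}. qnrm (\<Psi> x) = 0)"
  then have "disc = 0" using ker_eq_zero by blast
  moreover have "tr \<noteq> 0"
  proof
    assume "tr = 0"
    then obtain x where "x \<in> ker" "qnrm (\<Psi> x) \<noteq> 0"
      using rank_2(2) \<open>disc = 0\<close> disc_trace_zero by blast
    with k have "x = \<zero>" by blast
    with \<open>qnrm (\<Psi> x) \<noteq> 0\<close> show False by (simp add: Psi_zero)
  qed
  ultimately show "rk = 3" using rank_3(1) by blast
qed

text \<open>
  In rank two \<open>ker_invertible\<close> provides a unit; in rank four the kernel is zero, and in rank three it is isotropic.
\<close>

lemma rank_2_iff_unit: "rk = 2 \<longleftrightarrow> (\<exists>x\<in>ker. x \<in> Units R)"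
proof
  assume "rk = 2"
  then have "tr = 0" "qnrm vf = qnrm vg" using rank_cases by auto
  then show "\<exists>x\<in>ker. x \<in> Units R" using rank_2(2) Units_iff ker_D(1) by blast
next
  assume "\<exists>x\<in>ker. x \<in> Units R"
  then obtain x where x: "x \<in> ker" "qnrm (\<Psi> x) \<noteq> 0" using Units_iff by blast
  then have "tr = 0" using S.ker_isotropic[OF ker_D(2)] by blast
  moreover have "disc = 0"
  proof (rule ccontr)
    assume "disc \<noteq> 0"
    from ker_eq_zero[OF this] x show False by (simp add: Psi_zero)
  qed
  ultimately show "rk = 2" using rank_2(1) disc_trace_zero by blast
qed

text \<open>
  For a unit \<open>x\<close>, the equation \<open>f x + x g = 0\<close> is \<open>f = x (- g) x\<^sup>-\<^sup>1\<close>, so the conjugating element is \<open>x\<^sup>-\<^sup>1\<close>.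
\<close>

lemma unit_in_ker_iff_similar:
  "(\<exists>x\<in>ker. x \<in> Units R) \<longleftrightarrow> (\<exists>h\<in>Units R. f = inv h \<otimes> (\<ominus> g) \<otimes> h)"
proof
  assume "\<exists>x\<in>ker. x \<in> Units R"
  then obtain x where x: "x \<in> ker" "x \<in> Units R" by blast
  have xc: "x \<in> carrier R" "inv x \<in> carrier R" using x(2) by auto
  have 0: "f \<otimes> x \<oplus> x \<otimes> g = \<zero>"
    using x(1) xc f_cl g_cl by (simp add: ker_def Psi_eq_iff Psi_simps)
  have "f \<otimes> x = \<ominus> (x \<otimes> g)"
    using minus_equality[OF 0] f_cl g_cl xc by simp
  then have "f \<otimes> x \<otimes> inv x = x \<otimes> (\<ominus> g) \<otimes> inv x" using g_cl xc by (simp add: r_minus)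
  then have "f = inv (inv x) \<otimes> (\<ominus> g) \<otimes> inv x"
    using x(2) xc f_cl by (simp add: m_assoc)
  then show "\<exists>h\<in>Units R. f = inv h \<otimes> (\<ominus> g) \<otimes> h" using x(2) by blast
next
  assume "\<exists>h\<in>Units R. f = inv h \<otimes> (\<ominus> g) \<otimes> h"
  then obtain h where h: "h \<in> Units R" "f = inv h \<otimes> (\<ominus> g) \<otimes> h" by blast
  have hc: "h \<in> carrier R" "inv h \<in> carrier R" using h(1) by auto
  have "f \<otimes> inv h = inv h \<otimes> (\<ominus> g)"
    unfolding h(2) using hc g_cl h(1) by (simp add: m_assoc)
  then have "f \<otimes> inv h \<oplus> inv h \<otimes> g = \<zero>" using hc g_cl by (simp add: r_minus l_neg)
  then have "inv h \<in> ker"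
    using hc f_cl g_cl by (simp add: ker_def flip: Psi_simps)
  then show "\<exists>x\<in>ker. x \<in> Units R" using h(1) by blast
qed

lemma rank_3_isotropic:
  assumes "rk = 3"
  shows "\<exists>q\<in>QF. q \<noteq> 0 \<and> qnrm q = 0"
proof -
  obtain x where x: "x \<in> ker" "x \<noteq> \<zero>" "qnrm (\<Psi> x) = 0"
    using assms rank_3_iff_ker zero_in_ker by blast
  then show ?thesis using ker_nonzero Psi_QF[OF ker_D(1)] by blast
qed

text \<open>
  By \<open>ker_zero_divisor_iff\<close> the left side says that the common norm of the vector parts \<open>v\<close>, \<open>w\<close> is a square. The
  cases \<open>v = w\<close> and \<open>v - w\<close> invertible repeat this condition. If \<open>v - w\<close> is nonzero and isotropic, the condition holds
  automatically, because \<open>v - w\<close> itself is a zero divisor in the kernel.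
\<close>

lemma ker_zero_divisor_cases:
  assumes "rk = 2" "\<iota> \<in> F" "\<iota> * \<iota> = - 1"
  shows "(\<exists>x\<in>ker. x \<noteq> \<zero> \<and> qnrm (\<Psi> x) = 0) \<longleftrightarrow>
    vf = vg \<and> (\<exists>r\<in>F. qnrm vf = r * r) \<or>
    vf \<noteq> vg \<and> qnrm (vf - vg) = 0 \<or>
    qnrm (vf - vg) \<noteq> 0 \<and> (\<exists>r\<in>F. qnrm vf = r * r)"
proof -
  have t: "tr = 0" "qnrm vf = qnrm vg" using assms(1) rank_cases by auto
  have "(\<exists>x\<in>ker. x \<noteq> \<zero> \<and> qnrm (\<Psi> x) = 0) \<longleftrightarrow>
      (\<exists>q\<in>QF. q \<noteq> 0 \<and> qnrm q = 0 \<and> \<Psi> f * q + q * \<Psi> g = 0)" (is "?Z \<longleftrightarrow> ?Q")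
  proof
    assume ?Z
    then show ?Q using Psi_QF[OF ker_D(1)] ker_nonzero ker_D(2) by blast
  next
    assume ?Q
    then obtain q where q: "q \<in> QF" "q \<noteq> 0" "qnrm q = 0" "\<Psi> f * q + q * \<Psi> g = 0" by blast
    obtain x where "x \<in> carrier R" "\<Psi> x = q" using Psi_surj q(1) by blast
    with q show ?Z by (intro bexI[of _ x]) (auto simp: ker_def Psi_zero)
  qed
  moreover have "?Q \<longleftrightarrow> (\<exists>r\<in>F. qnrm vf = r * r)"
    by (rule S.ker_zero_divisor_iff[OF t assms(2,3)])
  moreover have ?Q if "vf \<noteq> vg" "qnrm (vf - vg) = 0"
  proof -
    have "vf * (vf - vg) + (vf - vg) * vg = vf * vf - vg * vg"
      by (simp add: left_diff_distrib right_diff_distrib)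
    then have "\<Psi> f * (vf - vg) + (vf - vg) * \<Psi> g = 0"
      unfolding S.ker_iff t(1) S.v_sq S.w_sq t(2) by simp
    moreover have "vf - vg \<in> QF" by (intro QF_intros S.vw_QF)
    ultimately show ?thesis using that by (intro bexI[of _ "vf - vg"]) auto
  qed
  ultimately show ?thesis by auto
qed

end


section \<open>Slices of the quaternions\<close>

lemma quat_sel [simp]:
  "qre 0 = 0" "qi 0 = 0" "qj 0 = 0" "qk 0 = 0"
  "qre 1 = 1" "qi 1 = 0" "qj 1 = 0" "qk 1 = 0"
  "qre (p + q) = qre p + qre q" "qi (p + q) = qi p + qi q" "qj (p + q) = qj p + qj q" "qk (p + q) = qk p + qk q"
  "qre (p - q) = qre p - qre q" "qi (p - q) = qi p - qi q" "qj (p - q) = qj p - qj q" "qk (p - q) = qk p - qk q"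
  "qre (- p) = - qre p" "qi (- p) = - qi p" "qj (- p) = - qj p" "qk (- p) = - qk p"
  "qre (r *\<^sub>R p) = r * qre p" "qi (r *\<^sub>R p) = r * qi p" "qj (r *\<^sub>R p) = r * qj p" "qk (r *\<^sub>R p) = r * qk p"
  by (simp_all add: zero_quat_def one_quat_def plus_quat_def minus_quat_def uminus_quat_def scaleR_quat_def)

lemma quat_of_real_sel [simp]:
  "qre (of_real r) = r" "qi (of_real r) = 0" "qj (of_real r) = 0" "qk (of_real r) = 0"
  by (simp_all add: of_real_def)

lemma quat_mult_sel:
  "qre (p * q) = qre p * qre q - qi p * qi q - qj p * qj q - qk p * qk q"
  "qi (p * q) = qre p * qi q + qi p * qre q + qj p * qk q - qk p * qj q"
  "qj (p * q) = qre p * qj q - qi p * qk q + qj p * qre q + qk p * qi q"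
  "qk (p * q) = qre p * qk q + qi p * qj q - qj p * qi q + qk p * qre q"
  by (simp_all add: times_quat_def)

lemma bounded_linear_quat_sel:
  "bounded_linear qre" "bounded_linear qi" "bounded_linear qj" "bounded_linear qk"
proof -
  have "qre = (\<lambda>p. inner p 1)" "qi = (\<lambda>p. inner p (Quat 0 1 0 0))"
    "qj = (\<lambda>p. inner p (Quat 0 0 1 0))" "qk = (\<lambda>p. inner p (Quat 0 0 0 1))"
    by (auto simp: inner_quat_def fun_eq_iff)
  then show "bounded_linear qre" "bounded_linear qi" "bounded_linear qj" "bounded_linear qk"
    using bounded_linear_inner_left[where 'a = quat] by metis+
qed

definition qI :: quat where "qI = Quat 0 1 0 0"

lemma imag_units_iff: "I \<in> imag_units \<longleftrightarrow> qre I = 0 \<and> (qi I)\<^sup>2 + (qj I)\<^sup>2 + (qk I)\<^sup>2 = 1"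
proof
  assume "I \<in> imag_units"
  then have e: "qre (I * I) = -1" "qi (I * I) = 0" "qj (I * I) = 0" "qk (I * I) = 0"
    by (simp_all add: imag_units_def power2_eq_square)
  have e2: "qi I = 0 \<or> qre I = 0" "qj I = 0 \<or> qre I = 0" "qk I = 0 \<or> qre I = 0"
    using e(2-4) by (simp_all add: quat_mult_sel)
  have "qre I = 0"
  proof (rule ccontr)
    assume nz: "qre I \<noteq> 0"
    with e2 e(1) have "qre I * qre I = -1" by (simp add: quat_mult_sel)
    moreover have "qre I * qre I \<ge> 0" by simp
    ultimately show False by linarith
  qed
  with e(1) show "qre I = 0 \<and> (qi I)\<^sup>2 + (qj I)\<^sup>2 + (qk I)\<^sup>2 = 1"
    by (simp add: quat_mult_sel power2_eq_square)
next
  assume "qre I = 0 \<and> (qi I)\<^sup>2 + (qj I)\<^sup>2 + (qk I)\<^sup>2 = 1"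
  then show "I \<in> imag_units"
    by (simp add: imag_units_def power2_eq_square quat_eq_iff quat_mult_sel algebra_simps)
qed

lemma imag_unit_square: "I \<in> imag_units \<Longrightarrow> I * (I * p) = - p"
  unfolding imag_units_def by (simp add: mult.assoc[symmetric] power2_eq_square)

lemma qI_unit: "qI \<in> imag_units" and minus_unit: "I \<in> imag_units \<Longrightarrow> - I \<in> imag_units"
  by (simp_all add: imag_units_iff qI_def)

lemma slice_point_sel:
  "I \<in> imag_units \<Longrightarrow> qre (slice_point I x y) = x"
  "qi (slice_point I x y) = qi I * y" "qj (slice_point I x y) = qj I * y" "qk (slice_point I x y) = qk I * y"
  by (simp_all add: slice_point_def quat_mult_sel imag_units_iff)

text \<open>
  The sphere of all \<open>x + J y\<close>, \<open>J\<^sup>2 = - 1\<close>, is represented by the point \<open>x + \<i> y\<close> with \<open>y \<ge> 0\<close>, so a circular set is a union of fibres of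
  \<open>qcoord\<close>.
\<close>

definition qcoord :: "quat \<Rightarrow> complex" where
  "qcoord q = Complex (qre q) (sqrt ((qi q)\<^sup>2 + (qj q)\<^sup>2 + (qk q)\<^sup>2))"

text \<open>
  A real number lies on every slice. The unit \<open>i\<close> is chosen for it; by symmetry a stem is real at real points, so its value
  does not depend on the unit.
\<close>

definition qdir :: "quat \<Rightarrow> quat" where
  "qdir q = (if Im (qcoord q) = 0 then qI
     else Quat 0 (qi q / Im (qcoord q)) (qj q / Im (qcoord q)) (qk q / Im (qcoord q)))"

lemma Im_qcoord_nonneg: "Im (qcoord q) \<ge> 0"
  by (simp add: qcoord_def)

lemma Im_qcoord_square: "(Im (qcoord q))\<^sup>2 = (qi q)\<^sup>2 + (qj q)\<^sup>2 + (qk q)\<^sup>2"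
  by (simp add: qcoord_def)

lemma qdir_unit: "qdir q \<in> imag_units"
proof (cases "Im (qcoord q) = 0")
  case False
  have "(qi q)\<^sup>2 / (Im (qcoord q))\<^sup>2 + (qj q)\<^sup>2 / (Im (qcoord q))\<^sup>2 + (qk q)\<^sup>2 / (Im (qcoord q))\<^sup>2
      = ((qi q)\<^sup>2 + (qj q)\<^sup>2 + (qk q)\<^sup>2) / (Im (qcoord q))\<^sup>2"
    by (simp add: add_divide_distrib)
  also have "\<dots> = 1" unfolding Im_qcoord_square[symmetric] using False by simp
  finally show ?thesis using False by (simp add: qdir_def imag_units_iff power_divide)
qed (simp add: qdir_def qI_unit)

lemma slice_point_qdir: "slice_point (qdir q) (Re (qcoord q)) (Im (qcoord q)) = q"
proof (cases "Im (qcoord q) = 0")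
  case True
  then have "(qi q)\<^sup>2 + (qj q)\<^sup>2 + (qk q)\<^sup>2 = 0" using Im_qcoord_square[of q] by simp
  then have "qi q = 0 \<and> qj q = 0 \<and> qk q = 0"
    by (smt (verit) zero_le_power2 power2_eq_iff_nonneg zero_eq_power2)
  with True show ?thesis
    by (simp add: quat_eq_iff slice_point_sel qdir_unit) (simp add: qcoord_def)
next
  case False
  then show ?thesis
    by (simp add: quat_eq_iff slice_point_sel qdir_unit) (simp add: qdir_def, simp add: qcoord_def)
qed

lemma qcoord_slice_point:
  assumes "I \<in> imag_units"
  shows "qcoord (slice_point I x y) = Complex x \<bar>y\<bar>"
proof -
  have "(qi I * y)\<^sup>2 + (qj I * y)\<^sup>2 + (qk I * y)\<^sup>2 = ((qi I)\<^sup>2 + (qj I)\<^sup>2 + (qk I)\<^sup>2) * y\<^sup>2"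
    by (simp add: power_mult_distrib algebra_simps)
  also have "\<dots> = y\<^sup>2" using assms by (simp add: imag_units_iff)
  finally show ?thesis by (simp add: qcoord_def slice_point_sel assms)
qed

lemma slice_point_cases:
  assumes "I \<in> imag_units"
  shows "Complex x y = qcoord (slice_point I x y) \<and> (y = 0 \<or> I = qdir (slice_point I x y)) \<or>
    cnj (Complex x y) = qcoord (slice_point I x y) \<and> - I = qdir (slice_point I x y)"
proof -
  let ?q = "slice_point I x y"
  note c = qcoord_slice_point[OF assms, of x y]
  show ?thesis
  proof (cases "y \<ge> 0")
    case True
    then have "y = 0 \<or> I = qdir ?q"
      unfolding qdir_def c using assms by (auto simp: quat_eq_iff slice_point_sel imag_units_iff)
    with True c show ?thesis by simp
  next
    case False
    then have "- I = qdir ?q"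
      unfolding qdir_def c using assms by (auto simp: quat_eq_iff slice_point_sel imag_units_iff)
    moreover have "cnj (Complex x y) = qcoord ?q" using False c by (simp add: complex_eq_iff)
    ultimately show ?thesis by simp
  qed
qed

lemma sphere_of_iff: "q \<in> sphere_of p \<longleftrightarrow> qcoord q = qcoord p"
proof
  assume "q \<in> sphere_of p"
  then show "qcoord q = qcoord p" by (auto simp: sphere_of_def qcoord_slice_point)
next
  assume "qcoord q = qcoord p"
  then have "q = slice_point (qdir q) (Re (qcoord p)) (Im (qcoord p))"
    using slice_point_qdir[of q] by simp
  then show "q \<in> sphere_of p"
    unfolding sphere_of_def using qdir_unit slice_point_qdir[of p] by (metis (mono_tags, lifting) mem_Collect_eq)
qed

text \<open>
  For circular \<open>\<Omega>\<close> the slices of all imaginary units give the same set, which is invariant under conjugation.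
\<close>

definition plane :: "quat set \<Rightarrow> complex set" where
  "plane \<Omega> = {z. slice_point qI (Re z) (Im z) \<in> \<Omega>}"

lemma circularD: "circular \<Omega> \<Longrightarrow> p \<in> \<Omega> \<Longrightarrow> qcoord q = qcoord p \<Longrightarrow> q \<in> \<Omega>"
  by (auto simp: circular_def simp flip: sphere_of_iff)

lemma circularI: "(\<And>p q. p \<in> \<Omega> \<Longrightarrow> qcoord q = qcoord p \<Longrightarrow> q \<in> \<Omega>) \<Longrightarrow> circular \<Omega>"
  by (auto simp: circular_def sphere_of_iff)

lemma slice_point_in_iff:
  assumes "circular \<Omega>" "I \<in> imag_units"
  shows "slice_point I x y \<in> \<Omega> \<longleftrightarrow> Complex x y \<in> plane \<Omega>"
proof -
  have "qcoord (slice_point I x y) = qcoord (slice_point qI x y)"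
    by (simp add: qcoord_slice_point assms qI_unit)
  then show ?thesis unfolding plane_def by (auto intro: circularD[OF assms(1)])
qed

lemma qcoord_in_iff: "circular \<Omega> \<Longrightarrow> qcoord q \<in> plane \<Omega> \<longleftrightarrow> q \<in> \<Omega>"
  using slice_point_in_iff[OF _ qdir_unit, of \<Omega> q "Re (qcoord q)" "Im (qcoord q)"]
  by (simp add: slice_point_qdir)

lemma cnj_in_plane_iff: "circular \<Omega> \<Longrightarrow> cnj z \<in> plane \<Omega> \<longleftrightarrow> z \<in> plane \<Omega>"
proof -
  assume c: "circular \<Omega>"
  have "qcoord (slice_point qI (Re z) (- Im z)) = qcoord (slice_point qI (Re z) (Im z))"
    by (simp add: qcoord_slice_point qI_unit)
  then show ?thesis unfolding plane_def by (auto intro: circularD[OF c])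
qed

lemma plane_Int: "plane (A \<inter> B) = plane A \<inter> plane B"
  by (auto simp: plane_def)

lemma open_plane: "open \<Omega> \<Longrightarrow> open (plane \<Omega>)"
proof -
  assume "open \<Omega>"
  moreover have "continuous_on UNIV (\<lambda>z. slice_point qI (Re z) (Im z))"
    unfolding slice_point_def by (intro continuous_intros)
  ultimately have "open ((\<lambda>z. slice_point qI (Re z) (Im z)) -` \<Omega>)"
    by (rule open_vimage)
  then show ?thesis by (simp add: plane_def vimage_def)
qed

lemma continuous_on_qcoord: "continuous_on UNIV qcoord"
proof -
  have "continuous_on UNIV (\<lambda>q. of_real (qre q) + \<i> * of_real (sqrt ((qi q)\<^sup>2 + (qj q)\<^sup>2 + (qk q)\<^sup>2)))"
    by (intro continuous_intros bounded_linear.continuous_on[OF bounded_linear_quat_sel(1)]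
      bounded_linear.continuous_on[OF bounded_linear_quat_sel(2)]
      bounded_linear.continuous_on[OF bounded_linear_quat_sel(3)]
      bounded_linear.continuous_on[OF bounded_linear_quat_sel(4)])
  then show ?thesis by (simp add: qcoord_def[abs_def] Complex_eq)
qed

text \<open>The circular set with a given conjugation-invariant planar section.\<close>

definition unplane :: "complex set \<Rightarrow> quat set" where
  "unplane W = qcoord -` W"

lemma open_unplane: "open W \<Longrightarrow> open (unplane W)"
  unfolding unplane_def using continuous_on_qcoord by (intro open_vimage)

lemma circular_unplane: "circular (unplane W)"
  by (auto intro!: circularI simp: unplane_def)

lemma plane_unplane:
  assumes "\<And>z. z \<in> W \<Longrightarrow> cnj z \<in> W"
  shows "plane (unplane W) = W"
proof -
  have "z \<in> plane (unplane W) \<longleftrightarrow> Complex (Re z) \<bar>Im z\<bar> \<in> W" for z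
    by (simp add: plane_def unplane_def qcoord_slice_point qI_unit)
  moreover have "Complex (Re z) \<bar>Im z\<bar> \<in> W \<longleftrightarrow> z \<in> W" for z
  proof (cases "Im z \<ge> 0")
    case False
    then have "Complex (Re z) \<bar>Im z\<bar> = cnj z" by (simp add: complex_eq_iff)
    then show ?thesis using assms[of z] assms[of "cnj z"] by auto
  qed simp
  ultimately show ?thesis by blast
qed

section \<open>Stem functions\<close>

text \<open>
  A stem takes values in the complexified quaternions, with \<open>F\<^sub>1 + \<i> F\<^sub>2\<close> written as a quaternion with complex coordinates; then the
  Cauchy-Riemann equation of \<open>F\<^sub>1\<close> and \<open>F\<^sub>2\<close> is holomorphy of the four coordinates.
\<close>

definition re_part :: "complex qalg \<Rightarrow> quat" where
  "re_part p = Quat (Re (co0 p)) (Re (co1 p)) (Re (co2 p)) (Re (co3 p))"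

definition im_part :: "complex qalg \<Rightarrow> quat" where
  "im_part p = Quat (Im (co0 p)) (Im (co1 p)) (Im (co2 p)) (Im (co3 p))"

definition of_parts :: "quat \<Rightarrow> quat \<Rightarrow> complex qalg" where
  "of_parts a b = QA (Complex (qre a) (qre b)) (Complex (qi a) (qi b)) (Complex (qj a) (qj b)) (Complex (qk a) (qk b))"

definition conj_coords :: "complex qalg \<Rightarrow> complex qalg" where
  "conj_coords p = QA (cnj (co0 p)) (cnj (co1 p)) (cnj (co2 p)) (cnj (co3 p))"

definition slice_val :: "quat \<Rightarrow> complex qalg \<Rightarrow> quat" where
  "slice_val I p = re_part p + I * im_part p"

text \<open>
  Evenness of \<open>F\<^sub>1\<close> and oddness of \<open>F\<^sub>2\<close>. It is required at all points of the plane, including singularities, where the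
  values are arbitrary up to symmetry.
\<close>

definition stem_symmetric :: "(complex \<Rightarrow> complex qalg) \<Rightarrow> bool" where
  "stem_symmetric \<phi> \<longleftrightarrow> (\<forall>z. \<phi> (cnj z) = conj_coords (\<phi> z))"

definition unstem :: "(complex \<Rightarrow> complex qalg) \<Rightarrow> quat \<Rightarrow> quat" where
  "unstem \<phi> q = slice_val (qdir q) (\<phi> (qcoord q))"

lemma re_part_of_parts [simp]: "re_part (of_parts a b) = a" and im_part_of_parts [simp]: "im_part (of_parts a b) = b"
  by (simp_all add: re_part_def im_part_def of_parts_def quat_eq_iff)

lemma of_parts_re_im [simp]: "of_parts (re_part p) (im_part p) = p"
  by (simp add: re_part_def im_part_def of_parts_def qalg_eq_iff)

lemma re_part_sel [simp]: "qre (re_part p) = Re (co0 p)" "qi (re_part p) = Re (co1 p)" "qj (re_part p) = Re (co2 p)" "qk (re_part p) = Re (co3 p)"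
  and im_part_sel [simp]: "qre (im_part p) = Im (co0 p)" "qi (im_part p) = Im (co1 p)" "qj (im_part p) = Im (co2 p)" "qk (im_part p) = Im (co3 p)"
  by (simp_all add: re_part_def im_part_def)

lemma co_conj_coords [simp]:
  "co0 (conj_coords p) = cnj (co0 p)" "co1 (conj_coords p) = cnj (co1 p)" "co2 (conj_coords p) = cnj (co2 p)" "co3 (conj_coords p) = cnj (co3 p)"
  by (simp_all add: conj_coords_def)

lemma re_part_iq_simps:
  "re_part (p + q) = re_part p + re_part q" "im_part (p + q) = im_part p + im_part q"
  "re_part (p * q) = re_part p * re_part q - im_part p * im_part q" "im_part (p * q) = re_part p * im_part q + im_part p * re_part q"
  "re_part (conj_coords p) = re_part p" "im_part (conj_coords p) = - im_part p" "re_part 0 = 0" "im_part 0 = 0"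
  by (simp_all add: quat_eq_iff co_mult quat_mult_sel algebra_simps)

lemma slice_val_simps:
  "slice_val I (p + q) = slice_val I p + slice_val I q" "slice_val I 0 = 0"
  "slice_val (- I) (conj_coords p) = slice_val I p"
  by (simp_all add: slice_val_def re_part_iq_simps algebra_simps)

lemma slice_val_mult:
  assumes "I \<in> imag_units"
  shows "slice_val I (p * q) = slice_val I p * re_part q + I * slice_val I p * im_part q"
  by (simp add: slice_val_def re_part_iq_simps algebra_simps imag_unit_square[OF assms])

lemma slice_val_eq_iff:
  assumes "I \<in> imag_units"
  shows "p = q \<longleftrightarrow> slice_val I p = slice_val I q \<and> slice_val (- I) p = slice_val (- I) q"
proof
  assume *: "slice_val I p = slice_val I q \<and> slice_val (- I) p = slice_val (- I) q"
  have "re_part r = (1/2) *\<^sub>R (slice_val I r + slice_val (- I) r)" for r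
    by (simp add: slice_val_def quat_eq_iff)
  then have "re_part p = re_part q" using * by simp
  moreover from this * have "I * im_part p = I * im_part q" by (simp add: slice_val_def)
  then have "I * (I * im_part p) = I * (I * im_part q)" by simp
  then have "im_part p = im_part q" unfolding imag_unit_square[OF assms] by simp
  ultimately show "p = q" by (metis of_parts_re_im)
qed auto

lemma unstem_slice_point:
  assumes "stem_symmetric \<phi>" "I \<in> imag_units"
  shows "unstem \<phi> (slice_point I x y) = slice_val I (\<phi> (Complex x y))"
  using slice_point_cases[OF assms(2), of x y]
proof (elim disjE conjE)
  assume "Complex x y = qcoord (slice_point I x y)" "y = 0"
  moreover have "cnj (Complex x 0) = Complex x 0" by (simp add: complex_eq_iff)
  then have "\<phi> (Complex x 0) = conj_coords (\<phi> (Complex x 0))"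
    using assms(1) unfolding stem_symmetric_def by metis
  then have "im_part (\<phi> (Complex x 0)) = - im_part (\<phi> (Complex x 0))" by (metis re_part_iq_simps(6))
  then have "im_part (\<phi> (Complex x 0)) = 0" by (simp add: quat_eq_iff)
  ultimately show ?thesis by (simp add: unstem_def slice_val_def)
next
  assume "Complex x y = qcoord (slice_point I x y)" "I = qdir (slice_point I x y)"
  then show ?thesis by (simp add: unstem_def)
next
  assume "cnj (Complex x y) = qcoord (slice_point I x y)" "- I = qdir (slice_point I x y)"
  then have "unstem \<phi> (slice_point I x y) = slice_val (- I) (\<phi> (cnj (Complex x y)))"
    by (simp add: unstem_def)
  also have "\<dots> = slice_val I (\<phi> (Complex x y))"
    using assms(1) by (simp add: stem_symmetric_def slice_val_simps)
  finally show ?thesis .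
qed

lemma conjugate_imag_unit:
  assumes "I \<in> imag_units" "a \<noteq> 0"
  shows "inverse a * I * a \<in> imag_units"
    "inverse a * slice_point I x y * a = slice_point (inverse a * I * a) x y"
proof -
  have "inverse a * I * a * (inverse a * I * a) = inverse a * (I * (I * a))"
    using assms(2) by (simp add: mult.assoc) (simp add: mult.assoc[symmetric])
  then show "inverse a * I * a \<in> imag_units"
    using assms(2) by (simp add: imag_unit_square[OF assms(1)] imag_units_def power2_eq_square)
  show "inverse a * slice_point I x y * a = slice_point (inverse a * I * a) x y"
    unfolding slice_point_def of_real_def using assms(2)
    by (simp add: distrib_left distrib_right mult.assoc)
qed

lemma qcoord_conjugate:
  assumes "a \<noteq> 0"
  shows "qcoord (inverse a * q * a) = qcoord q"
proof -
  have "inverse a * q * a = slice_point (inverse a * qdir q * a) (Re (qcoord q)) (Im (qcoord q))"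
    using conjugate_imag_unit(2)[OF qdir_unit assms] slice_point_qdir by metis
  also have "qcoord \<dots> = Complex (Re (qcoord q)) \<bar>Im (qcoord q)\<bar>"
    by (rule qcoord_slice_point[OF conjugate_imag_unit(1)[OF qdir_unit assms]])
  finally show ?thesis using Im_qcoord_nonneg[of q] by simp
qed

text \<open>
  With \<open>a = f(q)\<close> and \<open>q\<close> on the slice of \<open>I\<close>, the point \<open>a\<^sup>-\<^sup>1 q a\<close> lies on the same sphere and on the slice of \<open>a\<^sup>-\<^sup>1 I a\<close>.
  Therefore \<open>a g(a\<^sup>-\<^sup>1 q a) = a G\<^sub>1 + I a G\<^sub>2\<close>, which is the value of the product of the stems.
\<close>

lemma unstem_star:
  assumes "stem_symmetric \<phi>" "stem_symmetric \<psi>"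
  shows "star (unstem \<phi>) (unstem \<psi>) q = unstem (\<lambda>z. \<phi> z * \<psi> z) q"
proof -
  define z I where "z = qcoord q" and "I = qdir q"
  have I: "I \<in> imag_units" and q: "q = slice_point I (Re z) (Im z)"
    using qdir_unit slice_point_qdir by (simp_all add: z_def I_def)
  define a where "a = unstem \<phi> q"
  have a: "a = slice_val I (\<phi> z)" by (simp add: a_def unstem_def z_def I_def)
  have s: "unstem (\<lambda>z. \<phi> z * \<psi> z) q = a * re_part (\<psi> z) + I * a * im_part (\<psi> z)"
    unfolding unstem_def z_def[symmetric] I_def[symmetric] slice_val_mult[OF I] a ..
  show ?thesis
  proof (cases "a = 0")
    case True
    then show ?thesis using s by (simp add: star_def a_def)
  next
    case False
    define J where "J = inverse a * I * a"
    have J: "J \<in> imag_units"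
      unfolding J_def by (rule conjugate_imag_unit(1)[OF I False])
    have "inverse a * q * a = slice_point J (Re z) (Im z)"
      unfolding q J_def by (rule conjugate_imag_unit(2)[OF I False])
    then have "star (unstem \<phi>) (unstem \<psi>) q = a * slice_val J (\<psi> z)"
      using False unfolding star_def a_def[symmetric]
      by (simp add: unstem_slice_point[OF assms(2) J])
    also have "\<dots> = a * re_part (\<psi> z) + (a * inverse a) * I * a * im_part (\<psi> z)"
      by (simp add: slice_val_def J_def distrib_left mult.assoc)
    also have "\<dots> = unstem (\<lambda>z. \<phi> z * \<psi> z) q" using s False by simp
    finally show ?thesis .
  qed
qed

lemma unstem_add: "unstem (\<lambda>z. \<phi> z + \<psi> z) q = unstem \<phi> q + unstem \<psi> q"
  by (simp add: unstem_def slice_val_simps)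

lemma slice_val_qscal:
  "slice_val I (qscal c) = of_real (Re c) + I * of_real (Im c)"
  by (simp add: slice_val_def re_part_def im_part_def of_real_def one_quat_def scaleR_quat_def)

lemma slice_val_qscal_mult:
  assumes "I \<in> imag_units"
  shows "slice_val I (qscal c * p) = slice_val I (qscal c) * slice_val I p"
proof -
  have "re_part (qscal c * p) = Re c *\<^sub>R re_part p - Im c *\<^sub>R im_part p" "im_part (qscal c * p) = Re c *\<^sub>R im_part p + Im c *\<^sub>R re_part p"
    by (simp_all add: quat_eq_iff co_mult)
  then show ?thesis
    unfolding slice_val_qscal unfolding slice_val_def
    by (simp add: of_real_def distrib_left distrib_right right_diff_distrib imag_unit_square[OF assms] mult.assoc)
qed

lemma slice_val_qscal_power:
  assumes "I \<in> imag_units"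
  shows "slice_val I (qscal c) ^ m = slice_val I (qscal (c ^ m))"
proof (induction m)
  case (Suc m)
  then show ?case using slice_val_qscal_mult[OF assms, of c "qscal (c ^ m)"] by simp
qed (use slice_val_qscal[of I 1] in simp)

lemma Delta_slice_point:
  assumes "I \<in> imag_units"
  shows "Delta p (slice_point I x y) =
    slice_val I (qscal ((Complex x y - qcoord p) * (Complex x y - cnj (qcoord p))))"
proof -
  have n: "(norm p)\<^sup>2 = (qre p)\<^sup>2 + (Im (qcoord p))\<^sup>2"
    unfolding Im_qcoord_square by (simp add: norm_quat_def inner_quat_def power2_eq_square)
  have q: "slice_point I x y = slice_val I (qscal (Complex x y))"
    by (simp add: slice_point_def slice_val_qscal)
  have r: "of_real r = slice_val I (qscal (of_real r))" for r
    by (simp add: slice_val_qscal)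
  have d: "slice_val I p - slice_val I q = slice_val I (p - q)" for p q
    by (simp add: slice_val_def quat_eq_iff algebra_simps quat_mult_sel)
  have "Delta p (slice_point I x y) = slice_point I x y * slice_point I x y
      - of_real (2 * qre p) * slice_point I x y + of_real ((qre p)\<^sup>2 + (Im (qcoord p))\<^sup>2)"
    unfolding Delta_def n unfolding power2_eq_square[of "slice_point I x y"] ..
  also have "\<dots> = slice_val I (qscal (Complex x y * Complex x y
      - of_real (2 * qre p) * Complex x y + of_real ((qre p)\<^sup>2 + (Im (qcoord p))\<^sup>2)))"
    by (simp only: q r slice_val_qscal_mult[OF assms, symmetric] d slice_val_simps(1)[symmetric]
      qscal_mult qscal_add qscal_diff)
  also have "Complex x y * Complex x y - of_real (2 * qre p) * Complex x y + of_real ((qre p)\<^sup>2 + (Im (qcoord p))\<^sup>2)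
      = (Complex x y - qcoord p) * (Complex x y - cnj (qcoord p))"
    by (simp add: complex_eq_iff power2_eq_square algebra_simps) (simp add: qcoord_def)
  finally show ?thesis .
qed

text \<open>The Cauchy-Riemann equation on a slice is the one satisfied by each complex coordinate of the stem.\<close>

lemma slice_regular_unstem:
  assumes sym: "stem_symmetric \<phi>"
    and diff: "\<And>I x y. I \<in> imag_units \<Longrightarrow> slice_point I x y \<in> D \<Longrightarrow>
      (\<lambda>z. co0 (\<phi> z)) field_differentiable at (Complex x y) \<and>
      (\<lambda>z. co1 (\<phi> z)) field_differentiable at (Complex x y) \<and>
      (\<lambda>z. co2 (\<phi> z)) field_differentiable at (Complex x y) \<and>
      (\<lambda>z. co3 (\<phi> z)) field_differentiable at (Complex x y)"
  shows "slice_regular D (unstem \<phi>)"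
  unfolding slice_regular_def
proof (intro conjI ballI allI impI)
  let ?F1 = "\<lambda>x y. re_part (\<phi> (Complex x y))" and ?F2 = "\<lambda>x y. im_part (\<phi> (Complex x y))"
  have "\<phi> (Complex x (- y)) = conj_coords (\<phi> (Complex x y))" for x y
    using sym unfolding stem_symmetric_def by (metis complex_cnj)
  then show "\<exists>F1 F2 :: real \<Rightarrow> real \<Rightarrow> quat.
        (\<forall>x y. F1 x (- y) = F1 x y \<and> F2 x (- y) = - F2 x y) \<and>
        (\<forall>I\<in>imag_units. \<forall>x y. slice_point I x y \<in> D \<longrightarrow>
           unstem \<phi> (slice_point I x y) = F1 x y + I * F2 x y)"
    by (intro exI[of _ ?F1] exI[of _ ?F2]) (simp add: re_part_iq_simps unstem_slice_point[OF sym] slice_val_def)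
next
  fix I x y assume I: "I \<in> imag_units" and D: "slice_point I x y \<in> D"
  have coord: "\<exists>L. ((\<lambda>(s, t). Re (u (Complex s t)) *\<^sub>R b + Im (u (Complex s t)) *\<^sub>R (I * b)) has_derivative L) (at (x, y))
      \<and> L (1, 0) + I * L (0, 1) = 0"
    if u: "u field_differentiable at (Complex x y)" for u :: "complex \<Rightarrow> complex" and b :: quat
  proof -
    obtain d where d: "(u has_derivative (\<lambda>h. d * h)) (at (Complex x y))"
      using u by (auto simp: field_differentiable_def has_field_derivative_def)
    have c: "((\<lambda>p. Complex (fst p) (snd p)) has_derivative (\<lambda>p. Complex (fst p) (snd p))) (at (x, y))"
      unfolding Complex_eq
      by (intro has_derivative_add has_derivative_mult_right bounded_linear.has_derivative[OF bounded_linear_of_real]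
        has_derivative_fst has_derivative_snd has_derivative_ident)
    have "((\<lambda>p. u (Complex (fst p) (snd p))) has_derivative (\<lambda>p. d * Complex (fst p) (snd p))) (at (x, y))"
      using has_derivative_compose[OF c] d by simp
    then have "((\<lambda>p. Re (u (Complex (fst p) (snd p))) *\<^sub>R b + Im (u (Complex (fst p) (snd p))) *\<^sub>R (I * b)) has_derivative
        (\<lambda>p. Re (d * Complex (fst p) (snd p)) *\<^sub>R b + Im (d * Complex (fst p) (snd p)) *\<^sub>R (I * b))) (at (x, y))"
      by (intro has_derivative_add has_derivative_scaleR_left bounded_linear.has_derivative[OF bounded_linear_Re]
        bounded_linear.has_derivative[OF bounded_linear_Im])
    moreover have "(Re (d * Complex 1 0) *\<^sub>R b + Im (d * Complex 1 0) *\<^sub>R (I * b)) +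
        I * (Re (d * Complex 0 1) *\<^sub>R b + Im (d * Complex 0 1) *\<^sub>R (I * b)) = 0"
      by (simp add: algebra_simps imag_unit_square[OF I])
    ultimately show ?thesis
      by (intro exI[of _ "\<lambda>p. Re (d * Complex (fst p) (snd p)) *\<^sub>R b + Im (d * Complex (fst p) (snd p)) *\<^sub>R (I * b)"] conjI)
        (simp_all only: case_prod_unfold fst_conv snd_conv)
  qed
  let ?T = "\<lambda>u b (s, t). Re (u (Complex s t)) *\<^sub>R b + Im (u (Complex s t)) *\<^sub>R (I * b)"
  note diff' = diff[OF I D]
  obtain L0 where L0: "(?T (\<lambda>z. co0 (\<phi> z)) 1 has_derivative L0) (at (x, y))" "L0 (1, 0) + I * L0 (0, 1) = 0"
    using coord[OF diff'[THEN conjunct1], of 1] by (elim exE conjE)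
  obtain L1 where L1: "(?T (\<lambda>z. co1 (\<phi> z)) (Quat 0 1 0 0) has_derivative L1) (at (x, y))" "L1 (1, 0) + I * L1 (0, 1) = 0"
    using coord[OF diff'[THEN conjunct2, THEN conjunct1], of "Quat 0 1 0 0"] by (elim exE conjE)
  obtain L2 where L2: "(?T (\<lambda>z. co2 (\<phi> z)) (Quat 0 0 1 0) has_derivative L2) (at (x, y))" "L2 (1, 0) + I * L2 (0, 1) = 0"
    using coord[OF diff'[THEN conjunct2, THEN conjunct2, THEN conjunct1], of "Quat 0 0 1 0"] by (elim exE conjE)
  obtain L3 where L3: "(?T (\<lambda>z. co3 (\<phi> z)) (Quat 0 0 0 1) has_derivative L3) (at (x, y))" "L3 (1, 0) + I * L3 (0, 1) = 0"
    using coord[OF diff'[THEN conjunct2, THEN conjunct2, THEN conjunct2], of "Quat 0 0 0 1"] by (elim exE conjE)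
  note L = L0 L1 L2 L3
  have sum: "unstem \<phi> (slice_point I s t) = ?T (\<lambda>z. co0 (\<phi> z)) 1 (s, t) + ?T (\<lambda>z. co1 (\<phi> z)) (Quat 0 1 0 0) (s, t)
      + ?T (\<lambda>z. co2 (\<phi> z)) (Quat 0 0 1 0) (s, t) + ?T (\<lambda>z. co3 (\<phi> z)) (Quat 0 0 0 1) (s, t)" for s t
    unfolding unstem_slice_point[OF sym I] slice_val_def
    by (simp add: quat_eq_iff quat_mult_sel algebra_simps)
  have "((\<lambda>p. ?T (\<lambda>z. co0 (\<phi> z)) 1 p + ?T (\<lambda>z. co1 (\<phi> z)) (Quat 0 1 0 0) p
      + ?T (\<lambda>z. co2 (\<phi> z)) (Quat 0 0 1 0) p + ?T (\<lambda>z. co3 (\<phi> z)) (Quat 0 0 0 1) p)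
      has_derivative (\<lambda>p. L0 p + L1 p + L2 p + L3 p)) (at (x, y))"
    by (intro has_derivative_add L0(1) L1(1) L2(1) L3(1))
  moreover have "(\<lambda>p. ?T (\<lambda>z. co0 (\<phi> z)) 1 p + ?T (\<lambda>z. co1 (\<phi> z)) (Quat 0 1 0 0) p
      + ?T (\<lambda>z. co2 (\<phi> z)) (Quat 0 0 1 0) p + ?T (\<lambda>z. co3 (\<phi> z)) (Quat 0 0 0 1) p)
      = (\<lambda>(s, t). unstem \<phi> (slice_point I s t))"
    using sum by (auto simp: fun_eq_iff)
  moreover have "(L0 (1, 0) + L1 (1, 0) + L2 (1, 0) + L3 (1, 0)) +
      I * (L0 (0, 1) + L1 (0, 1) + L2 (0, 1) + L3 (0, 1)) =
      (L0 (1, 0) + I * L0 (0, 1)) + (L1 (1, 0) + I * L1 (0, 1)) + (L2 (1, 0) + I * L2 (0, 1)) + (L3 (1, 0) + I * L3 (0, 1))"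
    by (simp add: algebra_simps)
  then have "(L0 (1, 0) + L1 (1, 0) + L2 (1, 0) + L3 (1, 0)) +
      I * (L0 (0, 1) + L1 (0, 1) + L2 (0, 1) + L3 (0, 1)) = 0"
    unfolding L by simp
  ultimately show "\<exists>L. ((\<lambda>(s, t). unstem \<phi> (slice_point I s t)) has_derivative L) (at (x, y)) \<and>
             (L (1, 0) + I * L (0, 1)) /\<^sub>R 2 = 0"
    by (intro exI[of _ "\<lambda>p. L0 p + L1 p + L2 p + L3 p"]) simp
qed

text \<open>
  The parts of the stem are recovered from the values \<open>F\<^sub>1 \<plusminus> i F\<^sub>2\<close> on the slices of \<open>i\<close> and \<open>- i\<close>, which shows that they are
  differentiable; the two equations on these slices combine to the Cauchy-Riemann equations of the pair \<open>(F\<^sub>1, F\<^sub>2)\<close>.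
\<close>

lemma slice_regular_stem:
  assumes D: "open D" "circular D" and f: "slice_regular D f"
  obtains \<phi> where "stem_symmetric \<phi>" "\<And>q. q \<in> D \<Longrightarrow> f q = unstem \<phi> q"
    "\<And>z i. z \<in> plane D \<Longrightarrow> i \<in> {co0, co1, co2, co3} \<Longrightarrow> (\<lambda>z. i (\<phi> z)) field_differentiable at z"
proof -
  obtain F1 F2 :: "real \<Rightarrow> real \<Rightarrow> quat" where
    par: "\<And>x y. F1 x (- y) = F1 x y \<and> F2 x (- y) = - F2 x y" and
    rep: "\<And>I x y. I \<in> imag_units \<Longrightarrow> slice_point I x y \<in> D \<Longrightarrow> f (slice_point I x y) = F1 x y + I * F2 x y"
    using f unfolding slice_regular_def by blast
  have CR: "\<exists>L. ((\<lambda>(s, t). f (slice_point I s t)) has_derivative L) (at (x, y)) \<and> L (1, 0) + I * L (0, 1) = 0"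
    if "I \<in> imag_units" "slice_point I x y \<in> D" for I x y
    using f that unfolding slice_regular_def by auto
  define \<phi> where "\<phi> z = (if z \<in> plane D then of_parts (F1 (Re z) (Im z)) (F2 (Re z) (Im z)) else 0)" for z
  have sym: "stem_symmetric \<phi>"
    unfolding stem_symmetric_def \<phi>_def
    by (simp add: cnj_in_plane_iff[OF D(2)] par) (simp add: of_parts_def conj_coords_def qalg_eq_iff complex_eq_iff)
  have eq: "f q = unstem \<phi> q" if "q \<in> D" for q
  proof -
    have z: "qcoord q \<in> plane D" using that qcoord_in_iff[OF D(2)] by blast
    have "f q = f (slice_point (qdir q) (Re (qcoord q)) (Im (qcoord q)))"
      by (simp add: slice_point_qdir)
    also have "\<dots> = F1 (Re (qcoord q)) (Im (qcoord q)) + qdir q * F2 (Re (qcoord q)) (Im (qcoord q))"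
      using that by (intro rep qdir_unit) (simp add: slice_point_qdir)
    finally show ?thesis using z by (simp add: unstem_def slice_val_def \<phi>_def)
  qed
  have diff: "(\<lambda>z. i (\<phi> z)) field_differentiable at z"
    if z: "z \<in> plane D" and i: "i \<in> {co0, co1, co2, co3}" for z i
  proof -
    obtain x y where xy: "z = Complex x y" by (cases z)
    have in1: "slice_point qI x y \<in> D" and in2: "slice_point (- qI) x y \<in> D"
      using z slice_point_in_iff[OF D(2)] qI_unit minus_unit xy by auto
    obtain L where L: "((\<lambda>p. f (slice_point qI (fst p) (snd p))) has_derivative L) (at (x, y))" "L (1, 0) + qI * L (0, 1) = 0"
      using CR[OF qI_unit in1] by (auto simp: case_prod_unfold)
    obtain M where M: "((\<lambda>p. f (slice_point (- qI) (fst p) (snd p))) has_derivative M) (at (x, y))" "M (1, 0) + (- qI) * M (0, 1) = 0"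
      using CR[OF minus_unit[OF qI_unit] in2] by (auto simp: case_prod_unfold)
    define A B where "A p = (1/2) *\<^sub>R (L p + M p)" and "B p = (1/2) *\<^sub>R ((- qI) * (L p - M p))" for p
    define G1 G2 where "G1 p = (1/2) *\<^sub>R (f (slice_point qI (fst p) (snd p)) + f (slice_point (- qI) (fst p) (snd p)))"
      and "G2 p = (1/2) *\<^sub>R ((- qI) * (f (slice_point qI (fst p) (snd p)) - f (slice_point (- qI) (fst p) (snd p))))" for p
    have dG: "(G1 has_derivative A) (at (x, y))" "(G2 has_derivative B) (at (x, y))"
      unfolding G1_def[abs_def] G2_def[abs_def] A_def[abs_def] B_def[abs_def]
      by (intro has_derivative_scaleR_right has_derivative_mult_right has_derivative_add has_derivative_diff L(1) M(1))+
    have l: "L (1, 0) = - (qI * L (0, 1))" and m: "M (1, 0) = qI * M (0, 1)"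
      using L(2) M(2) by (simp_all add: eq_neg_iff_add_eq_0)
    have cr: "A (1, 0) = B (0, 1)" "A (0, 1) = - B (1, 0)"
      unfolding A_def B_def l m
      by (simp_all add: right_diff_distrib imag_unit_square[OF qI_unit] algebra_simps)
    have G: "\<phi> w = of_parts (G1 (Re w, Im w)) (G2 (Re w, Im w))" if w: "w \<in> plane D" for w
    proof -
      have "slice_point qI (Re w) (Im w) \<in> D" "slice_point (- qI) (Re w) (Im w) \<in> D"
        using w slice_point_in_iff[OF D(2)] qI_unit minus_unit by auto
      then have "f (slice_point qI (Re w) (Im w)) = F1 (Re w) (Im w) + qI * F2 (Re w) (Im w)"
        "f (slice_point (- qI) (Re w) (Im w)) = F1 (Re w) (Im w) + (- qI) * F2 (Re w) (Im w)"
        using rep[OF qI_unit] rep[OF minus_unit[OF qI_unit]] by blast+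
      then have "G1 (Re w, Im w) = F1 (Re w) (Im w)" "G2 (Re w, Im w) = F2 (Re w) (Im w)"
        unfolding G1_def G2_def
        by (simp_all add: quat_eq_iff) (simp_all add: quat_mult_sel qI_def)
      then show ?thesis using w by (simp add: \<phi>_def)
    qed
    have key: "(\<lambda>w. Complex (c (G1 (Re w, Im w))) (c (G2 (Re w, Im w)))) field_differentiable at z"
      if c: "bounded_linear c" for c :: "quat \<Rightarrow> real"
    proof -
      have p: "((\<lambda>w. (Re w, Im w)) has_derivative (\<lambda>w. (Re w, Im w))) (at z)"
        by (intro has_derivative_Pair bounded_linear.has_derivative[OF bounded_linear_Re]
          bounded_linear.has_derivative[OF bounded_linear_Im] has_derivative_ident)
      have z': "(Re z, Im z) = (x, y)" using xy by simp
      have "((\<lambda>w. of_real (c (G1 (Re w, Im w))) + \<i> * of_real (c (G2 (Re w, Im w)))) has_derivative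
          (\<lambda>h. of_real (c (A (Re h, Im h))) + \<i> * of_real (c (B (Re h, Im h))))) (at z)"
        by (intro has_derivative_add has_derivative_mult_right
          bounded_linear.has_derivative[OF bounded_linear_of_real] bounded_linear.has_derivative[OF c]
          has_derivative_compose[OF p, of G1 A, unfolded z', OF dG(1)]
          has_derivative_compose[OF p, of G2 B, unfolded z', OF dG(2)])
      moreover have "(\<lambda>h. of_real (c (A (Re h, Im h))) + \<i> * of_real (c (B (Re h, Im h))))
          = (\<lambda>h. Complex (c (A (1, 0))) (c (B (1, 0))) * h)"
      proof
        fix h
        have lin: "linear A" "linear B" using dG has_derivative_linear by blast+
        have split: "(Re h, Im h) = Re h *\<^sub>R (1, 0) + Im h *\<^sub>R (0, 1)" by simp
        have "A (Re h, Im h) = Re h *\<^sub>R A (1, 0) + Im h *\<^sub>R A (0, 1)"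
          "B (Re h, Im h) = Re h *\<^sub>R B (1, 0) + Im h *\<^sub>R B (0, 1)"
          unfolding split by (simp_all add: linear_add[OF lin(1)] linear_add[OF lin(2)]
            linear_scale[OF lin(1)] linear_scale[OF lin(2)] del: scaleR_Pair add_Pair)
        then have "A (Re h, Im h) = Re h *\<^sub>R A (1, 0) - Im h *\<^sub>R B (1, 0)"
          "B (Re h, Im h) = Re h *\<^sub>R B (1, 0) + Im h *\<^sub>R A (1, 0)"
          using cr by simp_all
        then have "c (A (Re h, Im h)) = Re h * c (A (1, 0)) - Im h * c (B (1, 0))"
          "c (B (Re h, Im h)) = Re h * c (B (1, 0)) + Im h * c (A (1, 0))"
          using bounded_linear.linear[OF c] by (simp_all add: linear_diff linear_add linear_scale)
        then show "of_real (c (A (Re h, Im h))) + \<i> * of_real (c (B (Re h, Im h)))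
            = Complex (c (A (1, 0))) (c (B (1, 0))) * h"
          by (simp add: complex_eq_iff algebra_simps)
      qed
      ultimately show ?thesis
        unfolding field_differentiable_def has_field_derivative_def Complex_eq by auto
    qed
    have ev: "eventually (\<lambda>w. w \<in> plane D) (nhds z)"
      using open_plane[OF D(1)] z by (rule eventually_nhds_in_open)
    have fin: "(\<lambda>z. i (\<phi> z)) field_differentiable at z"
      if c: "bounded_linear c" "\<And>a b. i (of_parts a b) = Complex (c a) (c b)" for c
    proof -
      have "eventually (\<lambda>w. i (\<phi> w) = Complex (c (G1 (Re w, Im w))) (c (G2 (Re w, Im w)))) (nhds z)"
        using ev by eventually_elim (simp add: G c(2))
      then show ?thesis
        using key[OF c(1)] unfolding field_differentiable_def by (simp add: DERIV_cong_ev[OF refl _ refl])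
    qed
    from i consider "i = co0" | "i = co1" | "i = co2" | "i = co3" by blast
    then show ?thesis
    proof cases
      case 1 then show ?thesis by (intro fin[OF bounded_linear_quat_sel(1)]) (simp add: of_parts_def)
    next
      case 2 then show ?thesis by (intro fin[OF bounded_linear_quat_sel(2)]) (simp add: of_parts_def)
    next
      case 3 then show ?thesis by (intro fin[OF bounded_linear_quat_sel(3)]) (simp add: of_parts_def)
    next
      case 4 then show ?thesis by (intro fin[OF bounded_linear_quat_sel(4)]) (simp add: of_parts_def)
    qed
  qed
  show ?thesis by (rule that[OF sym eq diff])
qed


section \<open>Semi-regular functions and meromorphic stems\<close>

definition conj_sym :: "(complex \<Rightarrow> complex) \<Rightarrow> bool" where
  "conj_sym u \<longleftrightarrow> (\<forall>z. u (cnj z) = cnj (u z))"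

lemma conj_symD: "conj_sym u \<Longrightarrow> u (cnj z) = cnj (u z)"
  by (simp add: conj_sym_def)

lemma conj_sym_intros:
  "conj_sym (\<lambda>_. of_real r)" "conj_sym u \<Longrightarrow> conj_sym v \<Longrightarrow> conj_sym (\<lambda>z. u z + v z)" "conj_sym u \<Longrightarrow> conj_sym v \<Longrightarrow> conj_sym (\<lambda>z. u z - v z)"
  "conj_sym u \<Longrightarrow> conj_sym (\<lambda>z. - u z)" "conj_sym u \<Longrightarrow> conj_sym v \<Longrightarrow> conj_sym (\<lambda>z. u z * v z)"
  "conj_sym u \<Longrightarrow> conj_sym (\<lambda>z. inverse (u z))" "conj_sym u \<Longrightarrow> conj_sym (\<lambda>z. u z ^ m)"
  "conj_sym (\<lambda>z. (z - w) * (z - cnj w))"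
  by (auto simp: conj_sym_def)

lemma conj_sym_tendsto:
  assumes "conj_sym u" "(u \<longlongrightarrow> c) (at z)"
  shows "(u \<longlongrightarrow> cnj c) (at (cnj z))"
proof -
  have "filterlim cnj (at z) (at (cnj z))"
  proof (rule filterlim_atI)
    have "(cnj \<longlongrightarrow> cnj (cnj z)) (at (cnj z))" by (intro tendsto_intros)
    then show "(cnj \<longlongrightarrow> z) (at (cnj z))" by simp
    show "eventually (\<lambda>w. cnj w \<noteq> z) (at (cnj z))"
      by (auto simp: eventually_at_filter intro!: always_eventually)
  qed
  then have "((\<lambda>w. cnj (u (cnj w))) \<longlongrightarrow> cnj c) (at (cnj z))"
    using assms(2) by (intro tendsto_cnj) (rule filterlim_compose)
  then show ?thesis using assms(1) by (simp add: conj_sym_def)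
qed

lemma conj_sym_remove_sings:
  assumes "conj_sym u"
  shows "conj_sym (remove_sings u)"
  unfolding conj_sym_def
proof
  fix z
  show "remove_sings u (cnj z) = cnj (remove_sings u z)"
  proof (cases "\<exists>c. (u \<longlongrightarrow> c) (at z)")
    case True
    then obtain c where c: "(u \<longlongrightarrow> c) (at z)" by blast
    show ?thesis
      using remove_sings_eqI[OF c] remove_sings_eqI[OF conj_sym_tendsto[OF assms c]] by simp
  next
    case False
    then have "\<not> (\<exists>c. (u \<longlongrightarrow> c) (at (cnj z)))"
      using conj_sym_tendsto[OF assms, of _ "cnj z"] by auto
    with False show ?thesis by (simp add: remove_sings_def)
  qed
qed

lemma open_image_cnj:
  assumes "open S"
  shows "open (cnj ` S)"
proof -
  have "cnj ` S = cnj -` S" by (auto simp: image_iff intro!: bexI[of _ "cnj _"])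
  moreover have "open (cnj -` S)" using assms by (intro open_vimage continuous_intros)
  ultimately show ?thesis by simp
qed

lemma conj_sym_analytic:
  assumes "conj_sym u" "u analytic_on {z}"
  shows "u analytic_on {cnj z}"
proof -
  obtain S where S: "open S" "z \<in> S" "u holomorphic_on S"
    using assms(2) unfolding analytic_at by blast
  have oc: "open (cnj ` S)" using S(1) by (simp add: open_image_cnj)
  have "cnj ` (cnj ` S) = S" by (simp add: image_image)
  then have "cnj \<circ> u \<circ> cnj holomorphic_on cnj ` S"
    using S(3) oc by (intro holomorphic_on_compose_cnj_cnj) simp_all
  moreover have "cnj \<circ> u \<circ> cnj = u" using assms(1) by (auto simp: conj_sym_def fun_eq_iff)
  ultimately show ?thesis unfolding analytic_at using oc S(2) by auto
qed

definition coords :: "(complex qalg \<Rightarrow> complex) set" where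
  "coords = {co0, co1, co2, co3}"

lemma qalg_eq_coords: "p = q \<longleftrightarrow> (\<forall>i\<in>coords. i p = i q)"
  by (auto simp: coords_def qalg_eq_iff)

lemma stem_symmetric_iff: "stem_symmetric \<phi> \<longleftrightarrow> (\<forall>i\<in>coords. conj_sym (\<lambda>z. i (\<phi> z)))"
  unfolding stem_symmetric_def conj_sym_def qalg_eq_coords by (auto simp: coords_def)

lemma stem_conj_sym: "stem_symmetric \<phi> \<Longrightarrow> i \<in> coords \<Longrightarrow> conj_sym (\<lambda>z. i (\<phi> z))"
  by (simp add: stem_symmetric_iff)

definition meromorphic_stem :: "quat set \<Rightarrow> (complex \<Rightarrow> complex qalg) \<Rightarrow> bool" where
  "meromorphic_stem \<Omega> \<phi> \<longleftrightarrow> stem_symmetric \<phi> \<and> (\<forall>i\<in>coords. (\<lambda>z. i (\<phi> z)) meromorphic_on plane \<Omega>)"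

definition regular_points :: "(complex \<Rightarrow> complex qalg) \<Rightarrow> complex set" where
  "regular_points \<phi> = {z. \<forall>i\<in>coords. (\<lambda>z. i (\<phi> z)) analytic_on {z}}"

lemma open_regular_points: "open (regular_points \<phi>)"
proof -
  have "regular_points \<phi> = (\<Inter>i\<in>coords. {z. (\<lambda>z. i (\<phi> z)) analytic_on {z}})"
    by (auto simp: regular_points_def)
  moreover have "open {z. u analytic_on {z}}" for u :: "complex \<Rightarrow> complex"
  proof (rule openI)
    fix z assume "z \<in> {z. u analytic_on {z}}"
    then obtain S where S: "open S" "z \<in> S" "u holomorphic_on S" unfolding mem_Collect_eq analytic_at by blast
    then have "S \<subseteq> {z. u analytic_on {z}}" unfolding analytic_at by blast
    with S show "\<exists>e>0. ball z e \<subseteq> {z. u analytic_on {z}}"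
      by (meson open_contains_ball subset_trans)
  qed
  ultimately show ?thesis by (auto simp: coords_def intro!: open_Int)
qed

lemma cnj_regular_points: "stem_symmetric \<phi> \<Longrightarrow> z \<in> regular_points \<phi> \<Longrightarrow> cnj z \<in> regular_points \<phi>"
  unfolding regular_points_def using conj_sym_analytic[OF stem_conj_sym] by blast

lemma slice_regular_unstem':
  assumes "stem_symmetric \<phi>" "circular D" "plane D \<subseteq> regular_points \<phi>"
  shows "slice_regular D (unstem \<phi>)"
proof (rule slice_regular_unstem[OF assms(1)])
  fix I x y assume "I \<in> imag_units" "slice_point I x y \<in> D"
  then have "Complex x y \<in> regular_points \<phi>"
    using assms(3) slice_point_in_iff[OF assms(2)] by blast
  then show "(\<lambda>z. co0 (\<phi> z)) field_differentiable at (Complex x y) \<and>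
      (\<lambda>z. co1 (\<phi> z)) field_differentiable at (Complex x y) \<and>
      (\<lambda>z. co2 (\<phi> z)) field_differentiable at (Complex x y) \<and>
      (\<lambda>z. co3 (\<phi> z)) field_differentiable at (Complex x y)"
    by (auto simp: regular_points_def coords_def intro!: analytic_on_imp_differentiable_at)
qed

lemma slice_regular_mono:
  assumes "slice_regular D f" "E \<subseteq> D"
  shows "slice_regular E f"
  unfolding slice_regular_def
proof (intro conjI ballI allI impI)
  obtain F1 F2 :: "real \<Rightarrow> real \<Rightarrow> quat" where
    "\<forall>x y. F1 x (- y) = F1 x y \<and> F2 x (- y) = - F2 x y"
    "\<forall>I\<in>imag_units. \<forall>x y. slice_point I x y \<in> D \<longrightarrow> f (slice_point I x y) = F1 x y + I * F2 x y"
    using assms(1) unfolding slice_regular_def by (elim conjE exE)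
  then show "\<exists>F1 F2 :: real \<Rightarrow> real \<Rightarrow> quat.
        (\<forall>x y. F1 x (- y) = F1 x y \<and> F2 x (- y) = - F2 x y) \<and>
        (\<forall>I\<in>imag_units. \<forall>x y. slice_point I x y \<in> E \<longrightarrow> f (slice_point I x y) = F1 x y + I * F2 x y)"
    using assms(2) by (intro exI[of _ F1] exI[of _ F2]) auto
next
  fix I x y assume "I \<in> imag_units" "slice_point I x y \<in> E"
  then show "\<exists>L. ((\<lambda>(s, t). f (slice_point I s t)) has_derivative L) (at (x, y)) \<and>
      (L (1, 0) + I * L (0, 1)) /\<^sub>R 2 = 0"
    using assms unfolding slice_regular_def by (elim conjE) (simp add: subset_iff)
qed

lemma semiregular_local:
  assumes "semiregular_on \<Omega> D f" "p \<in> \<Omega>"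
  obtains U m h where "p \<in> U" "U \<subseteq> \<Omega>" "open U" "circular U" "U - sphere_of p \<subseteq> D"
    "slice_regular U h" "\<forall>q\<in>U - sphere_of p. h q = Delta p q ^ m * f q"
proof (cases "p \<in> D")
  case True
  then show ?thesis
    using assms that[of D f 0] unfolding semiregular_on_def by auto
next
  case False
  then have "\<exists>U m h. p \<in> U \<and> U \<subseteq> \<Omega> \<and> open U \<and> circular U \<and> U - sphere_of p \<subseteq> D \<and>
        slice_regular U h \<and> (\<forall>q\<in>U - sphere_of p. h q = Delta p q ^ m * f q)"
    using assms unfolding semiregular_on_def by blast
  then show ?thesis by (elim exE conjE) (rule that)
qed

lemma circular_Int: "circular A \<Longrightarrow> circular B \<Longrightarrow> circular (A \<inter> B)"
  by (auto simp: circular_def)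

text \<open>
  Domains of regularity may be shrunk: a sphere that is isolated in the complement of either domain is isolated in the
  complement of the intersection, and \<open>f\<close> has at worst a pole on it.
\<close>

lemma semiregular_on_Int:
  assumes f: "semiregular_on \<Omega> D f" and g: "semiregular_on \<Omega> E g"
  shows "semiregular_on \<Omega> (D \<inter> E) f"
proof -
  have D: "D \<subseteq> \<Omega>" "open D" "circular D" "slice_regular D f" and E: "open E" "circular E"
    using f g unfolding semiregular_on_def by auto
  have "\<exists>U m h. p \<in> U \<and> U \<subseteq> \<Omega> \<and> open U \<and> circular U \<and> U - sphere_of p \<subseteq> D \<inter> E \<and>
        slice_regular U h \<and> (\<forall>q\<in>U - sphere_of p. h q = Delta p q ^ m * f q)" if p: "p \<in> \<Omega>" for p
  proof -
    obtain U m h where U: "p \<in> U" "U \<subseteq> \<Omega>" "open U" "circular U" "U - sphere_of p \<subseteq> D"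
      "slice_regular U h" "\<forall>q\<in>U - sphere_of p. h q = Delta p q ^ m * f q"
      by (rule semiregular_local[OF f p])
    obtain V m' h' where V: "p \<in> V" "V \<subseteq> \<Omega>" "open V" "circular V" "V - sphere_of p \<subseteq> E"
      "slice_regular V h'" "\<forall>q\<in>V - sphere_of p. h' q = Delta p q ^ m' * g q"
      by (rule semiregular_local[OF g p])
    show ?thesis
    proof (intro exI conjI)
      show "p \<in> U \<inter> V" "U \<inter> V \<subseteq> \<Omega>" "U \<inter> V - sphere_of p \<subseteq> D \<inter> E" using U V by auto
      show "open (U \<inter> V)" "circular (U \<inter> V)" using U V by (auto intro: circular_Int)
      show "slice_regular (U \<inter> V) h" using U(6) by (rule slice_regular_mono) simp
      show "\<forall>q\<in>U \<inter> V - sphere_of p. h q = Delta p q ^ m * f q" using U(7) by blast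
    qed
  qed
  moreover have "slice_regular (D \<inter> E) f" using D(4) by (rule slice_regular_mono) simp
  ultimately show ?thesis
    unfolding semiregular_on_def using D E circular_Int by (simp add: open_Int le_infI1)
qed

lemma slice_regular_cong:
  assumes "open D" "slice_regular D f" "\<forall>q\<in>D. g q = f q"
  shows "slice_regular D g"
proof -
  have "\<exists>L. ((\<lambda>(s, t). g (slice_point I s t)) has_derivative L) (at (x, y)) \<and> (L (1, 0) + I * L (0, 1)) /\<^sub>R 2 = 0"
    if I: "I \<in> imag_units" and q: "slice_point I x y \<in> D" for I x y
  proof -
    obtain L where L: "((\<lambda>(s, t). f (slice_point I s t)) has_derivative L) (at (x, y))"
      "(L (1, 0) + I * L (0, 1)) /\<^sub>R 2 = 0"
      using assms(2) I q unfolding slice_regular_def by blast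
    have "continuous_on UNIV (\<lambda>p. slice_point I (fst p) (snd p))"
      unfolding slice_point_def by (intro continuous_intros)
    then have o: "open ((\<lambda>p. slice_point I (fst p) (snd p)) -` D)" (is "open ?S")
      using assms(1) by (intro open_vimage)
    have "((\<lambda>(s, t). g (slice_point I s t)) has_derivative L) (at (x, y))"
      by (rule has_derivative_transform_within_open[OF L(1) o]) (use assms(3) q in auto)
    with L(2) show ?thesis by blast
  qed
  moreover have "\<exists>F1 F2 :: real \<Rightarrow> real \<Rightarrow> quat.
        (\<forall>x y. F1 x (- y) = F1 x y \<and> F2 x (- y) = - F2 x y) \<and>
        (\<forall>I\<in>imag_units. \<forall>x y. slice_point I x y \<in> D \<longrightarrow> g (slice_point I x y) = F1 x y + I * F2 x y)"
  proof -
    obtain F1 F2 :: "real \<Rightarrow> real \<Rightarrow> quat" where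
      "\<forall>x y. F1 x (- y) = F1 x y \<and> F2 x (- y) = - F2 x y"
      "\<forall>I\<in>imag_units. \<forall>x y. slice_point I x y \<in> D \<longrightarrow> f (slice_point I x y) = F1 x y + I * F2 x y"
      using assms(2) unfolding slice_regular_def by (elim conjE exE)
    then show ?thesis using assms(3) by (intro exI[of _ F1] exI[of _ F2]) auto
  qed
  ultimately show ?thesis unfolding slice_regular_def by blast
qed

lemma semiregular_on_cong:
  assumes "semiregular_on \<Omega> D f" "\<forall>q\<in>D. g q = f q"
  shows "semiregular_on \<Omega> D g"
proof -
  have D: "D \<subseteq> \<Omega>" "open D" "circular D" "slice_regular D f"
    using assms(1) unfolding semiregular_on_def by auto
  have "\<exists>U m h. p \<in> U \<and> U \<subseteq> \<Omega> \<and> open U \<and> circular U \<and> U - sphere_of p \<subseteq> D \<and>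
        slice_regular U h \<and> (\<forall>q\<in>U - sphere_of p. h q = Delta p q ^ m * g q)" if p: "p \<in> \<Omega>" for p
  proof -
    obtain U m h where U: "p \<in> U" "U \<subseteq> \<Omega>" "open U" "circular U" "U - sphere_of p \<subseteq> D"
      "slice_regular U h" "\<forall>q\<in>U - sphere_of p. h q = Delta p q ^ m * f q"
      by (rule semiregular_local[OF assms(1) p])
    moreover have "\<forall>q\<in>U - sphere_of p. h q = Delta p q ^ m * g q"
      using U(5,7) assms(2) by (simp add: subset_iff)
    ultimately show ?thesis by blast
  qed
  with D slice_regular_cong[OF D(2,4) assms(2)] show ?thesis
    unfolding semiregular_on_def by blast
qed

lemma eventually_off_pair: "eventually (\<lambda>w. w \<noteq> z \<and> w \<noteq> cnj z) (at z)"
proof (cases "cnj z = z")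
  case True
  then show ?thesis by (simp add: eventually_at_filter)
next
  case False
  then have "eventually (\<lambda>w. w \<in> - {cnj z}) (nhds z)" by (intro eventually_nhds_in_open) auto
  then show ?thesis by (simp add: eventually_at_filter eventually_mono)
qed

lemma semiregular_eventually:
  assumes "semiregular_on \<Omega> D f" "circular \<Omega>" "z \<in> plane \<Omega>"
  shows "eventually (\<lambda>w. w \<in> plane D) (at z)"
proof -
  let ?p = "slice_point qI (Re z) (Im z)"
  have p: "?p \<in> \<Omega>" using assms(3) by (simp add: plane_def)
  obtain U m h where U: "?p \<in> U" "U \<subseteq> \<Omega>" "open U" "circular U" "U - sphere_of ?p \<subseteq> D"
      "slice_regular U h" "\<forall>q\<in>U - sphere_of ?p. h q = Delta ?p q ^ m * f q"
    by (rule semiregular_local[OF assms(1) p])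
  have z: "z \<in> plane U" using U(1) by (simp add: plane_def)
  have "eventually (\<lambda>w. w \<in> plane U) (at z)"
    using eventually_nhds_in_open[OF open_plane[OF U(3)] z] by (simp add: eventually_at_filter eventually_mono)
  moreover note eventually_off_pair[of z]
  ultimately show ?thesis
  proof eventually_elim
    case (elim w)
    let ?q = "slice_point qI (Re w) (Im w)"
    have "?q \<notin> sphere_of ?p"
    proof
      assume "?q \<in> sphere_of ?p"
      then have "Re w = Re z" "\<bar>Im w\<bar> = \<bar>Im z\<bar>"
        unfolding sphere_of_iff by (simp_all add: qcoord_slice_point qI_unit)
      then have "w = z \<or> w = cnj z" by (auto simp: complex_eq_iff abs_eq_iff)
      with elim show False by blast
    qed
    with elim U(5) show ?case by (auto simp: plane_def)
  qed
qed

lemma meromorphic_clear_pole: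
  assumes "u meromorphic_on {z}"
  obtains n where "\<And>k. k \<ge> n \<Longrightarrow> \<exists>c. ((\<lambda>w. (w - z) ^ k * u w) \<longlongrightarrow> c) (at z)"
proof -
  obtain F where F: "(\<lambda>w. u (z + w)) has_laurent_expansion F"
    using assms by (auto simp: meromorphic_on_def)
  show ?thesis
  proof (rule that)
    fix k assume k: "nat (- fls_subdegree F) \<le> k"
    have "(\<lambda>w. w ^ k * u (z + w)) has_laurent_expansion fls_X_intpow (int k) * F"
      by (intro laurent_expansion_intros F)
    then have G: "(\<lambda>w. (\<lambda>v. (v - z) ^ k * u v) (z + w)) has_laurent_expansion fls_X_intpow (int k) * F"
      by simp
    have "fls_subdegree (fls_X_intpow (int k) * F) \<ge> 0"
      using k by (cases "F = 0") simp_all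
    from has_laurent_expansion_imp_tendsto[OF G this]
    show "\<exists>c. ((\<lambda>w. (w - z) ^ k * u w) \<longlongrightarrow> c) (at z)" by blast
  qed
qed

text \<open>
  At a singularity \<open>w\<close>, the poles at \<open>w\<close> and \<open>cnj w\<close> are cleared together by a power of \<open>(z - w) (z - cnj w)\<close>, the planar
  form of \<open>Delta\<close>, and the removable singularities that are left are removed. Both steps preserve the symmetry.
\<close>

lemma semiregular_unstem:
  assumes \<Omega>: "open \<Omega>" "circular \<Omega>" and \<phi>: "meromorphic_stem \<Omega> \<phi>"
  shows "semiregular_on \<Omega> (\<Omega> \<inter> unplane (regular_points \<phi>)) (unstem \<phi>)"
proof -
  let ?R = "regular_points \<phi>" let ?D = "\<Omega> \<inter> unplane ?R"
  have sym: "stem_symmetric \<phi>" and mero: "\<And>i. i \<in> coords \<Longrightarrow> (\<lambda>z. i (\<phi> z)) meromorphic_on plane \<Omega>"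
    using \<phi> by (auto simp: meromorphic_stem_def)
  have planeR: "plane (unplane ?R) = ?R"
    by (rule plane_unplane) (rule cnj_regular_points[OF sym])
  have cD: "circular ?D" by (intro circular_Int \<Omega> circular_unplane)
  have "slice_regular ?D (unstem \<phi>)"
    by (rule slice_regular_unstem'[OF sym cD]) (simp add: plane_Int planeR)
  moreover have "\<exists>U m h. p \<in> U \<and> U \<subseteq> \<Omega> \<and> open U \<and> circular U \<and> U - sphere_of p \<subseteq> ?D \<and>
        slice_regular U h \<and> (\<forall>q\<in>U - sphere_of p. h q = Delta p q ^ m * unstem \<phi> q)" if p: "p \<in> \<Omega>" for p
  proof -
    define w where "w = qcoord p"
    have w: "w \<in> plane \<Omega>" unfolding w_def using qcoord_in_iff[OF \<Omega>(2)] p by blast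
    have merow: "(\<lambda>z. i (\<phi> z)) meromorphic_on {w}" if "i \<in> coords" for i
      using w by (intro meromorphic_on_subset[OF mero[OF that]]) simp
    have "eventually (\<lambda>z. (\<lambda>z. i (\<phi> z)) analytic_on {z}) (at w)" if "i \<in> coords" for i
      using meromorphic_on_imp_not_islimpt_singularities[OF merow[OF that], of w]
      by (simp add: islimpt_iff_eventually)
    then have "eventually (\<lambda>z. z \<in> ?R) (at w)"
      unfolding regular_points_def mem_Collect_eq
      by (intro eventually_ball_finite) (auto simp: coords_def)
    moreover have "eventually (\<lambda>z. z \<in> plane \<Omega>) (nhds w)"
      using open_plane[OF \<Omega>(1)] w by (rule eventually_nhds_in_open)
    ultimately have "eventually (\<lambda>z. z \<in> plane \<Omega> \<and> (z \<noteq> w \<longrightarrow> z \<in> ?R)) (nhds w)"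
      unfolding eventually_at_filter by eventually_elim auto
    then obtain S where S: "open S" "w \<in> S" "\<And>z. z \<in> S \<Longrightarrow> z \<in> plane \<Omega>" "\<And>z. z \<in> S \<Longrightarrow> z \<noteq> w \<Longrightarrow> z \<in> ?R"
      unfolding eventually_nhds by blast
    define W where "W = S \<union> cnj ` S"
    have W: "open W" "w \<in> W" "\<And>z. z \<in> W \<Longrightarrow> cnj z \<in> W"
      using S(1,2) by (auto simp: W_def open_image_cnj)
    have WO: "z \<in> plane \<Omega>" if "z \<in> W" for z
      using that S(3) cnj_in_plane_iff[OF \<Omega>(2)] by (auto simp: W_def)
    have WR: "z \<in> ?R" if "z \<in> W" "z \<noteq> w" "z \<noteq> cnj w" for z
      using that S(4) cnj_regular_points[OF sym] by (auto simp: W_def)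
    define U where "U = unplane W"
    have U: "open U" "circular U" "plane U = W"
      unfolding U_def using open_unplane[OF W(1)] circular_unplane plane_unplane[OF W(3)] by blast+
    have "\<exists>n. \<forall>k\<ge>n. \<exists>c. ((\<lambda>z. (z - w) ^ k * i (\<phi> z)) \<longlongrightarrow> c) (at w)" if "i \<in> coords" for i
      using meromorphic_clear_pole[OF merow[OF that]] by metis
    then have "\<forall>i\<in>coords. \<exists>n. \<forall>k\<ge>n. \<exists>c. ((\<lambda>z. (z - w) ^ k * i (\<phi> z)) \<longlongrightarrow> c) (at w)" by blast
    from bchoice[OF this] obtain n
      where n: "\<forall>i\<in>coords. \<forall>k\<ge>n i. \<exists>c. ((\<lambda>z. (z - w) ^ k * i (\<phi> z)) \<longlongrightarrow> c) (at w)" ..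
    define m where "m = Max (n ` coords)"
    have m: "n i \<le> m" if "i \<in> coords" for i
      unfolding m_def using that by (intro Max_ge) (auto simp: coords_def)
    define \<delta> where "\<delta> z = ((z - w) * (z - cnj w)) ^ m" for z
    define \<xi> where "\<xi> i z = \<delta> z * i (\<phi> z)" for i :: "complex qalg \<Rightarrow> complex" and z
    define \<eta> where "\<eta> z = QA (remove_sings (\<xi> co0) z) (remove_sings (\<xi> co1) z)
      (remove_sings (\<xi> co2) z) (remove_sings (\<xi> co3) z)" for z
    have i\<eta>: "(\<lambda>z. i (\<eta> z)) = remove_sings (\<xi> i)" if "i \<in> coords" for i
      using that by (auto simp: coords_def \<eta>_def)
    have \<xi>sym: "conj_sym (\<xi> i)" if "i \<in> coords" for i
      unfolding \<xi>_def[abs_def] \<delta>_def[abs_def] by (intro conj_sym_intros stem_conj_sym[OF sym that])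
    have \<eta>sym: "stem_symmetric \<eta>"
      unfolding stem_symmetric_iff using i\<eta> conj_sym_remove_sings[OF \<xi>sym] by simp
    have \<xi>an: "\<xi> i analytic_on {z}" if "i \<in> coords" "z \<in> ?R" for i z
      using that unfolding \<xi>_def[abs_def] \<delta>_def[abs_def] regular_points_def
      by (intro analytic_intros) auto
    have anw: "remove_sings (\<xi> i) analytic_on {w}" if i: "i \<in> coords" for i
    proof -
      obtain c where c: "((\<lambda>z. (z - w) ^ m * i (\<phi> z)) \<longlongrightarrow> c) (at w)" using n i m[OF i] by blast
      have "((\<lambda>z. (z - cnj w) ^ m * ((z - w) ^ m * i (\<phi> z))) \<longlongrightarrow> (w - cnj w) ^ m * c) (at w)"
        by (intro tendsto_intros c)
      then have lim: "(\<xi> i \<longlongrightarrow> (w - cnj w) ^ m * c) (at w)"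
        by (simp add: \<xi>_def[abs_def] \<delta>_def power_mult_distrib mult_ac)
      have "\<xi> i meromorphic_on {w}"
        unfolding \<xi>_def[abs_def] \<delta>_def[abs_def] by (intro meromorphic_intros merow i)
      then have "isolated_singularity_at (\<xi> i) w" by (rule meromorphic_on_isolated_singularity)
      then show ?thesis using lim by (rule remove_sings_analytic_at)
    qed
    have an: "remove_sings (\<xi> i) analytic_on {z}" if i: "i \<in> coords" and z: "z \<in> W" for i z
    proof -
      consider "z = w" | "z = cnj w" | "z \<in> ?R" using WR z by blast
      then show ?thesis
      proof cases
        case 1 then show ?thesis using anw[OF i] by simp
      next
        case 2 then show ?thesis using conj_sym_analytic[OF conj_sym_remove_sings[OF \<xi>sym[OF i]] anw[OF i]] by simp
      next
        case 3 then show ?thesis using remove_sings_analytic_on[OF \<xi>an[OF i]] by simp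
      qed
    qed
    have "plane U \<subseteq> regular_points \<eta>"
      unfolding U(3) regular_points_def using an i\<eta> by auto
    then have reg: "slice_regular U (unstem \<eta>)"
      by (rule slice_regular_unstem'[OF \<eta>sym U(2)])
    have off: "qcoord q \<in> W \<and> qcoord q \<in> ?R" if q: "q \<in> U - sphere_of p" for q
    proof -
      have qW: "qcoord q \<in> W" using q by (simp add: U_def unplane_def)
      have ne: "qcoord q \<noteq> w" using q by (simp add: sphere_of_iff w_def)
      have "qcoord q \<noteq> cnj w"
      proof
        assume e: "qcoord q = cnj w"
        then have "Im (qcoord q) = - Im w" by simp
        then have "Im w = 0" using Im_qcoord_nonneg[of q] Im_qcoord_nonneg[of p] by (simp add: w_def)
        with e ne show False by (simp add: complex_eq_iff)
      qed
      with qW ne WR show ?thesis by blast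
    qed
    have val: "unstem \<eta> q = Delta p q ^ m * unstem \<phi> q" if q: "q \<in> U - sphere_of p" for q
    proof -
      let ?z = "qcoord q" let ?I = "qdir q"
      have I: "?I \<in> imag_units" by (rule qdir_unit)
      have z: "?z \<in> ?R" using off[OF q] by blast
      have "\<eta> ?z = qscal (\<delta> ?z) * \<phi> ?z"
        using remove_sings_at_analytic[OF \<xi>an[OF _ z]]
        by (simp add: \<eta>_def qalg_eq_iff co_mult coords_def \<xi>_def)
      then have "unstem \<eta> q = slice_val ?I (qscal (\<delta> ?z)) * unstem \<phi> q"
        unfolding unstem_def using slice_val_qscal_mult[OF I] by simp
      moreover have "Delta p q = slice_val ?I (qscal ((?z - w) * (?z - cnj w)))"
        using Delta_slice_point[OF I, of p "Re ?z" "Im ?z"] unfolding slice_point_qdir w_def by simp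
      then have "Delta p q ^ m = slice_val ?I (qscal (\<delta> ?z))"
        unfolding \<delta>_def using slice_val_qscal_power[OF I] by simp
      ultimately show ?thesis by simp
    qed
    show ?thesis
    proof (intro exI conjI)
      show "p \<in> U" using W(2) by (simp add: U_def unplane_def w_def)
      show "U \<subseteq> \<Omega>" using WO qcoord_in_iff[OF \<Omega>(2)] by (auto simp: U_def unplane_def)
      then show "U - sphere_of p \<subseteq> ?D" using off by (auto simp: unplane_def)
      show "\<forall>q\<in>U - sphere_of p. unstem \<eta> q = Delta p q ^ m * unstem \<phi> q" using val by blast
    qed (fact U reg)+
  qed
  ultimately show ?thesis
    unfolding semiregular_on_def
    using \<Omega> cD open_unplane[OF open_regular_points] by (simp add: open_Int)
qed

text \<open>
  A stem value is determined by its slice values for two opposite imaginary units.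
\<close>

lemma stem_unique:
  assumes "circular D" "stem_symmetric \<phi>" "stem_symmetric \<psi>" "\<And>q. q \<in> D \<Longrightarrow> unstem \<phi> q = unstem \<psi> q" "z \<in> plane D"
  shows "\<phi> z = \<psi> z"
proof -
  have "slice_val I (\<phi> z) = slice_val I (\<psi> z)" if I: "I \<in> imag_units" for I
  proof -
    have "slice_point I (Re z) (Im z) \<in> D" using slice_point_in_iff[OF assms(1) I] assms(5) by simp
    from assms(4)[OF this] show ?thesis
      by (simp add: unstem_slice_point[OF assms(2) I] unstem_slice_point[OF assms(3) I])
  qed
  then show ?thesis using slice_val_eq_iff[OF qI_unit] qI_unit minus_unit by blast
qed

lemma regular_points_of_unstem:
  assumes D: "open D" "circular D" "slice_regular D f" and \<phi>: "stem_symmetric \<phi>" "\<And>q. q \<in> D \<Longrightarrow> f q = unstem \<phi> q"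
  shows "plane D \<subseteq> regular_points \<phi>"
proof
  fix z assume z: "z \<in> plane D"
  obtain \<psi> where \<psi>: "stem_symmetric \<psi>" "\<And>q. q \<in> D \<Longrightarrow> f q = unstem \<psi> q"
    "\<And>z i. z \<in> plane D \<Longrightarrow> i \<in> {co0, co1, co2, co3} \<Longrightarrow> (\<lambda>z. i (\<psi> z)) field_differentiable at z"
    by (rule slice_regular_stem[OF D], rule that)
  have eq: "\<phi> w = \<psi> w" if "w \<in> plane D" for w
    by (rule stem_unique[OF D(2) \<phi>(1) \<psi>(1) _ that]) (simp flip: \<phi>(2) \<psi>(2))
  have "(\<lambda>z. i (\<phi> z)) holomorphic_on plane D" if "i \<in> coords" for i
  proof -
    have "(\<lambda>z. i (\<psi> z)) holomorphic_on plane D"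
      unfolding holomorphic_on_def using \<psi>(3) that field_differentiable_at_within unfolding coords_def by blast
    then show ?thesis by (rule holomorphic_transform) (simp add: eq)
  qed
  then show "z \<in> regular_points \<phi>"
    unfolding regular_points_def analytic_at using open_plane[OF D(1)] z by blast
qed

text \<open>
  Conversely to \<open>semiregular_unstem\<close>: near a point of \<open>\<Omega>\<close>, the product \<open>Delta p ^ m * f\<close> has a holomorphic stem, and the
  stem of \<open>f\<close> is the quotient of this stem by \<open>((z - w) (z - cnj w)) ^ m\<close>.
\<close>

lemma semiregular_stem:
  assumes \<Omega>: "circular \<Omega>" and f: "semiregular_on \<Omega> D f"
  obtains \<phi> where "meromorphic_stem \<Omega> \<phi>" "\<And>q. q \<in> D \<Longrightarrow> f q = unstem \<phi> q"
proof -
  have D: "open D" "circular D" "slice_regular D f" "D \<subseteq> \<Omega>"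
    using f unfolding semiregular_on_def by auto
  obtain \<phi> where \<phi>: "stem_symmetric \<phi>" "\<And>q. q \<in> D \<Longrightarrow> f q = unstem \<phi> q"
    by (rule slice_regular_stem[OF D(1-3)], rule that)
  have "(\<lambda>z. i (\<phi> z)) meromorphic_on {z}" if z: "z \<in> plane \<Omega>" and i: "i \<in> coords" for z i
  proof -
    let ?p = "slice_point qI (Re z) (Im z)"
    have p: "?p \<in> \<Omega>" using z by (simp add: plane_def)
    obtain U m h where U: "?p \<in> U" "U \<subseteq> \<Omega>" "open U" "circular U" "U - sphere_of ?p \<subseteq> D"
      "slice_regular U h" "\<forall>q\<in>U - sphere_of ?p. h q = Delta ?p q ^ m * f q"
      by (rule semiregular_local[OF f p])
    obtain \<eta> where \<eta>: "stem_symmetric \<eta>" "\<And>q. q \<in> U \<Longrightarrow> h q = unstem \<eta> q"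
      by (rule slice_regular_stem[OF U(3,4,6)], rule that)
    have zU: "z \<in> plane U" using U(1) by (simp add: plane_def)
    have "z \<in> regular_points \<eta>"
      using regular_points_of_unstem[OF U(3,4,6) \<eta>] zU by blast
    then have an: "(\<lambda>z. i (\<eta> z)) analytic_on {z}" using i by (simp add: regular_points_def)
    let ?c = "qcoord ?p" let ?d = "\<lambda>w. ((w - ?c) * (w - cnj ?c)) ^ m"
    have c: "?c = z \<and> cnj ?c = cnj z \<or> ?c = cnj z \<and> cnj ?c = z"
      by (auto simp: qcoord_slice_point qI_unit complex_eq_iff abs_if)
    have rel: "i (\<phi> w) = i (\<eta> w) / ?d w" if w: "w \<in> plane U" "w \<noteq> z" "w \<noteq> cnj z" for w
    proof -
      have "slice_val I (\<eta> w) = slice_val I (qscal (?d w) * \<phi> w)" if I: "I \<in> imag_units" for I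
      proof -
        let ?q = "slice_point I (Re w) (Im w)"
        have qU: "?q \<in> U" using slice_point_in_iff[OF U(4) I] w(1) by simp
        have "?q \<notin> sphere_of ?p"
        proof
          assume "?q \<in> sphere_of ?p"
          then have "Re w = Re z" "\<bar>Im w\<bar> = \<bar>Im z\<bar>"
            unfolding sphere_of_iff by (simp_all add: qcoord_slice_point qI_unit I)
          then have "w = z \<or> w = cnj z" by (auto simp: complex_eq_iff abs_eq_iff)
          with w show False by blast
        qed
        then have "h ?q = Delta ?p ?q ^ m * f ?q" "?q \<in> D" using U(5,7) qU by auto
        then have "unstem \<eta> ?q = Delta ?p ?q ^ m * unstem \<phi> ?q"
          using \<eta>(2)[OF qU] \<phi>(2) by simp
        then show ?thesis
          unfolding unstem_slice_point[OF \<eta>(1) I] unstem_slice_point[OF \<phi>(1) I]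
            Delta_slice_point[OF I] slice_val_qscal_power[OF I] slice_val_qscal_mult[OF I] by simp
      qed
      then have "\<eta> w = qscal (?d w) * \<phi> w"
        using slice_val_eq_iff[OF qI_unit] qI_unit minus_unit by blast
      then have "i (\<eta> w) = ?d w * i (\<phi> w)" using i by (auto simp: coords_def co_mult)
      moreover have "?d w \<noteq> 0" using c w by auto
      ultimately show ?thesis by (simp add: field_simps)
    qed
    have "eventually (\<lambda>w. w \<in> plane U) (at z)"
      using eventually_nhds_in_open[OF open_plane[OF U(3)] zU] by (simp add: eventually_at_filter eventually_mono)
    moreover note eventually_off_pair[of z]
    ultimately have "eventually (\<lambda>w. i (\<phi> w) = i (\<eta> w) / ?d w) (at z)"
      by eventually_elim (simp add: rel)
    moreover have "(\<lambda>w. i (\<eta> w) / ?d w) meromorphic_on {z}"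
      by (intro meromorphic_intros analytic_on_imp_meromorphic_on an)
    ultimately show ?thesis
      using meromorphic_on_cong[of "{z}" "\<lambda>w. i (\<phi> w)" "\<lambda>w. i (\<eta> w) / ?d w" "{z}"] by blast
  qed
  then have "meromorphic_stem \<Omega> \<phi>"
    unfolding meromorphic_stem_def using \<phi>(1) meromorphic_on_meromorphic_at by blast
  then show ?thesis using \<phi>(2) by (rule that)
qed


section \<open>The algebra of semi-regular functions as a quaternion algebra of Laurent series\<close>

text \<open>
  The last assumption is the identity theorem for the base point \<open>z0\<close>: a symmetric meromorphic function is determined by
  its germ at \<open>z0\<close>. On a product domain the planar section has two components, and it is the symmetry that carries the
  vanishing from one to the other.
\<close>

locale circular_base =
  fixes \<Omega> :: "quat set" and z0 :: complex
  assumes open_dom: "open \<Omega>" and circ: "circular \<Omega>" and z0: "z0 \<in> plane \<Omega>"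
    and identity: "\<And>u z. conj_sym u \<Longrightarrow> u meromorphic_on plane \<Omega> \<Longrightarrow> eventually (\<lambda>w. u w = 0) (at z0) \<Longrightarrow>
      z \<in> plane \<Omega> \<Longrightarrow> eventually (\<lambda>w. u w = 0) (at z)"
begin

definition expansion :: "(complex \<Rightarrow> complex) \<Rightarrow> complex fls" where
  "expansion u = laurent_expansion u z0"

lemma expansion_expansion:
  assumes "u meromorphic_on plane \<Omega>"
  shows "(\<lambda>w. u (z0 + w)) has_laurent_expansion expansion u"
  unfolding expansion_def using meromorphic_on_imp_has_laurent_expansion[OF assms z0] .

lemma expansion_simps:
  assumes "u meromorphic_on plane \<Omega>" "v meromorphic_on plane \<Omega>"
  shows "expansion (\<lambda>z. u z + v z) = expansion u + expansion v" "expansion (\<lambda>z. u z - v z) = expansion u - expansion v" "expansion (\<lambda>z. - u z) = - expansion u"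
    "expansion (\<lambda>z. u z * v z) = expansion u * expansion v" "expansion (\<lambda>z. inverse (u z)) = inverse (expansion u)"
  by (subst expansion_def, rule laurent_expansion_eqI,
      intro laurent_expansion_intros expansion_expansion assms)+

lemma expansion_const: "expansion (\<lambda>_. c) = fls_const c"
  unfolding expansion_def by (rule laurent_expansion_eqI) simp

lemma expansion_eq_iff:
  assumes "u meromorphic_on plane \<Omega>" "v meromorphic_on plane \<Omega>"
  shows "expansion u = expansion v \<longleftrightarrow> eventually (\<lambda>z. u z = v z) (at z0)"
proof
  assume "expansion u = expansion v"
  then have "eventually (\<lambda>w. eval_fls (expansion u) w = u (z0 + w)) (at 0)" "eventually (\<lambda>w. eval_fls (expansion u) w = v (z0 + w)) (at 0)"
    using expansion_expansion[OF assms(1)] expansion_expansion[OF assms(2)] by (simp_all add: has_laurent_expansion_def)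
  then have "eventually (\<lambda>w. u (z0 + w) = v (z0 + w)) (at 0)" by eventually_elim simp
  then show "eventually (\<lambda>z. u z = v z) (at z0)"
    by (subst eventually_at_to_0) (simp add: add.commute)
next
  assume "eventually (\<lambda>z. u z = v z) (at z0)"
  then show "expansion u = expansion v" unfolding expansion_def by (rule laurent_expansion_cong) simp
qed

text \<open>
  The field of symmetric meromorphic functions on the planar section. It is realized by expansions at \<open>z0\<close> because
  functions that differ at isolated points have to be identified, and because it then lies inside a field type over which
  the results on quaternion algebras apply.
\<close>

definition F :: "complex fls set" where
  "F = {expansion u | u. conj_sym u \<and> u meromorphic_on plane \<Omega>}"

lemma F_I: "conj_sym u \<Longrightarrow> u meromorphic_on plane \<Omega> \<Longrightarrow> expansion u \<in> F"
  unfolding F_def by blast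

sublocale subfield_set F
proof
  show "0 \<in> F" using F_I[OF conj_sym_intros(1)[of 0] meromorphic_on_const] by (simp add: expansion_const)
  show "1 \<in> F" using F_I[OF conj_sym_intros(1)[of 1] meromorphic_on_const] by (simp add: expansion_const)
  fix x y assume "x \<in> F" "y \<in> F"
  then obtain u v where uv: "conj_sym u" "u meromorphic_on plane \<Omega>" "x = expansion u" "conj_sym v" "v meromorphic_on plane \<Omega>" "y = expansion v"
    unfolding F_def by blast
  show "x + y \<in> F" unfolding uv(3,6) expansion_simps(1)[OF uv(2,5), symmetric]
    by (intro F_I conj_sym_intros meromorphic_intros uv)
  show "x * y \<in> F" unfolding uv(3,6) expansion_simps(4)[OF uv(2,5), symmetric]
    by (intro F_I conj_sym_intros meromorphic_intros uv)
next
  fix x assume "x \<in> F"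
  then obtain u where uv: "conj_sym u" "u meromorphic_on plane \<Omega>" "x = expansion u"
    unfolding F_def by blast
  show "- x \<in> F" unfolding uv(3) expansion_simps(3)[OF uv(2) uv(2), symmetric]
    by (intro F_I conj_sym_intros meromorphic_intros uv)
  show "inverse x \<in> F" unfolding uv(3) expansion_simps(5)[OF uv(2) uv(2), symmetric]
    by (intro F_I conj_sym_intros meromorphic_intros uv)
qed

definition laurent :: "(complex \<Rightarrow> complex qalg) \<Rightarrow> complex fls qalg" where
  "laurent \<phi> = QA (expansion (\<lambda>z. co0 (\<phi> z))) (expansion (\<lambda>z. co1 (\<phi> z))) (expansion (\<lambda>z. co2 (\<phi> z))) (expansion (\<lambda>z. co3 (\<phi> z)))"

lemma co_laurent [simp]:
  "co0 (laurent \<phi>) = expansion (\<lambda>z. co0 (\<phi> z))" "co1 (laurent \<phi>) = expansion (\<lambda>z. co1 (\<phi> z))"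
  "co2 (laurent \<phi>) = expansion (\<lambda>z. co2 (\<phi> z))" "co3 (laurent \<phi>) = expansion (\<lambda>z. co3 (\<phi> z))"
  by (simp_all add: laurent_def)

abbreviation "mstem \<equiv> meromorphic_stem \<Omega>"

lemma mstem_mero:
  assumes "mstem \<phi>"
  shows "(\<lambda>z. co0 (\<phi> z)) meromorphic_on plane \<Omega>" "(\<lambda>z. co1 (\<phi> z)) meromorphic_on plane \<Omega>"
    "(\<lambda>z. co2 (\<phi> z)) meromorphic_on plane \<Omega>" "(\<lambda>z. co3 (\<phi> z)) meromorphic_on plane \<Omega>"
  using assms by (auto simp: meromorphic_stem_def coords_def)

lemma mstem_conj_sym:
  assumes "mstem \<phi>"
  shows "conj_sym (\<lambda>z. co0 (\<phi> z))" "conj_sym (\<lambda>z. co1 (\<phi> z))" "conj_sym (\<lambda>z. co2 (\<phi> z))" "conj_sym (\<lambda>z. co3 (\<phi> z))"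
  using assms by (auto simp: meromorphic_stem_def stem_symmetric_iff coords_def)

lemma mstem_I:
  assumes "conj_sym (\<lambda>z. co0 (\<phi> z))" "conj_sym (\<lambda>z. co1 (\<phi> z))" "conj_sym (\<lambda>z. co2 (\<phi> z))" "conj_sym (\<lambda>z. co3 (\<phi> z))"
    "(\<lambda>z. co0 (\<phi> z)) meromorphic_on plane \<Omega>" "(\<lambda>z. co1 (\<phi> z)) meromorphic_on plane \<Omega>"
    "(\<lambda>z. co2 (\<phi> z)) meromorphic_on plane \<Omega>" "(\<lambda>z. co3 (\<phi> z)) meromorphic_on plane \<Omega>"
  shows "mstem \<phi>"
  using assms by (auto simp: meromorphic_stem_def stem_symmetric_iff coords_def)

lemma mstem_add:
  assumes "mstem \<phi>" "mstem \<psi>"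
  shows "mstem (\<lambda>z. \<phi> z + \<psi> z)"
  by (rule mstem_I; simp only: co_simps; intro conj_sym_intros meromorphic_intros mstem_conj_sym mstem_mero assms)

lemma mstem_mult:
  assumes "mstem \<phi>" "mstem \<psi>"
  shows "mstem (\<lambda>z. \<phi> z * \<psi> z)"
  by (rule mstem_I; simp only: co_mult; intro conj_sym_intros meromorphic_intros mstem_conj_sym mstem_mero assms)

lemma mstem_const: "mstem (\<lambda>_. of_parts c 0)"
proof (rule mstem_I)
qed (auto simp: of_parts_def conj_sym_def complex_eq_iff intro!: meromorphic_intros)

lemma laurent_add:
  assumes "mstem \<phi>" "mstem \<psi>"
  shows "laurent (\<lambda>z. \<phi> z + \<psi> z) = laurent \<phi> + laurent \<psi>"
  by (simp add: qalg_eq_iff expansion_simps mstem_mero assms)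

lemma laurent_mult:
  assumes "mstem \<phi>" "mstem \<psi>"
  shows "laurent (\<lambda>z. \<phi> z * \<psi> z) = laurent \<phi> * laurent \<psi>"
  by (simp add: qalg_eq_iff co_mult expansion_simps meromorphic_on_mult meromorphic_on_add meromorphic_on_diff mstem_mero assms)

lemma laurent_const: "laurent (\<lambda>_. of_parts c 0) = QA (fls_const (of_real (qre c))) (fls_const (of_real (qi c)))
    (fls_const (of_real (qj c))) (fls_const (of_real (qk c)))"
  by (simp add: laurent_def of_parts_def expansion_const Complex_eq)

lemma laurent_QF: "mstem \<phi> \<Longrightarrow> laurent \<phi> \<in> QF"
  by (auto simp: QF_def intro!: F_I mstem_conj_sym mstem_mero)

lemma QF_laurent:
  assumes "q \<in> QF"
  obtains \<phi> where "mstem \<phi>" "laurent \<phi> = q"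
proof -
  have "\<exists>u. conj_sym u \<and> u meromorphic_on plane \<Omega> \<and> x = expansion u" if "x \<in> F" for x
    using that unfolding F_def by blast
  then have "\<forall>x\<in>F. \<exists>u. conj_sym u \<and> u meromorphic_on plane \<Omega> \<and> x = expansion u" by blast
  from bchoice[OF this] obtain u where u: "\<forall>x\<in>F. conj_sym (u x) \<and> u x meromorphic_on plane \<Omega> \<and> x = expansion (u x)" ..
  define \<phi> where "\<phi> z = QA (u (co0 q) z) (u (co1 q) z) (u (co2 q) z) (u (co3 q) z)" for z
  note q = QF_D[OF assms]
  have "mstem \<phi>"
    using bspec[OF u q(1)] bspec[OF u q(2)] bspec[OF u q(3)] bspec[OF u q(4)]
    by (intro mstem_I) (simp_all only: \<phi>_def qalg.sel)
  moreover have "laurent \<phi> = q"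
    using bspec[OF u q(1)] bspec[OF u q(2)] bspec[OF u q(3)] bspec[OF u q(4)]
    unfolding qalg_eq_iff co_laurent \<phi>_def qalg.sel by (elim conjE) (intro conjI; rule sym; assumption)
  ultimately show ?thesis by (rule that)
qed

lemma laurent_eq_iff:
  assumes "mstem \<phi>" "mstem \<psi>"
  shows "laurent \<phi> = laurent \<psi> \<longleftrightarrow> eventually (\<lambda>z. \<phi> z = \<psi> z) (at z0)"
  by (simp add: qalg_eq_iff expansion_eq_iff mstem_mero assms eventually_conj_iff)

text \<open>
  The values of \<open>f\<close> at its singularities are arbitrary, so the stem represents \<open>f\<close> only on some domain of regularity.
\<close>

definition has_stem :: "(quat \<Rightarrow> quat) \<Rightarrow> (complex \<Rightarrow> complex qalg) \<Rightarrow> bool" where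
  "has_stem f \<phi> \<longleftrightarrow> mstem \<phi> \<and> (\<exists>D. semiregular_on \<Omega> D f \<and> (\<forall>q\<in>D. f q = unstem \<phi> q))"

lemma has_stem_mstem: "has_stem f \<phi> \<Longrightarrow> mstem \<phi>"
  by (simp add: has_stem_def)

lemma has_stem_exists: "semiregular_on \<Omega> D f \<Longrightarrow> \<exists>\<phi>. has_stem f \<phi>"
proof -
  assume f: "semiregular_on \<Omega> D f"
  obtain \<phi> where "mstem \<phi>" "\<And>q. q \<in> D \<Longrightarrow> f q = unstem \<phi> q"
    by (rule semiregular_stem[OF circ f], rule that)
  with f show ?thesis unfolding has_stem_def by blast
qed

lemma has_stem_unstem: "mstem \<phi> \<Longrightarrow> has_stem (unstem \<phi>) \<phi>"
  unfolding has_stem_def using semiregular_unstem[OF open_dom circ] by blast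

lemma semiregular_D: "semiregular_on \<Omega> D f \<Longrightarrow> open D \<and> circular D \<and> slice_regular D f \<and> D \<subseteq> \<Omega>"
  by (simp add: semiregular_on_def)

text \<open>
  If \<open>f\<close> and \<open>g\<close> agree on common domains of regularity, the stems agree near \<open>z0\<close>, since singularities are isolated.
  Conversely the identity theorem spreads agreement near \<open>z0\<close> to punctured neighbourhoods of all points, and continuity
  fills in the points at which both functions are regular.
\<close>

lemma SEM_rel_iff:
  assumes f: "has_stem f \<phi>" and g: "has_stem g \<psi>"
  shows "(f, g) \<in> SEM_rel \<Omega> \<longleftrightarrow> laurent \<phi> = laurent \<psi>"
proof -
  obtain D1 where D1: "semiregular_on \<Omega> D1 f" "\<forall>q\<in>D1. f q = unstem \<phi> q" and \<phi>: "mstem \<phi>" using f by (auto simp: has_stem_def)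
  obtain E1 where E1: "semiregular_on \<Omega> E1 g" "\<forall>q\<in>E1. g q = unstem \<psi> q" and \<psi>: "mstem \<psi>" using g by (auto simp: has_stem_def)
  have sym: "stem_symmetric \<phi>" "stem_symmetric \<psi>" using \<phi> \<psi> by (simp_all add: meromorphic_stem_def)
  show ?thesis
  proof
    assume "(f, g) \<in> SEM_rel \<Omega>"
    then obtain D E where D: "semiregular_on \<Omega> D f" and E: "semiregular_on \<Omega> E g" and fg: "\<forall>q\<in>D \<inter> E. f q = g q"
      unfolding SEM_rel_def by auto
    let ?G = "D \<inter> E \<inter> D1 \<inter> E1"
    have G: "semiregular_on \<Omega> ?G f"
      by (rule semiregular_on_Int[OF semiregular_on_Int[OF semiregular_on_Int[OF D E] D1(1)] E1(1)])
    then have cG: "circular ?G" using semiregular_D by blast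
    have "unstem \<phi> q = unstem \<psi> q" if "q \<in> ?G" for q
    proof -
      have "f q = unstem \<phi> q" "g q = unstem \<psi> q" "f q = g q" using that fg D1(2) E1(2) by blast+
      then show ?thesis by simp
    qed
    from stem_unique[OF cG sym this] have "\<phi> z = \<psi> z" if "z \<in> plane ?G" for z using that by blast
    then have "eventually (\<lambda>z. \<phi> z = \<psi> z) (at z0)"
      using semiregular_eventually[OF G circ z0] by (rule eventually_mono[rotated])
    then show "laurent \<phi> = laurent \<psi>" using laurent_eq_iff[OF \<phi> \<psi>] by blast
  next
    assume "laurent \<phi> = laurent \<psi>"
    then have ev0: "eventually (\<lambda>z. \<phi> z = \<psi> z) (at z0)" using laurent_eq_iff[OF \<phi> \<psi>] by blast
    have "f q = g q" if q: "q \<in> D1 \<inter> E1" for q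
    proof -
      let ?z = "qcoord q"
      have z: "?z \<in> plane D1" "?z \<in> plane E1" "?z \<in> plane \<Omega>"
        using q semiregular_D[OF D1(1)] semiregular_D[OF E1(1)] qcoord_in_iff circ by auto
      have "i (\<phi> ?z) = i (\<psi> ?z)" if i: "i \<in> coords" for i
      proof -
        have "eventually (\<lambda>z. i (\<phi> z) - i (\<psi> z) = 0) (at z0)" using ev0 by eventually_elim simp
        moreover have "conj_sym (\<lambda>z. i (\<phi> z) - i (\<psi> z))"
          by (intro conj_sym_intros stem_conj_sym[OF sym(1) i] stem_conj_sym[OF sym(2) i])
        moreover have "(\<lambda>z. i (\<phi> z) - i (\<psi> z)) meromorphic_on plane \<Omega>"
          using \<phi> \<psi> i by (intro meromorphic_intros) (auto simp: meromorphic_stem_def)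
        ultimately have "eventually (\<lambda>z. i (\<phi> z) - i (\<psi> z) = 0) (at ?z)" using identity z(3) by blast
        then have e: "eventually (\<lambda>z. i (\<phi> z) = i (\<psi> z)) (at ?z)" by simp
        have "(\<lambda>z. i (\<phi> z)) analytic_on {?z}"
          using regular_points_of_unstem[OF _ _ _ sym(1), of D1 f] semiregular_D[OF D1(1)] D1(2) z(1) i
          by (auto simp: regular_points_def)
        then have l1: "((\<lambda>z. i (\<phi> z)) \<longlongrightarrow> i (\<phi> ?z)) (at ?z)"
          by (intro isContD analytic_at_imp_isCont)
        have "(\<lambda>z. i (\<psi> z)) analytic_on {?z}"
          using regular_points_of_unstem[OF _ _ _ sym(2), of E1 g] semiregular_D[OF E1(1)] E1(2) z(2) i
          by (auto simp: regular_points_def)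
        then have "((\<lambda>z. i (\<psi> z)) \<longlongrightarrow> i (\<psi> ?z)) (at ?z)"
          by (intro isContD analytic_at_imp_isCont)
        then have "((\<lambda>z. i (\<phi> z)) \<longlongrightarrow> i (\<psi> ?z)) (at ?z)"
          using e by (subst tendsto_cong)
        then show ?thesis using l1 by (intro tendsto_unique[of "at ?z"]) simp_all
      qed
      then have "\<phi> ?z = \<psi> ?z" using qalg_eq_coords by blast
      then show ?thesis using q D1(2) E1(2) by (simp add: unstem_def)
    qed
    then show "(f, g) \<in> SEM_rel \<Omega>" unfolding SEM_rel_def using D1(1) E1(1) by blast
  qed
qed

lemma has_stem_add:
  assumes f: "has_stem f \<phi>" and g: "has_stem g \<psi>"
  shows "has_stem (\<lambda>q. f q + g q) (\<lambda>z. \<phi> z + \<psi> z)"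
proof -
  obtain D where D: "semiregular_on \<Omega> D f" "\<forall>q\<in>D. f q = unstem \<phi> q" and \<phi>: "mstem \<phi>" using f by (auto simp: has_stem_def)
  obtain E where E: "semiregular_on \<Omega> E g" "\<forall>q\<in>E. g q = unstem \<psi> q" and \<psi>: "mstem \<psi>" using g by (auto simp: has_stem_def)
  have m: "mstem (\<lambda>z. \<phi> z + \<psi> z)" using \<phi> \<psi> by (rule mstem_add)
  from semiregular_unstem[OF open_dom circ m] obtain H where H: "semiregular_on \<Omega> H (unstem (\<lambda>z. \<phi> z + \<psi> z))" by blast
  have "semiregular_on \<Omega> (H \<inter> D \<inter> E) (unstem (\<lambda>z. \<phi> z + \<psi> z))"
    by (rule semiregular_on_Int[OF semiregular_on_Int[OF H D(1)] E(1)])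
  moreover have eq: "\<forall>q\<in>H \<inter> D \<inter> E. f q + g q = unstem (\<lambda>z. \<phi> z + \<psi> z) q" using D(2) E(2) by (simp add: unstem_add)
  ultimately have "semiregular_on \<Omega> (H \<inter> D \<inter> E) (\<lambda>q. f q + g q)" by (rule semiregular_on_cong)
  with eq m show ?thesis unfolding has_stem_def by blast
qed

lemma has_stem_star:
  assumes f: "has_stem f \<phi>" and g: "has_stem g \<psi>"
  shows "has_stem (star f g) (\<lambda>z. \<phi> z * \<psi> z)"
proof -
  obtain D where D: "semiregular_on \<Omega> D f" "\<forall>q\<in>D. f q = unstem \<phi> q" and \<phi>: "mstem \<phi>" using f by (auto simp: has_stem_def)
  obtain E where E: "semiregular_on \<Omega> E g" "\<forall>q\<in>E. g q = unstem \<psi> q" and \<psi>: "mstem \<psi>" using g by (auto simp: has_stem_def)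
  have sym: "stem_symmetric \<phi>" "stem_symmetric \<psi>" using \<phi> \<psi> by (simp_all add: meromorphic_stem_def)
  have m: "mstem (\<lambda>z. \<phi> z * \<psi> z)" using \<phi> \<psi> by (rule mstem_mult)
  from semiregular_unstem[OF open_dom circ m] obtain H where H: "semiregular_on \<Omega> H (unstem (\<lambda>z. \<phi> z * \<psi> z))" by blast
  have "semiregular_on \<Omega> (H \<inter> D \<inter> E) (unstem (\<lambda>z. \<phi> z * \<psi> z))"
    by (rule semiregular_on_Int[OF semiregular_on_Int[OF H D(1)] E(1)])
  moreover have eq: "\<forall>q\<in>H \<inter> D \<inter> E. star f g q = unstem (\<lambda>z. \<phi> z * \<psi> z) q"
  proof
    fix q assume q: "q \<in> H \<inter> D \<inter> E"
    then have fq: "f q = unstem \<phi> q" using D(2) by blast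
    have "g (inverse (f q) * q * f q) = unstem \<psi> (inverse (f q) * q * f q)" if "f q \<noteq> 0"
    proof -
      have "qcoord (inverse (f q) * q * f q) = qcoord q" using that by (rule qcoord_conjugate)
      then have "inverse (f q) * q * f q \<in> E" using q semiregular_D[OF E(1)] circularD by blast
      then show ?thesis using E(2) by blast
    qed
    then have "star f g q = star (unstem \<phi>) (unstem \<psi>) q" unfolding star_def fq by auto
    then show "star f g q = unstem (\<lambda>z. \<phi> z * \<psi> z) q" using unstem_star[OF sym] by simp
  qed
  ultimately have "semiregular_on \<Omega> (H \<inter> D \<inter> E) (star f g)" by (rule semiregular_on_cong)
  with eq m show ?thesis unfolding has_stem_def by blast
qed

lemma has_stem_const: "has_stem (\<lambda>_. c) (\<lambda>_. of_parts c 0)"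
proof -
  have "unstem (\<lambda>_. of_parts c 0) = (\<lambda>_. c)" by (simp add: unstem_def slice_val_def fun_eq_iff)
  with has_stem_unstem[OF mstem_const[of c]] show ?thesis by simp
qed

lemma class_eq: "has_stem f \<phi> \<Longrightarrow> SEM_class \<Omega> f = {g. \<exists>\<psi>. has_stem g \<psi> \<and> laurent \<psi> = laurent \<phi>}"
proof (intro Set.set_eqI iffI)
  fix g assume f: "has_stem f \<phi>" and g: "g \<in> SEM_class \<Omega> f"
  then have fg: "(f, g) \<in> SEM_rel \<Omega>" by (simp add: SEM_class_def)
  then obtain E where "semiregular_on \<Omega> E g" unfolding SEM_rel_def by blast
  then obtain \<psi> where "has_stem g \<psi>" using has_stem_exists by blast
  with fg SEM_rel_iff[OF f this] show "g \<in> {g. \<exists>\<psi>. has_stem g \<psi> \<and> laurent \<psi> = laurent \<phi>}" by auto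
next
  fix g assume f: "has_stem f \<phi>" and g: "g \<in> {g. \<exists>\<psi>. has_stem g \<psi> \<and> laurent \<psi> = laurent \<phi>}"
  then obtain \<psi> where "has_stem g \<psi>" "laurent \<psi> = laurent \<phi>" by blast
  then show "g \<in> SEM_class \<Omega> f" using SEM_rel_iff[OF f] by (simp add: SEM_class_def)
qed

lemma class_eq_iff: "has_stem f \<phi> \<Longrightarrow> has_stem g \<psi> \<Longrightarrow> SEM_class \<Omega> f = SEM_class \<Omega> g \<longleftrightarrow> laurent \<phi> = laurent \<psi>"
proof
  assume f: "has_stem f \<phi>" and g: "has_stem g \<psi>" and "SEM_class \<Omega> f = SEM_class \<Omega> g"
  then have "g \<in> SEM_class \<Omega> f" using class_eq[OF g] by auto
  then show "laurent \<phi> = laurent \<psi>" using SEM_rel_iff[OF f g] by (simp add: SEM_class_def)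
qed (simp add: class_eq)

definition \<Psi> :: "(quat \<Rightarrow> quat) set \<Rightarrow> complex fls qalg" where
  "\<Psi> A = (THE X. \<exists>f \<phi>. has_stem f \<phi> \<and> A = SEM_class \<Omega> f \<and> X = laurent \<phi>)"

lemma Psi_class: "has_stem f \<phi> \<Longrightarrow> \<Psi> (SEM_class \<Omega> f) = laurent \<phi>"
proof -
  assume f: "has_stem f \<phi>"
  show ?thesis
    unfolding \<Psi>_def
  proof (rule the_equality)
    show "\<exists>g \<psi>. has_stem g \<psi> \<and> SEM_class \<Omega> f = SEM_class \<Omega> g \<and> laurent \<phi> = laurent \<psi>" using f by blast
    fix X assume "\<exists>g \<psi>. has_stem g \<psi> \<and> SEM_class \<Omega> f = SEM_class \<Omega> g \<and> X = laurent \<psi>"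
    then obtain g \<psi> where g: "has_stem g \<psi>" "SEM_class \<Omega> f = SEM_class \<Omega> g" "X = laurent \<psi>" by blast
    then show "X = laurent \<phi>" using class_eq_iff[OF f g(1)] by simp
  qed
qed

lemma carrier_SEM: "A \<in> carrier (SEM \<Omega>) \<longleftrightarrow> (\<exists>f \<phi>. has_stem f \<phi> \<and> A = SEM_class \<Omega> f)"
proof
  assume "A \<in> carrier (SEM \<Omega>)"
  then obtain f D where "semiregular_on \<Omega> D f" "A = SEM_class \<Omega> f"
    by (auto simp: SEM_def quotient_def SEM_class_def)
  then show "\<exists>f \<phi>. has_stem f \<phi> \<and> A = SEM_class \<Omega> f" using has_stem_exists by blast
next
  assume "\<exists>f \<phi>. has_stem f \<phi> \<and> A = SEM_class \<Omega> f"
  then show "A \<in> carrier (SEM \<Omega>)"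
    by (auto simp: SEM_def quotient_def SEM_class_def has_stem_def)
qed

lemma UN_UN_const:
  assumes "\<And>x y. x \<in> A \<Longrightarrow> y \<in> B \<Longrightarrow> h x y = c" "a \<in> A" "b \<in> B"
  shows "(\<Union>x\<in>A. \<Union>y\<in>B. h x y) = c"
proof -
  have "(\<Union>y\<in>B. h x y) = c" if "x \<in> A" for x using assms(1)[OF that] assms(3) by auto
  then show ?thesis using assms(2) by auto
qed

lemma class_mult:
  assumes "has_stem f \<phi>" "has_stem g \<psi>"
  shows "SEM_class \<Omega> f \<otimes>\<^bsub>SEM \<Omega>\<^esub> SEM_class \<Omega> g = SEM_class \<Omega> (star f g)"
proof -
  have "SEM_class \<Omega> (star f' g') = SEM_class \<Omega> (star f g)"
    if fg': "f' \<in> SEM_class \<Omega> f" "g' \<in> SEM_class \<Omega> g" for f' g'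
  proof -
    obtain \<phi>' \<psi>' where "has_stem f' \<phi>'" "laurent \<phi>' = laurent \<phi>" "has_stem g' \<psi>'" "laurent \<psi>' = laurent \<psi>"
      using fg' unfolding class_eq[OF assms(1)] class_eq[OF assms(2)] by blast
    then show ?thesis
      using class_eq_iff[OF has_stem_star has_stem_star] laurent_mult assms by (simp add: has_stem_mstem)
  qed
  moreover have "f \<in> SEM_class \<Omega> f" "g \<in> SEM_class \<Omega> g"
    unfolding class_eq[OF assms(1)] class_eq[OF assms(2)] using assms by blast+
  ultimately show ?thesis unfolding SEM_def monoid.simps ring.simps by (rule UN_UN_const)
qed

lemma class_add:
  assumes "has_stem f \<phi>" "has_stem g \<psi>"
  shows "SEM_class \<Omega> f \<oplus>\<^bsub>SEM \<Omega>\<^esub> SEM_class \<Omega> g = SEM_class \<Omega> (\<lambda>q. f q + g q)"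
proof -
  have "SEM_class \<Omega> (\<lambda>q. f' q + g' q) = SEM_class \<Omega> (\<lambda>q. f q + g q)"
    if fg': "f' \<in> SEM_class \<Omega> f" "g' \<in> SEM_class \<Omega> g" for f' g'
  proof -
    obtain \<phi>' \<psi>' where "has_stem f' \<phi>'" "laurent \<phi>' = laurent \<phi>" "has_stem g' \<psi>'" "laurent \<psi>' = laurent \<psi>"
      using fg' unfolding class_eq[OF assms(1)] class_eq[OF assms(2)] by blast
    then show ?thesis
      using class_eq_iff[OF has_stem_add has_stem_add] laurent_add assms by (simp add: has_stem_mstem)
  qed
  moreover have "f \<in> SEM_class \<Omega> f" "g \<in> SEM_class \<Omega> g"
    unfolding class_eq[OF assms(1)] class_eq[OF assms(2)] using assms by blast+
  ultimately show ?thesis unfolding SEM_def monoid.simps ring.simps by (rule UN_UN_const)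
qed

lemma SEM_const_carrier: "SEM_const \<Omega> c \<in> carrier (SEM \<Omega>)"
  unfolding SEM_const_def carrier_SEM using has_stem_const by blast

lemma Psi_const: "\<Psi> (SEM_const \<Omega> c) = QA (fls_const (of_real (qre c))) (fls_const (of_real (qi c)))
    (fls_const (of_real (qj c))) (fls_const (of_real (qk c)))"
  unfolding SEM_const_def Psi_class[OF has_stem_const] laurent_const ..

lemma zero_one_SEM: "\<zero>\<^bsub>SEM \<Omega>\<^esub> = SEM_const \<Omega> 0" "\<one>\<^bsub>SEM \<Omega>\<^esub> = SEM_const \<Omega> 1"
  by (simp_all add: SEM_def SEM_const_def)

text \<open>
  Surjectivity onto the quaternions with coordinates in \<open>F\<close> is \<open>semiregular_unstem\<close>, injectivity is \<open>SEM_rel_iff\<close>, and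
  compatibility with the products is \<open>unstem_star\<close>.
\<close>

sublocale Q: quat_model F "SEM \<Omega>" \<Psi>
proof
  show "bij_betw \<Psi> (carrier (SEM \<Omega>)) QF"
  proof (rule bij_betw_imageI)
    show "inj_on \<Psi> (carrier (SEM \<Omega>))"
    proof (rule inj_onI)
      fix A B assume "A \<in> carrier (SEM \<Omega>)" "B \<in> carrier (SEM \<Omega>)" "\<Psi> A = \<Psi> B"
      then obtain f \<phi> g \<psi> where fg: "has_stem f \<phi>" "A = SEM_class \<Omega> f" "has_stem g \<psi>" "B = SEM_class \<Omega> g" "\<Psi> A = \<Psi> B"
        unfolding carrier_SEM by blast
      then have "laurent \<phi> = laurent \<psi>" using Psi_class[OF fg(1)] Psi_class[OF fg(3)] by simp
      then show "A = B" unfolding fg(2,4) using class_eq_iff[OF fg(1,3)] by blast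
    qed
    show "\<Psi> ` carrier (SEM \<Omega>) = QF"
    proof (intro Set.set_eqI iffI)
      fix q assume "q \<in> \<Psi> ` carrier (SEM \<Omega>)"
      then obtain A where "A \<in> carrier (SEM \<Omega>)" "q = \<Psi> A" by blast
      then obtain f \<phi> where "has_stem f \<phi>" "q = \<Psi> (SEM_class \<Omega> f)" unfolding carrier_SEM by blast
      then show "q \<in> QF" using Psi_class[of f \<phi>] laurent_QF[OF has_stem_mstem[of f \<phi>]] by simp
    next
      fix q assume "q \<in> QF"
      then obtain \<phi> where \<phi>: "mstem \<phi>" "laurent \<phi> = q" by (rule QF_laurent)
      then have "\<Psi> (SEM_class \<Omega> (unstem \<phi>)) = q" using Psi_class[OF has_stem_unstem] by simp
      moreover have "SEM_class \<Omega> (unstem \<phi>) \<in> carrier (SEM \<Omega>)" using carrier_SEM has_stem_unstem[OF \<phi>(1)] by blast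
      ultimately show "q \<in> \<Psi> ` carrier (SEM \<Omega>)" by blast
    qed
  qed
next
  fix A B assume "A \<in> carrier (SEM \<Omega>)" "B \<in> carrier (SEM \<Omega>)"
  then obtain f \<phi> g \<psi> where fg: "has_stem f \<phi>" "A = SEM_class \<Omega> f" "has_stem g \<psi>" "B = SEM_class \<Omega> g"
    unfolding carrier_SEM by blast
  show "A \<oplus>\<^bsub>SEM \<Omega>\<^esub> B \<in> carrier (SEM \<Omega>)" "A \<otimes>\<^bsub>SEM \<Omega>\<^esub> B \<in> carrier (SEM \<Omega>)"
    unfolding fg(2,4) class_add[OF fg(1,3)] class_mult[OF fg(1,3)] carrier_SEM
    using has_stem_add[OF fg(1,3)] has_stem_star[OF fg(1,3)] by blast+
  show "\<Psi> (A \<oplus>\<^bsub>SEM \<Omega>\<^esub> B) = \<Psi> A + \<Psi> B" "\<Psi> (A \<otimes>\<^bsub>SEM \<Omega>\<^esub> B) = \<Psi> A * \<Psi> B"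
    unfolding fg(2,4) class_add[OF fg(1,3)] class_mult[OF fg(1,3)]
    using Psi_class[OF has_stem_add[OF fg(1,3)]] Psi_class[OF has_stem_star[OF fg(1,3)]] Psi_class[OF fg(1)] Psi_class[OF fg(3)]
      laurent_add laurent_mult has_stem_mstem[OF fg(1)] has_stem_mstem[OF fg(3)] by simp_all
next
  show "\<zero>\<^bsub>SEM \<Omega>\<^esub> \<in> carrier (SEM \<Omega>)" "\<one>\<^bsub>SEM \<Omega>\<^esub> \<in> carrier (SEM \<Omega>)"
    unfolding zero_one_SEM by (rule SEM_const_carrier)+
  show "\<Psi> \<zero>\<^bsub>SEM \<Omega>\<^esub> = 0" "\<Psi> \<one>\<^bsub>SEM \<Omega>\<^esub> = 1"
    unfolding zero_one_SEM Psi_const by (simp_all add: qalg_eq_iff)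
qed

end


section \<open>Conjugation, norm and square roots in coordinates\<close>

lemma quat_numeral_sel: "numeral n = Quat (numeral n) 0 0 0"
proof -
  have "(numeral n :: quat) = of_real (numeral n)" by simp
  also have "\<dots> = Quat (numeral n) 0 0 0" by (simp only: quat_eq_iff quat_of_real_sel quat.sel)
  finally show ?thesis .
qed

context circular_base
begin

text \<open>
  Values in the plane of \<open>i\<close> on the slice of \<open>i\<close>, at \<open>z\<close> and its conjugate, annihilate the last two coordinates of the
  stem; the slice of \<open>j\<close> annihilates the first and third vector coordinates.
\<close>

lemma SEM_R_eq: "SEM_R \<Omega> = Q.K"
proof (intro Set.set_eqI iffI)
  fix A assume "A \<in> SEM_R \<Omega>"
  then obtain f D where f: "A = SEM_class \<Omega> f" "semiregular_on \<Omega> D f" "slice_preserving D f"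
    unfolding SEM_R_def by blast
  obtain \<phi> where \<phi>: "mstem \<phi>" "\<And>q. q \<in> D \<Longrightarrow> f q = unstem \<phi> q"
    by (rule semiregular_stem[OF circ f(2)], rule that)
  have r: "has_stem f \<phi>" using \<phi> f(2) unfolding has_stem_def by blast
  have sym: "stem_symmetric \<phi>" using \<phi>(1) by (simp add: meromorphic_stem_def)
  have cD: "circular D" using semiregular_D[OF f(2)] by blast
  have sc: "co1 (\<phi> z) = 0 \<and> co2 (\<phi> z) = 0 \<and> co3 (\<phi> z) = 0" if z: "z \<in> plane D" for z
  proof -
    have val: "slice_val I (\<phi> w) \<in> complex_slice I" if I: "I \<in> imag_units" and w: "w \<in> plane D" for I w
    proof -
      let ?q = "slice_point I (Re w) (Im w)"
      have q: "?q \<in> D" using slice_point_in_iff[OF cD I] w by simp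
      have "?q \<in> complex_slice I" unfolding complex_slice_def by blast
      then have "f ?q \<in> complex_slice I" using f(3) I q unfolding slice_preserving_def by blast
      then show ?thesis using \<phi>(2)[OF q] by (simp add: unstem_slice_point[OF sym I])
    qed
    have slice: "\<exists>x y. p = slice_point I x y" if "p \<in> complex_slice I" for p I
      using that unfolding complex_slice_def by blast
    have cz: "cnj z \<in> plane D" using z cnj_in_plane_iff[OF cD] by simp
    have c: "\<phi> (cnj z) = conj_coords (\<phi> z)" using sym by (simp add: stem_symmetric_def)
    let ?J = "Quat 0 0 1 0"
    have J: "?J \<in> imag_units" by (simp add: imag_units_iff)
    have i: "qj (slice_val qI (\<phi> z)) = 0" "qk (slice_val qI (\<phi> z)) = 0"
      "qj (slice_val qI (\<phi> (cnj z))) = 0" "qk (slice_val qI (\<phi> (cnj z))) = 0"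
      using slice[OF val[OF qI_unit z]] slice[OF val[OF qI_unit cz]]
      by (auto simp: slice_point_sel) (auto simp: qI_def)
    have j: "qi (slice_val ?J (\<phi> z)) = 0" "qk (slice_val ?J (\<phi> z)) = 0"
      "qi (slice_val ?J (\<phi> (cnj z))) = 0" "qk (slice_val ?J (\<phi> (cnj z))) = 0"
      using slice[OF val[OF J z]] slice[OF val[OF J cz]]
      by (auto simp: slice_point_sel)
    show ?thesis
      using i j unfolding c
      by (simp add: slice_val_def quat_mult_sel complex_eq_iff qI_def)
  qed
  have ev: "eventually (\<lambda>z. z \<in> plane D) (at z0)"
    by (rule semiregular_eventually[OF f(2) circ z0])
  have "expansion (\<lambda>z. co1 (\<phi> z)) = expansion (\<lambda>_. 0)" "expansion (\<lambda>z. co2 (\<phi> z)) = expansion (\<lambda>_. 0)" "expansion (\<lambda>z. co3 (\<phi> z)) = expansion (\<lambda>_. 0)"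
    using sc by (simp_all add: expansion_eq_iff mstem_mero \<phi>(1) meromorphic_on_const) (auto intro: eventually_mono[OF ev])
  then have "qvec (laurent \<phi>) = 0" by (simp add: qalg_eq_iff expansion_const)
  then show "A \<in> Q.K" using r f(1) Psi_class[OF r] carrier_SEM by (auto simp: Q.K_def)
next
  fix A assume A: "A \<in> Q.K"
  then obtain f \<phi> where f: "has_stem f \<phi>" "A = SEM_class \<Omega> f" using Q.K_D(1) carrier_SEM by blast
  have v: "qvec (laurent \<phi>) = 0" using A Psi_class[OF f(1)] f(2) by (simp add: Q.K_def)
  define \<psi> where "\<psi> z = qscal (co0 (\<phi> z))" for z
  have m: "mstem \<psi>"
    by (rule mstem_I) (auto simp: \<psi>_def mstem_conj_sym[OF has_stem_mstem[OF f(1)]] mstem_mero[OF has_stem_mstem[OF f(1)]] conj_sym_def)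
  have "laurent \<psi> = laurent \<phi>" using v by (simp add: qalg_eq_iff \<psi>_def expansion_const)
  then have A': "A = SEM_class \<Omega> (unstem \<psi>)" using class_eq_iff[OF f(1) has_stem_unstem[OF m]] f(2) by simp
  obtain D where D: "semiregular_on \<Omega> D (unstem \<psi>)" using has_stem_unstem[OF m] unfolding has_stem_def by blast
  have sym: "stem_symmetric \<psi>" using m by (simp add: meromorphic_stem_def)
  have "slice_preserving D (unstem \<psi>)"
    unfolding slice_preserving_def complex_slice_def
  proof (intro ballI subsetI)
    fix I p assume I: "I \<in> imag_units" and "p \<in> unstem \<psi> ` (D \<inter> {slice_point I x y |x y. True})"
    then obtain x y where "p = unstem \<psi> (slice_point I x y)" by blast
    then have "p = slice_val I (qscal (co0 (\<phi> (Complex x y))))"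
      by (simp add: unstem_slice_point[OF sym I] \<psi>_def)
    then have "p = slice_point I (Re (co0 (\<phi> (Complex x y)))) (Im (co0 (\<phi> (Complex x y))))"
      by (simp add: slice_val_qscal slice_point_def)
    then show "p \<in> {slice_point I x y |x y. True}" by blast
  qed
  with D A' show "A \<in> SEM_R \<Omega>" unfolding SEM_R_def by blast
qed

lemma Psi_units:
  "\<Psi> (SEM_const \<Omega> (Quat 0 1 0 0)) = QA 0 1 0 0" "\<Psi> (SEM_const \<Omega> (Quat 0 0 1 0)) = QA 0 0 1 0"
  "\<Psi> (SEM_const \<Omega> (Quat 0 0 0 1)) = QA 0 0 0 1" "\<Psi> (SEM_const \<Omega> 2) = qscal 2"
  by (simp_all add: Psi_const qalg_eq_iff quat_numeral_sel)

abbreviation "S \<equiv> SEM \<Omega>"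

lemma Psi_decomposition:
  assumes "f0 \<in> Q.K" "f1 \<in> Q.K" "f2 \<in> Q.K" "f3 \<in> Q.K"
  shows "\<Psi> (f0 \<oplus>\<^bsub>S\<^esub> f1 \<otimes>\<^bsub>S\<^esub> SEM_const \<Omega> (Quat 0 1 0 0) \<oplus>\<^bsub>S\<^esub> f2 \<otimes>\<^bsub>S\<^esub> SEM_const \<Omega> (Quat 0 0 1 0)
      \<oplus>\<^bsub>S\<^esub> f3 \<otimes>\<^bsub>S\<^esub> SEM_const \<Omega> (Quat 0 0 0 1)) = QA (co0 (\<Psi> f0)) (co0 (\<Psi> f1)) (co0 (\<Psi> f2)) (co0 (\<Psi> f3))"
proof -
  obtain a b c d where "\<Psi> f0 = qscal a" "\<Psi> f1 = qscal b" "\<Psi> f2 = qscal c" "\<Psi> f3 = qscal d"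
    using Q.K_D(2) assms by blast
  then show ?thesis
    using Q.K_D(1)[OF assms(1)] Q.K_D(1)[OF assms(2)] Q.K_D(1)[OF assms(3)] Q.K_D(1)[OF assms(4)]
    by (simp add: Q.Psi_add Q.Psi_mult Psi_units SEM_const_carrier qalg_eq_iff co_mult)
qed

lemma SEM_re:
  assumes f: "f \<in> carrier S"
  shows "SEM_re \<Omega> f \<in> Q.K" "\<Psi> (SEM_re \<Omega> f) = qscal (co0 (\<Psi> f))"
proof -
  have "\<Psi> f \<in> QF" using f by (rule Q.Psi_QF)
  then obtain f0 f1 f2 f3 where K: "f0 \<in> Q.K" "f1 \<in> Q.K" "f2 \<in> Q.K" "f3 \<in> Q.K"
    and P: "\<Psi> f0 = qscal (co0 (\<Psi> f))" "\<Psi> f1 = qscal (co1 (\<Psi> f))" "\<Psi> f2 = qscal (co2 (\<Psi> f))" "\<Psi> f3 = qscal (co3 (\<Psi> f))"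
    using Q.K_surj QF_D by metis
  let ?d = "\<lambda>f0 f1 f2 f3. f0 \<oplus>\<^bsub>S\<^esub> f1 \<otimes>\<^bsub>S\<^esub> SEM_const \<Omega> (Quat 0 1 0 0) \<oplus>\<^bsub>S\<^esub> f2 \<otimes>\<^bsub>S\<^esub> SEM_const \<Omega> (Quat 0 0 1 0)
      \<oplus>\<^bsub>S\<^esub> f3 \<otimes>\<^bsub>S\<^esub> SEM_const \<Omega> (Quat 0 0 0 1)"
  have dc: "?d f0 f1 f2 f3 \<in> carrier S" if "f0 \<in> Q.K" "f1 \<in> Q.K" "f2 \<in> Q.K" "f3 \<in> Q.K" for f0 f1 f2 f3
    using that by (simp add: Q.K_D(1) SEM_const_carrier)
  have "\<Psi> (?d f0 f1 f2 f3) = \<Psi> f"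
    unfolding Psi_decomposition[OF K] P by simp
  then have fd: "f = ?d f0 f1 f2 f3" using Q.Psi_eq_iff[OF f dc[OF K]] by simp
  have re: "SEM_re \<Omega> f = f0"
    unfolding SEM_re_def SEM_R_eq
  proof (rule the_equality)
    show "f0 \<in> Q.K \<and> (\<exists>f1\<in>Q.K. \<exists>f2\<in>Q.K. \<exists>f3\<in>Q.K. f = ?d f0 f1 f2 f3)"
      using K fd by blast
    fix g0 assume "g0 \<in> Q.K \<and> (\<exists>f1\<in>Q.K. \<exists>f2\<in>Q.K. \<exists>f3\<in>Q.K. f = ?d g0 f1 f2 f3)"
    then obtain g1 g2 g3 where g: "g0 \<in> Q.K" "g1 \<in> Q.K" "g2 \<in> Q.K" "g3 \<in> Q.K" "f = ?d g0 g1 g2 g3" by blast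
    have "co0 (\<Psi> f) = co0 (\<Psi> g0)" unfolding g(5) Psi_decomposition[OF g(1-4)] by simp
    then have "\<Psi> g0 = \<Psi> f0" using Q.K_D(2)[OF g(1)] P(1) by simp
    then show "g0 = f0" using Q.Psi_eq_iff[OF Q.K_D(1)[OF g(1)] Q.K_D(1)[OF K(1)]] by simp
  qed
  show "SEM_re \<Omega> f \<in> Q.K" "\<Psi> (SEM_re \<Omega> f) = qscal (co0 (\<Psi> f))"
    unfolding re by (fact K(1), fact P(1))
qed

lemma SEM_vec:
  assumes f: "f \<in> carrier S"
  shows "SEM_vec \<Omega> f \<in> carrier S" "\<Psi> (SEM_vec \<Omega> f) = qvec (\<Psi> f)"
  using f SEM_re[OF f] Q.K_D(1) by (simp_all add: SEM_vec_def Q.Psi_diff) (simp add: qalg_eq_iff)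

lemma SEM_symm:
  assumes f: "f \<in> carrier S"
  shows "SEM_symm \<Omega> f \<in> carrier S" "\<Psi> (SEM_symm \<Omega> f) = qscal (qnrm (\<Psi> f))"
proof -
  have c: "SEM_conj \<Omega> f \<in> carrier S" "\<Psi> (SEM_conj \<Omega> f) = qconj (\<Psi> f)"
    using SEM_vec[OF f] SEM_re[OF f] Q.K_D(1) by (simp_all add: SEM_conj_def Q.Psi_diff) (simp add: qalg_eq_iff)
  then show "SEM_symm \<Omega> f \<in> carrier S" "\<Psi> (SEM_symm \<Omega> f) = qscal (qnrm (\<Psi> f))"
    using f by (simp_all add: SEM_symm_def Q.Psi_mult mult_qconj)
qed

lemma eq_zero_iff: "x \<in> carrier S \<Longrightarrow> x = \<zero>\<^bsub>S\<^esub> \<longleftrightarrow> \<Psi> x = 0"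
  using Q.Psi_eq_iff[OF _ Q.zero_cl] Q.Psi_zero by simp

lemma zero_divisor_iff:
  "SEM_zero_divisor \<Omega> x \<longleftrightarrow> x \<in> carrier S \<and> x \<noteq> \<zero>\<^bsub>S\<^esub> \<and> qnrm (\<Psi> x) = 0"
  unfolding SEM_zero_divisor_def using eq_zero_iff[OF SEM_symm(1)] SEM_symm(2) by auto

lemma has_sqrt_iff:
  assumes "x \<in> carrier S" "\<Psi> x = qscal c"
  shows "SEM_has_sqrt \<Omega> x \<longleftrightarrow> (\<exists>r\<in>F. c = r * r)"
proof
  assume "SEM_has_sqrt \<Omega> x"
  then obtain h where h: "h \<in> Q.K" "x = h [^]\<^bsub>S\<^esub> (2::nat)" unfolding SEM_has_sqrt_def SEM_R_eq by blast
  obtain r where r: "\<Psi> h = qscal r" "r \<in> F" using Q.K_D(2,3)[OF h(1)] by blast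
  have "qscal c = qscal (r * r)" using assms(2) Q.Psi_square[OF Q.K_D(1)[OF h(1)]] h(2) r(1) by simp
  then show "\<exists>r\<in>F. c = r * r" using r(2) by auto
next
  assume "\<exists>r\<in>F. c = r * r"
  then obtain r where r: "r \<in> F" "c = r * r" by blast
  obtain h where h: "h \<in> Q.K" "\<Psi> h = qscal r" using Q.K_surj[OF r(1)] by blast
  then have "x = h [^]\<^bsub>S\<^esub> (2::nat)"
    using assms r(2) Q.K_D(1)[OF h(1)] by (simp add: Q.Psi_eq_iff Q.Psi_square)
  then show "SEM_has_sqrt \<Omega> x" unfolding SEM_has_sqrt_def SEM_R_eq using h(1) by blast
qed

section \<open>Slice domains and product domains\<close>

text \<open>At a real base point the coordinates of a stem are real on the real axis, where a vanishing sum of four squares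
  forces all four to vanish.\<close>

lemma anisotropic_real_base:
  assumes "Im z0 = 0" "q \<in> QF" "qnrm q = 0"
  shows "q = 0"
proof -
  obtain \<phi> where \<phi>: "mstem \<phi>" "laurent \<phi> = q" by (rule QF_laurent[OF assms(2)])
  let ?s = "\<lambda>z. co0 (\<phi> z) * co0 (\<phi> z) + co1 (\<phi> z) * co1 (\<phi> z) + co2 (\<phi> z) * co2 (\<phi> z) + co3 (\<phi> z) * co3 (\<phi> z)"
  have "expansion ?s = qnrm q"
    unfolding \<phi>(2)[symmetric] qnrm_def
    by (simp add: expansion_simps meromorphic_on_mult meromorphic_on_add mstem_mero[OF \<phi>(1)])
  then have "expansion ?s = expansion (\<lambda>_. 0)" using assms(3) by (simp add: expansion_const)
  moreover have "?s meromorphic_on plane \<Omega>"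
    by (intro meromorphic_intros mstem_mero[OF \<phi>(1)])
  ultimately have ev: "eventually (\<lambda>z. ?s z = 0) (at z0)"
    using expansion_eq_iff[OF _ meromorphic_on_const] by blast
  have lim: "filterlim (\<lambda>t. z0 + of_real t) (at z0) (at_right (0::real))"
  proof (rule filterlim_atI)
    have "((\<lambda>t. z0 + of_real t) \<longlongrightarrow> z0 + of_real 0) (at_right (0::real))" by (intro tendsto_intros)
    then show "((\<lambda>t. z0 + of_real t) \<longlongrightarrow> z0) (at_right (0::real))" by simp
    show "eventually (\<lambda>t. z0 + of_real t \<noteq> z0) (at_right (0::real))"
      by (simp add: eventually_at_filter)
  qed
  have zero: "expansion (\<lambda>z. i (\<phi> z)) = 0" if i: "i \<in> coords" for i
  proof (rule ccontr)
    assume "expansion (\<lambda>z. i (\<phi> z)) \<noteq> 0"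
    moreover have "(\<lambda>z. i (\<phi> z)) meromorphic_on plane \<Omega>" using \<phi>(1) i by (simp add: meromorphic_stem_def)
    ultimately have "eventually (\<lambda>z. i (\<phi> z) \<noteq> 0) (at z0)"
      using has_laurent_expansion_eventually_nonzero_iff[of "\<lambda>z. i (\<phi> z)" z0, OF expansion_expansion] by blast
    with ev have "eventually (\<lambda>z. i (\<phi> z) \<noteq> 0 \<and> ?s z = 0) (at z0)" by eventually_elim simp
    then have "eventually (\<lambda>t. i (\<phi> (z0 + of_real t)) \<noteq> 0 \<and> ?s (z0 + of_real t) = 0) (at_right (0::real))"
      using lim by (rule eventually_compose_filterlim)
    then obtain t :: real where t: "i (\<phi> (z0 + of_real t)) \<noteq> 0" "?s (z0 + of_real t) = 0"
      using eventually_happens'[of "at_right (0::real)"] by auto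
    let ?w = "z0 + of_real t"
    have w: "cnj ?w = ?w" using assms(1) by (simp add: complex_eq_iff)
    have "j (\<phi> ?w) = of_real (Re (j (\<phi> ?w)))" if "j \<in> coords" for j
    proof -
      have "conj_sym (\<lambda>z. j (\<phi> z))" using \<phi>(1) that by (simp add: meromorphic_stem_def stem_conj_sym)
      from conj_symD[OF this, of ?w] have "Im (j (\<phi> ?w)) = 0" unfolding w by (simp add: complex_eq_iff)
      then show ?thesis by (simp add: complex_eq_iff)
    qed
    then obtain a b c d where r: "co0 (\<phi> ?w) = of_real a" "co1 (\<phi> ?w) = of_real b" "co2 (\<phi> ?w) = of_real c" "co3 (\<phi> ?w) = of_real d"
      unfolding coords_def by blast
    have "a * a + b * b + c * c + d * d = 0"
      using t(2) unfolding r by (metis of_real_add of_real_eq_0_iff of_real_mult)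
    then have "a = 0" "b = 0" "c = 0" "d = 0" by (simp_all add: add_nonneg_eq_0_iff)
    then show False using t(1) i r by (auto simp: coords_def)
  qed
  show ?thesis unfolding \<phi>(2)[symmetric] using zero by (simp add: qalg_eq_iff coords_def)
qed

text \<open>Off the real axis, the locally constant function \<open>\<plusminus>\<i>\<close> on the two half planes is a symmetric square root of \<open>-1\<close>.\<close>

lemma imaginary_unit_off_axis:
  assumes "\<And>z. z \<in> plane \<Omega> \<Longrightarrow> Im z \<noteq> 0"
  shows "\<exists>\<iota>\<in>F. \<iota> * \<iota> = - 1"
proof -
  define u :: "complex \<Rightarrow> complex" where "u z = \<i> * of_real (sgn (Im z))" for z
  have loc: "eventually (\<lambda>w. u w = \<i> * of_real (sgn (Im z))) (nhds z)" if "Im z \<noteq> 0" for z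
  proof -
    have "open {w. sgn (Im z) * Im w > 0}" by (intro open_Collect_less continuous_intros)
    moreover have "z \<in> {w. sgn (Im z) * Im w > 0}" using that by (auto simp: sgn_if)
    ultimately have "eventually (\<lambda>w. w \<in> {w. sgn (Im z) * Im w > 0}) (nhds z)" by (rule eventually_nhds_in_open)
    then show ?thesis by eventually_elim (auto simp: u_def sgn_if split: if_splits)
  qed
  have cs: "conj_sym u" by (simp add: conj_sym_def u_def sgn_minus)
  have "u meromorphic_on {z}" if "z \<in> plane \<Omega>" for z
  proof -
    have "eventually (\<lambda>w. u w = \<i> * of_real (sgn (Im z))) (at z)"
      using loc[OF assms[OF that]] by (simp add: eventually_at_filter eventually_mono)
    then show ?thesis
      using meromorphic_on_cong[of "{z}" u "\<lambda>_. \<i> * of_real (sgn (Im z))" "{z}"] meromorphic_on_const by blast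
  qed
  then have m: "u meromorphic_on plane \<Omega>" using meromorphic_on_meromorphic_at by blast
  have "eventually (\<lambda>w. u w * u w = - 1) (at z0)"
    using loc[OF assms[OF z0]] assms[OF z0] unfolding eventually_at_filter
    by (auto elim!: eventually_mono simp: sgn_if)
  then have "expansion (\<lambda>z. u z * u z) = expansion (\<lambda>_. - 1)"
    using expansion_eq_iff[OF meromorphic_on_mult[OF m m] meromorphic_on_const] by blast
  moreover have "fls_const (- 1 :: complex) = - 1" by (intro fls_eqI) simp
  ultimately have "expansion u * expansion u = - 1" unfolding expansion_simps(4)[OF m m] expansion_const by simp
  then show ?thesis using F_I[OF cs m] by blast
qed

end

lemma meromorphic_zero_propagates:
  assumes "open A" "connected A" "u meromorphic_on A" "eventually (\<lambda>w. u w = 0) (at a)" "a \<in> A" "z \<in> A"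
  shows "eventually (\<lambda>w. u w = 0) (at z)"
proof -
  consider "eventually (\<lambda>w. u w = 0) (cosparse A)" | "eventually (\<lambda>w. u w \<noteq> 0) (cosparse A)"
    using meromorphic_imp_constant_or_avoid[OF assms(3,1,2), of 0] by blast
  then show ?thesis
  proof cases
    case 1
    then show ?thesis using assms(1,6) by (simp add: eventually_cosparse_open_eq)
  next
    case 2
    then have "eventually (\<lambda>w. u w \<noteq> 0) (at a)" using assms(1,5) by (simp add: eventually_cosparse_open_eq)
    with assms(4) have "eventually (\<lambda>w. False) (at a)" by eventually_elim simp
    then show ?thesis by simp
  qed
qed

lemma slice_domain_iff_real:
  assumes "circular_domain \<Omega>"
  shows "slice_domain \<Omega> \<longleftrightarrow> (\<exists>z\<in>plane \<Omega>. Im z = 0)"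
proof
  assume "slice_domain \<Omega>"
  then obtain r where "of_real r \<in> \<Omega>" unfolding slice_domain_def by (auto elim!: Reals_cases)
  then show "\<exists>z\<in>plane \<Omega>. Im z = 0" by (intro bexI[of _ "of_real r"]) (simp_all add: plane_def slice_point_def)
next
  assume "\<exists>z\<in>plane \<Omega>. Im z = 0"
  then obtain z where "slice_point qI (Re z) 0 \<in> \<Omega>" by (auto simp: plane_def)
  then have "of_real (Re z) \<in> \<Omega> \<inter> \<real>" by (simp add: slice_point_def)
  then show "slice_domain \<Omega>" unfolding slice_domain_def using assms by blast
qed

text \<open>
  The image of \<open>\<Omega>\<close> under \<open>qcoord\<close> is the part of the planar section in the closed upper half plane, and it is connected. If
  it meets the real axis, its union with its mirror image is connected, and the usual identity theorem holds for
  any base point, in particular for a real one. Otherwise the identity theorem holds on the upper half, and symmetry takes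
  care of the lower one.
\<close>

lemma base_point_exists:
  assumes \<Omega>: "circular_domain \<Omega>" and "\<Omega> \<noteq> {}"
  obtains z0 where "circular_base \<Omega> z0" "slice_domain \<Omega> \<Longrightarrow> Im z0 = 0"
proof -
  have o: "open \<Omega>" and c: "circular \<Omega>" and conn: "connected \<Omega>"
    using \<Omega> by (simp_all add: circular_domain_def)
  define P where "P = qcoord ` \<Omega>"
  have P: "P = {z \<in> plane \<Omega>. Im z \<ge> 0}"
  proof (intro Set.set_eqI iffI)
    fix z assume "z \<in> P"
    then show "z \<in> {z \<in> plane \<Omega>. Im z \<ge> 0}"
      using qcoord_in_iff[OF c] Im_qcoord_nonneg by (auto simp: P_def)
  next
    fix z assume z: "z \<in> {z \<in> plane \<Omega>. Im z \<ge> 0}"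
    then have "qcoord (slice_point qI (Re z) (Im z)) = z" by (simp add: qcoord_slice_point qI_unit)
    moreover have "slice_point qI (Re z) (Im z) \<in> \<Omega>" using z by (simp add: plane_def)
    ultimately show "z \<in> P" unfolding P_def by (metis imageI)
  qed
  have connP: "connected P"
    unfolding P_def using conn continuous_on_subset[OF continuous_on_qcoord] by (intro connected_continuous_image) auto
  show ?thesis
  proof (cases "slice_domain \<Omega>")
    case True
    then obtain z0 where z0: "z0 \<in> plane \<Omega>" "Im z0 = 0" using slice_domain_iff_real[OF \<Omega>] by blast
    have "cnj z0 = z0" using z0(2) by (simp add: complex_eq_iff)
    moreover have z0P: "z0 \<in> P" using P z0 by simp
    ultimately have "P \<inter> cnj ` P \<noteq> {}" by (metis IntI empty_iff imageI)
    moreover have "connected (cnj ` P)"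
      using connP by (intro connected_continuous_image continuous_intros) auto
    ultimately have "connected (P \<union> cnj ` P)" using connP by (intro connected_Un)
    moreover have "P \<union> cnj ` P = plane \<Omega>"
    proof (intro Set.set_eqI iffI)
      fix z assume "z \<in> P \<union> cnj ` P"
      then show "z \<in> plane \<Omega>" using cnj_in_plane_iff[OF c] unfolding P by auto
    next
      fix z assume z: "z \<in> plane \<Omega>"
      show "z \<in> P \<union> cnj ` P"
      proof (cases "Im z \<ge> 0")
        case False
        then have "cnj z \<in> P" using z cnj_in_plane_iff[OF c] unfolding P by simp
        then have "cnj (cnj z) \<in> cnj ` P" by (rule imageI)
        then show ?thesis by simp
      qed (use z P in simp)
    qed
    ultimately have cp: "connected (plane \<Omega>)" by simp
    have "circular_base \<Omega> z0"
    proof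
      fix u z assume "conj_sym u" "u meromorphic_on plane \<Omega>" "eventually (\<lambda>w. u w = 0) (at z0)" "z \<in> plane \<Omega>"
      then show "eventually (\<lambda>w. u w = 0) (at z)"
        using meromorphic_zero_propagates[OF open_plane[OF o] cp] z0(1) by blast
    qed (fact o c z0(1))+
    then show ?thesis using that z0(2) by blast
  next
    case False
    then have nr: "Im z \<noteq> 0" if "z \<in> plane \<Omega>" for z using slice_domain_iff_real[OF \<Omega>] that by blast
    obtain z0 where z0: "z0 \<in> P" using assms(2) by (auto simp: P_def)
    have P': "P = plane \<Omega> \<inter> {z. Im z > 0}" using P nr by (auto simp: less_le)
    have oP: "open P" unfolding P' using open_plane[OF o] open_halfspace_Im_gt by (rule open_Int)
    have "circular_base \<Omega> z0"
    proof
      show "z0 \<in> plane \<Omega>" using z0 P by simp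
      fix u z assume u: "conj_sym u" "u meromorphic_on plane \<Omega>" "eventually (\<lambda>w. u w = 0) (at z0)" and z: "z \<in> plane \<Omega>"
      have "u meromorphic_on P" using u(2) by (rule meromorphic_on_subset) (auto simp: P)
      then have vanish: "eventually (\<lambda>w. u w = 0) (at w)" if "w \<in> P" for w
        using meromorphic_zero_propagates[OF oP connP _ u(3) z0 that] by blast
      show "eventually (\<lambda>w. u w = 0) (at z)"
      proof (cases "z \<in> P")
        case True then show ?thesis by (rule vanish)
      next
        case False
        then have "cnj z \<in> P" using z nr cnj_in_plane_iff[OF c] unfolding P' by (auto simp: not_less less_le)
        from vanish[OF this] have ev: "eventually (\<lambda>w. u w = 0) (at (cnj z))" .
        have "filterlim cnj (at (cnj z)) (at z)"
        proof (rule filterlim_atI)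
          show "(cnj \<longlongrightarrow> cnj z) (at z)" by (intro tendsto_intros)
          show "eventually (\<lambda>w. cnj w \<noteq> cnj z) (at z)" by (simp add: eventually_at_filter)
        qed
        with ev have "eventually (\<lambda>w. u (cnj w) = 0) (at z)" by (rule eventually_compose_filterlim)
        then show ?thesis by eventually_elim (simp add: conj_symD[OF u(1)])
      qed
    qed (fact o c)+
    then show ?thesis using that False by blast
  qed
qed


section \<open>Ranks of Sylvester operators\<close>

theorem mainTheorem1:
  fixes \<Omega> :: "quat set" and f g :: "(quat \<Rightarrow> quat) set" and R (structure)
  assumes "circular_domain \<Omega>"
    and "R = SEM \<Omega>"
    and "f \<in> carrier R - SEM_R \<Omega>"
    and "g \<in> carrier R - SEM_R \<Omega>"
  shows
    "let f0 = SEM_re \<Omega> f; g0 = SEM_re \<Omega> g;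
         fv = SEM_vec \<Omega> f; gv = SEM_vec \<Omega> g;
         Nf = SEM_symm \<Omega> fv; Ng = SEM_symm \<Omega> gv;
         d = (f0 \<oplus> g0) [^] (2::nat) \<otimes> ((f0 \<oplus> g0) [^] (2::nat) \<oplus> SEM_const \<Omega> 2 \<otimes> (Nf \<oplus> Ng))
               \<oplus> (Nf \<ominus> Ng) [^] (2::nat);
         rk = SEM_rk \<Omega> (Sylvester \<Omega> f g);
         Ker = SEM_ker \<Omega> (Sylvester \<Omega> f g)
     in
       rk > 1 \<and>
       (rk = 4 \<longleftrightarrow> d \<noteq> \<zero>) \<and>
       (rk = 3 \<longleftrightarrow> d = \<zero> \<and> f0 \<oplus> g0 \<noteq> \<zero>) \<and>
       (rk = 3 \<longleftrightarrow> Ker \<noteq> {\<zero>} \<and> (\<forall>X\<in>Ker - {\<zero>}. SEM_zero_divisor \<Omega> X)) \<and>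
       (rk = 3 \<longrightarrow> product_domain \<Omega>) \<and>
       (rk = 2 \<longleftrightarrow> SEM_equiv \<Omega> f (\<ominus> g)) \<and>
       (rk = 2 \<longleftrightarrow> f0 \<oplus> g0 = \<zero> \<and> Nf = Ng) \<and>
       (rk = 2 \<longleftrightarrow> (\<exists>X\<in>Ker. X \<in> Units R)) \<and>
       (rk = 2 \<longrightarrow>
         ((\<exists>X\<in>Ker. SEM_zero_divisor \<Omega> X) \<longleftrightarrow>
           product_domain \<Omega> \<and>
           (fv = gv \<and> SEM_has_sqrt \<Omega> Nf \<or>
            fv \<noteq> gv \<and> SEM_symm \<Omega> (fv \<ominus> gv) = \<zero> \<or>
            SEM_symm \<Omega> (fv \<ominus> gv) \<noteq> \<zero> \<and> SEM_has_sqrt \<Omega> Nf)))"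
proof -
  let ?S = "SEM \<Omega>"
  have R: "R = ?S" by (fact assms(2))
  have f: "f \<in> carrier ?S" "f \<notin> SEM_R \<Omega>" and g: "g \<in> carrier ?S" "g \<notin> SEM_R \<Omega>"
    using assms(3,4) unfolding R by auto
  \<comment> \<open>Over the empty set every function is slice preserving, so no class lies outside \<open>SEM_R\<close>.\<close>
  have "\<Omega> \<noteq> {}"
  proof
    assume "\<Omega> = {}"
    then have sr: "semiregular_on \<Omega> {} h" for h
      by (simp add: semiregular_on_def circular_def slice_regular_def)
        (intro exI[of _ "\<lambda>_ _. 0"], simp)
    obtain h where "f = SEM_class \<Omega> h"
      using f(1) by (auto simp: SEM_def quotient_def SEM_class_def)
    then have "f \<in> SEM_R \<Omega>" unfolding SEM_R_def using sr[of h] by (auto simp: slice_preserving_def)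
    with f(2) show False by blast
  qed
  then obtain z0 where base: "circular_base \<Omega> z0" and real_base: "slice_domain \<Omega> \<Longrightarrow> Im z0 = 0"
    using base_point_exists[OF assms(1)] by blast
  interpret circular_base \<Omega> z0 by (fact base)
  interpret M: sylvester_model F ?S \<Psi> f g
    by unfold_locales (use f g SEM_R_eq in auto)
  define f0 g0 fv gv where "f0 = SEM_re \<Omega> f" and "g0 = SEM_re \<Omega> g"
    and "fv = SEM_vec \<Omega> f" and "gv = SEM_vec \<Omega> g"
  define Nf Ng where "Nf = SEM_symm \<Omega> fv" and "Ng = SEM_symm \<Omega> gv"
  define t where "t = f0 \<oplus>\<^bsub>?S\<^esub> g0"
  define d where "d = t [^]\<^bsub>?S\<^esub> (2::nat) \<otimes>\<^bsub>?S\<^esub> (t [^]\<^bsub>?S\<^esub> (2::nat) \<oplus>\<^bsub>?S\<^esub> SEM_const \<Omega> 2 \<otimes>\<^bsub>?S\<^esub> (Nf \<oplus>\<^bsub>?S\<^esub> Ng))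
      \<oplus>\<^bsub>?S\<^esub> (Nf \<ominus>\<^bsub>?S\<^esub> Ng) [^]\<^bsub>?S\<^esub> (2::nat)"
  have c0: "f0 \<in> carrier ?S" "g0 \<in> carrier ?S" "\<Psi> f0 = qscal (co0 (\<Psi> f))" "\<Psi> g0 = qscal (co0 (\<Psi> g))"
    unfolding f0_def g0_def using SEM_re[OF f(1)] SEM_re[OF g(1)] Q.K_D(1) by auto
  have cv: "fv \<in> carrier ?S" "gv \<in> carrier ?S" "\<Psi> fv = M.vf" "\<Psi> gv = M.vg"
    unfolding fv_def gv_def M.vf_def M.vg_def using SEM_vec[OF f(1)] SEM_vec[OF g(1)] by auto
  have cN: "Nf \<in> carrier ?S" "Ng \<in> carrier ?S" "\<Psi> Nf = qscal (qnrm M.vf)" "\<Psi> Ng = qscal (qnrm M.vg)"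
    unfolding Nf_def Ng_def using SEM_symm[OF cv(1)] SEM_symm[OF cv(2)] cv(3,4) by auto
  have ct: "t \<in> carrier ?S" "\<Psi> t = qscal M.tr"
    unfolding t_def using c0 by (simp_all add: Q.Psi_add M.tr_def)
  have cd: "d \<in> carrier ?S" "\<Psi> d = qscal M.disc"
    unfolding d_def using ct cN
    by (simp_all add: Q.Psi_simps Psi_units SEM_const_carrier sylv_disc_def)
  have t0: "t = \<zero>\<^bsub>?S\<^esub> \<longleftrightarrow> M.tr = 0" and d0: "d = \<zero>\<^bsub>?S\<^esub> \<longleftrightarrow> M.disc = 0"
    using eq_zero_iff[OF ct(1)] ct(2) eq_zero_iff[OF cd(1)] cd(2) by simp_all
  have N0: "Nf = Ng \<longleftrightarrow> qnrm M.vf = qnrm M.vg"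
    using Q.Psi_eq_iff[OF cN(1,2)] cN(3,4) by simp
  have op: "Sylvester \<Omega> f g = Q.sylvester f g"
    by (simp add: fun_eq_iff Sylvester_def Q.sylvester_def)
  define rk where "rk = SEM_rk \<Omega> (Sylvester \<Omega> f g)"
  have rk: "rk = M.rk"
    unfolding rk_def SEM_rk_def op SEM_R_eq ..
  have ker: "SEM_ker \<Omega> (Sylvester \<Omega> f g) = M.ker"
  proof -
    have "Q.sylvester f g x = \<zero>\<^bsub>?S\<^esub> \<longleftrightarrow> \<Psi> f * \<Psi> x + \<Psi> x * \<Psi> g = 0" if x: "x \<in> carrier ?S" for x
    proof -
      have "Q.sylvester f g x \<in> carrier ?S" using x f(1) g(1) by (simp add: Q.sylvester_def)
      then show ?thesis by (simp only: eq_zero_iff Q.Psi_sylvester[OF f(1) g(1) x])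
    qed
    then show ?thesis unfolding SEM_ker_def a_kernel_def' op M.ker_def by blast
  qed
  note cases = M.rank_cases[folded rk]
  have zd: "SEM_zero_divisor \<Omega> x \<longleftrightarrow> qnrm (\<Psi> x) = 0" if "x \<in> M.ker - {\<zero>\<^bsub>?S\<^esub>}" for x
    using that M.ker_D(1)[of x] by (simp add: zero_divisor_iff)
  have no_isotropic: "\<not> slice_domain \<Omega>" if "q \<in> QF" "q \<noteq> 0" "qnrm q = 0" for q
    using anisotropic_real_base[OF real_base that(1,3)] that(2) by blast
  have product: "product_domain \<Omega> \<longleftrightarrow> \<not> slice_domain \<Omega>"
    using assms(1) by (simp add: product_domain_def)
  have ex_zd: "(\<exists>x\<in>M.ker. SEM_zero_divisor \<Omega> x) \<longleftrightarrow> (\<exists>x\<in>M.ker. x \<noteq> \<zero>\<^bsub>?S\<^esub> \<and> qnrm (\<Psi> x) = 0)"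
    unfolding zero_divisor_iff using M.ker_D(1) by blast
  have "rk > 1" using cases by auto
  moreover have "rk = 4 \<longleftrightarrow> d \<noteq> \<zero>\<^bsub>?S\<^esub>" using cases d0 by auto
  moreover have "rk = 3 \<longleftrightarrow> d = \<zero>\<^bsub>?S\<^esub> \<and> t \<noteq> \<zero>\<^bsub>?S\<^esub>" using cases d0 t0 by auto
  moreover have "rk = 3 \<longleftrightarrow> M.ker \<noteq> {\<zero>\<^bsub>?S\<^esub>} \<and> (\<forall>x\<in>M.ker - {\<zero>\<^bsub>?S\<^esub>}. SEM_zero_divisor \<Omega> x)"
    using M.rank_3_iff_ker[folded rk] zd by blast
  moreover have "rk = 3 \<longrightarrow> product_domain \<Omega>"
    using M.rank_3_isotropic[folded rk] no_isotropic product by blast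
  moreover have "rk = 2 \<longleftrightarrow> SEM_equiv \<Omega> f (\<ominus>\<^bsub>?S\<^esub> g)"
    unfolding SEM_equiv_def M.unit_in_ker_iff_similar[symmetric] rk by (rule M.rank_2_iff_unit)
  moreover have "rk = 2 \<longleftrightarrow> t = \<zero>\<^bsub>?S\<^esub> \<and> Nf = Ng"
    using cases t0 N0 M.disc_trace_zero by auto
  moreover have "rk = 2 \<longleftrightarrow> (\<exists>x\<in>M.ker. x \<in> Units ?S)"
    unfolding rk by (rule M.rank_2_iff_unit)
  moreover have "rk = 2 \<longrightarrow> ((\<exists>x\<in>M.ker. SEM_zero_divisor \<Omega> x) \<longleftrightarrow>
      product_domain \<Omega> \<and>
      (fv = gv \<and> SEM_has_sqrt \<Omega> Nf \<or>
       fv \<noteq> gv \<and> SEM_symm \<Omega> (fv \<ominus>\<^bsub>?S\<^esub> gv) = \<zero>\<^bsub>?S\<^esub> \<or>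
       SEM_symm \<Omega> (fv \<ominus>\<^bsub>?S\<^esub> gv) \<noteq> \<zero>\<^bsub>?S\<^esub> \<and> SEM_has_sqrt \<Omega> Nf))"
  proof (intro impI)
    assume r2: "rk = 2"
    show "(\<exists>x\<in>M.ker. SEM_zero_divisor \<Omega> x) \<longleftrightarrow>
      product_domain \<Omega> \<and>
      (fv = gv \<and> SEM_has_sqrt \<Omega> Nf \<or>
       fv \<noteq> gv \<and> SEM_symm \<Omega> (fv \<ominus>\<^bsub>?S\<^esub> gv) = \<zero>\<^bsub>?S\<^esub> \<or>
       SEM_symm \<Omega> (fv \<ominus>\<^bsub>?S\<^esub> gv) \<noteq> \<zero>\<^bsub>?S\<^esub> \<and> SEM_has_sqrt \<Omega> Nf)"
    proof (cases "slice_domain \<Omega>")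
      case True
      then have "\<not> (\<exists>x\<in>M.ker. x \<noteq> \<zero>\<^bsub>?S\<^esub> \<and> qnrm (\<Psi> x) = 0)"
        using no_isotropic Q.Psi_QF M.ker_D(1) M.ker_nonzero by blast
      then show ?thesis using ex_zd product True by blast
    next
      case False
      then have "Im z \<noteq> 0" if "z \<in> plane \<Omega>" for z
        using slice_domain_iff_real[OF assms(1)] that by blast
      then obtain \<iota> where i: "\<iota> \<in> F" "\<iota> * \<iota> = - 1" using imaginary_unit_off_axis by blast
      have dv: "fv \<ominus>\<^bsub>?S\<^esub> gv \<in> carrier ?S" "\<Psi> (fv \<ominus>\<^bsub>?S\<^esub> gv) = M.vf - M.vg"
        using cv by (simp_all add: Q.Psi_diff)
      have "SEM_symm \<Omega> (fv \<ominus>\<^bsub>?S\<^esub> gv) = \<zero>\<^bsub>?S\<^esub> \<longleftrightarrow> qnrm (M.vf - M.vg) = 0"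
        using eq_zero_iff[OF SEM_symm(1)[OF dv(1)]] SEM_symm(2)[OF dv(1)] dv(2) by simp
      moreover have "fv = gv \<longleftrightarrow> M.vf = M.vg" using Q.Psi_eq_iff[OF cv(1,2)] cv(3,4) by simp
      moreover have "SEM_has_sqrt \<Omega> Nf \<longleftrightarrow> (\<exists>r\<in>F. qnrm M.vf = r * r)"
        by (rule has_sqrt_iff[OF cN(1,3)])
      moreover have "product_domain \<Omega>" using product False by blast
      ultimately show ?thesis
        using M.ker_zero_divisor_cases[OF r2[unfolded rk] i] unfolding ex_zd by simp
    qed
  qed
  ultimately show ?thesis
    unfolding R Let_def ker f0_def[symmetric] g0_def[symmetric] fv_def[symmetric] gv_def[symmetric]
      Nf_def[symmetric] Ng_def[symmetric] t_def[symmetric] d_def[symmetric] rk_def[symmetric]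
    by (intro conjI)
qed

end
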